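(* Let $X \subset \mathbb{R}^N$, $N \in \mathbb{N}$, be a Borel set, $\mu$ a Borel probability measure on $X$ and $T\colon X \to X$ a locally Lipschitz map. Then a prevalent locally Lipschitz observable $h \colon X \to \mathbb{R}$ (i.e. every $h$ in some prevalent subset of $\mathrm{Lip}_{loc}(X)$) is almost surely deterministically $k$-predictable with respect to $\mu$ for every $k\in\mathbb{N}$ with $k > \dim_H \mu$. If $\mu$ is $T$-invariant, then the full $\mu$-measure Borel set $X_h\subset X$ from the definition of almost sure deterministic $k$-predictability can be chosen to satisfy $T(X_h) \subset X_h$, so that $\phi\circ T=S\circ\phi$ on $X_h$ with $S\colon\phi(X_h)\to\phi(X_h)$, where $\phi(x)=(h(x),\dots,h(T^{k-1}x))$ is the $k$-delay coordinate map, $\phi(X_h)$ is a Borel set and $S$ is a Borel prediction map. Furthermore, if $X$ is compact and $k > \dim_H(\operatorname{supp} \mu)$, then $S$ is continuous (on $\phi(X_h)$, for a suitable choice of the full-measure set $X_h$) for a prevalent locally Lipschitz observable $h$.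
   Context: $\mathbb{N}=\{1,2,\dots\}$. $\dim_H\mu$ is the infimum of the Hausdorff dimensions of Borel sets of full $\mu$-measure. $\operatorname{supp}\mu$ is the smallest closed set of full $\mu$-measure. A function or map on $X$ is locally Lipschitz if every $x\in X$ has an open neighbourhood $U$ such that its restriction to $U\cap X$ is Lipschitz; $\mathrm{Lip}_{loc}(X)$ is the linear space of locally Lipschitz functions $X\to\mathbb{R}$. A Borel observable $h$ is almost surely deterministically $k$-predictable with respect to $\mu$ if there is a Borel set $X_h\subset X$ of full $\mu$-measure such that for all $x_1,x_2\in X_h$, $\phi(x_1)=\phi(x_2)$ implies $\phi(Tx_1)=\phi(Tx_2)$. Equivalently, there is a map $S\colon\phi(X_h)\to\phi(X)$ (the prediction map) with $\phi(Tx)=S(\phi(x))$ for all $x\in X_h$. Prevalence: fix a countable basis $\{U_1,U_2,\dots\}$ of the topology of $\mathbb{R}^N$ consisting of bounded sets. For $f\colon Y\to\mathbb R$ put $\|f\|_{1,Y}=\sup_{Y}|f|+\sup_{x\neq y}|f(x)-f(y)|/\|x-y\|\in[0,\infty]$. $V=\mathrm{Lip}_{loc}(X)$ is equipped with the metric $d(h,\tilde h)=\sum_{n\ge1}2^{-n}\min\{1,\|h-\tilde h\|_{1,U_n\cap X}\}$. A Borel set $\mathcal S\subset V$ is prevalent if there is a Borel measure $\nu$ on $V$, positive and finite on some compact subset of $V$, such that for every $v\in V$ we have $v+e\in\mathcal S$ for $\nu$-almost every $e\in V$. A non-Borel subset of $V$ is prevalent if it contains a prevalent Borel subset. *)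

theory Defs
  imports "HOL-Probability.Probability"
begin

text \<open>Hausdorff measure and dimension. Covering sets are required to be bounded because
  \<^const>\<open>diameter\<close> is only meaningful for bounded sets; only exponents \<open>s > 0\<close> are used, so the
  convention for \<open>0\<close> to the power \<open>0\<close> plays no role.\<close>

definition hausdorff_premeasure :: "real \<Rightarrow> real \<Rightarrow> 'a::metric_space set \<Rightarrow> ennreal" where
  "hausdorff_premeasure s \<delta> A =
     (INF C \<in> {C :: nat \<Rightarrow> 'a set. A \<subseteq> (\<Union>i. C i) \<and> (\<forall>i. bounded (C i) \<and> diameter (C i) \<le> \<delta>)}.
        \<Sum>i. ennreal (diameter (C i) powr s))"

definition hausdorff_measure :: "real \<Rightarrow> 'a::metric_space set \<Rightarrow> ennreal" where
  "hausdorff_measure s A = (SUP \<delta> \<in> {0<..}. hausdorff_premeasure s \<delta> A)"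

definition hausdorff_dim :: "'a::metric_space set \<Rightarrow> ennreal" where
  "hausdorff_dim A = (INF s \<in> {s. 0 < s \<and> hausdorff_measure s A = 0}. ennreal s)"

definition full_measure_set :: "'a measure \<Rightarrow> 'a set \<Rightarrow> bool" where
  "full_measure_set \<mu> A \<longleftrightarrow> A \<in> sets \<mu> \<and> emeasure \<mu> (space \<mu> - A) = 0"

definition hausdorff_dim_measure :: "'a::metric_space measure \<Rightarrow> ennreal" where
  "hausdorff_dim_measure \<mu> = (INF A \<in> {A. full_measure_set \<mu> A}. hausdorff_dim A)"

text \<open>The smallest (relatively) closed set of full measure. In a second countable space the
  intersection below is itself closed and of full measure.\<close>

definition measure_support :: "'a::topological_space measure \<Rightarrow> 'a set" where
  "measure_support \<mu> =
     \<Inter>{C. closedin (top_of_set (space \<mu>)) C \<and> full_measure_set \<mu> C}"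

definition invariant_measure :: "'a measure \<Rightarrow> ('a \<Rightarrow> 'a) \<Rightarrow> bool" where
  "invariant_measure \<mu> T \<longleftrightarrow> (\<forall>A \<in> sets \<mu>. emeasure \<mu> (T -` A \<inter> space \<mu>) = emeasure \<mu> A)"

definition borel_of :: "'a topology \<Rightarrow> 'a measure" where
  "borel_of \<tau> = sigma (topspace \<tau>) {W. openin \<tau> W}"

definition locally_lipschitz_on :: "'a::metric_space set \<Rightarrow> ('a \<Rightarrow> 'b::metric_space) \<Rightarrow> bool" where
  "locally_lipschitz_on X f \<longleftrightarrow>
     (\<forall>x\<in>X. \<exists>W. open W \<and> x \<in> W \<and> (\<exists>L. L-lipschitz_on (W \<inter> X) f))"

text \<open>The space \<open>Lip\<^sub>l\<^sub>o\<^sub>c(X)\<close>. Functions on \<open>X\<close> are represented by total functions that take the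
  fixed value \<^const>\<open>undefined\<close> outside \<open>X\<close>, so that equality is equality on \<open>X\<close>.\<close>

definition lip_loc :: "'a::metric_space set \<Rightarrow> ('a \<Rightarrow> real) set" where
  "lip_loc X = {h \<in> extensional X. locally_lipschitz_on X h}"

definition lip_norm :: "'a::real_normed_vector set \<Rightarrow> ('a \<Rightarrow> real) \<Rightarrow> ennreal" where
  "lip_norm Y f =
     (SUP x\<in>Y. ennreal \<bar>f x\<bar>) +
     (SUP (x, y) \<in> {(x, y). x \<in> Y \<and> y \<in> Y \<and> x \<noteq> y}. ennreal (\<bar>f x - f y\<bar> / norm (x - y)))"

text \<open>The basis is enumerated from \<open>0\<close>, so \<open>U n\<close> carries the weight \<open>2\<close> to the power \<open>-(n + 1)\<close>.\<close>

definition lip_dist ::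
  "(nat \<Rightarrow> 'a::real_normed_vector set) \<Rightarrow> 'a set \<Rightarrow> ('a \<Rightarrow> real) \<Rightarrow> ('a \<Rightarrow> real) \<Rightarrow> real" where
  "lip_dist U X h h' =
     (\<Sum>n. (1/2) ^ Suc n * enn2real (min 1 (lip_norm (U n \<inter> X) (\<lambda>x. h x - h' x))))"

definition lip_topology ::
  "(nat \<Rightarrow> 'a::real_normed_vector set) \<Rightarrow> 'a set \<Rightarrow> ('a \<Rightarrow> real) topology" where
  "lip_topology U X = Metric_space.mtopology (lip_loc X) (lip_dist U X)"

definition borel_prevalent ::
  "(nat \<Rightarrow> 'a::real_normed_vector set) \<Rightarrow> 'a set \<Rightarrow> ('a \<Rightarrow> real) set \<Rightarrow> bool" where
  "borel_prevalent U X S \<longleftrightarrow>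
     S \<in> sets (borel_of (lip_topology U X)) \<and>
     (\<exists>\<nu>. sets \<nu> = sets (borel_of (lip_topology U X)) \<and>
        (\<exists>K. compactin (lip_topology U X) K \<and> 0 < emeasure \<nu> K \<and> emeasure \<nu> K < \<infinity>) \<and>
        (\<forall>v \<in> lip_loc X. AE e in \<nu>. (\<lambda>x\<in>X. v x + e x) \<in> S))"

text \<open>For Borel \<open>S\<close> this agrees with \<^const>\<open>borel_prevalent\<close>, which is inherited by Borel supersets.\<close>

definition prevalent ::
  "(nat \<Rightarrow> 'a::real_normed_vector set) \<Rightarrow> 'a set \<Rightarrow> ('a \<Rightarrow> real) set \<Rightarrow> bool" where
  "prevalent U X S \<longleftrightarrow> S \<subseteq> lip_loc X \<and> (\<exists>S'\<subseteq>S. borel_prevalent U X S')"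

text \<open>The \<open>k\<close>-delay coordinate map takes values in \<^term>\<open>Euclidean_space k\<close>, the library's model of
  \<open>k\<close>-dimensional Euclidean space by real sequences that vanish from index \<open>k\<close> on.\<close>

definition delay_map :: "('a \<Rightarrow> 'a) \<Rightarrow> ('a \<Rightarrow> real) \<Rightarrow> nat \<Rightarrow> 'a \<Rightarrow> nat \<Rightarrow> real" where
  "delay_map T h k x = (\<lambda>i. if i < k then h ((T ^^ i) x) else 0)"

text \<open>\<open>Xh\<close> is a set witnessing almost sure deterministic \<open>k\<close>-predictability of \<open>h\<close>.\<close>

definition predictability_set ::
  "'a measure \<Rightarrow> ('a \<Rightarrow> 'a) \<Rightarrow> nat \<Rightarrow> ('a \<Rightarrow> real) \<Rightarrow> 'a set \<Rightarrow> bool" where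
  "predictability_set \<mu> T k h Xh \<longleftrightarrow>
     full_measure_set \<mu> Xh \<and>
     (\<forall>x\<^sub>1\<in>Xh. \<forall>x\<^sub>2\<in>Xh. delay_map T h k x\<^sub>1 = delay_map T h k x\<^sub>2 \<longrightarrow>
        delay_map T h k (T x\<^sub>1) = delay_map T h k (T x\<^sub>2))"

definition as_predictable :: "'a measure \<Rightarrow> ('a \<Rightarrow> 'a) \<Rightarrow> nat \<Rightarrow> ('a \<Rightarrow> real) \<Rightarrow> bool" where
  "as_predictable \<mu> T k h \<longleftrightarrow>
     h \<in> borel_measurable \<mu> \<and> (\<exists>Xh. predictability_set \<mu> T k h Xh)"

definition prediction_map ::
  "'a set \<Rightarrow> ('a \<Rightarrow> 'a) \<Rightarrow> nat \<Rightarrow> ('a \<Rightarrow> real) \<Rightarrow> 'a set \<Rightarrow> ((nat \<Rightarrow> real) \<Rightarrow> nat \<Rightarrow> real) \<Rightarrow> bool" where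
  "prediction_map X T k h Xh S \<longleftrightarrow>
     S \<in> delay_map T h k ` Xh \<rightarrow> delay_map T h k ` X \<and>
     (\<forall>x\<in>Xh. delay_map T h k (T x) = S (delay_map T h k x))"

definition borel_invariant_prediction ::
  "('a \<Rightarrow> 'a) \<Rightarrow> nat \<Rightarrow> ('a \<Rightarrow> real) \<Rightarrow> 'a set \<Rightarrow> ((nat \<Rightarrow> real) \<Rightarrow> nat \<Rightarrow> real) \<Rightarrow> bool" where
  "borel_invariant_prediction T k h Xh S \<longleftrightarrow>
     T ` Xh \<subseteq> Xh \<and>
     S \<in> delay_map T h k ` Xh \<rightarrow> delay_map T h k ` Xh \<and>
     delay_map T h k ` Xh \<in> sets (borel_of (Euclidean_space k)) \<and>
     S \<in> restrict_space (borel_of (Euclidean_space k)) (delay_map T h k ` Xh)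
           \<rightarrow>\<^sub>M borel_of (Euclidean_space k)"

definition continuous_prediction ::
  "('a \<Rightarrow> 'a) \<Rightarrow> nat \<Rightarrow> ('a \<Rightarrow> real) \<Rightarrow> 'a set \<Rightarrow> ((nat \<Rightarrow> real) \<Rightarrow> nat \<Rightarrow> real) \<Rightarrow> bool" where
  "continuous_prediction T k h Xh S \<longleftrightarrow>
     continuous_map (subtopology (Euclidean_space k) (delay_map T h k ` Xh)) (Euclidean_space k) S"

end

theory Submission
  imports Defs
begin

text \<open>Perturb an observable by polynomials \<open>\<alpha> \<bullet> F(x)\<close> of degree high enough to interpolate at \<open>2k\<close> points. For a pair
  \<open>(x, y)\<close> put \<open>w\<^sub>i = F (T^i x) - F (T^i y)\<close>. If \<open>w\<^sub>i\<close>, \<open>i < k\<close>, are linearly dependent, interpolation shows that the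
  same relation holds for every observable; pulling it back along \<open>T\<close> gives a recurrence, so two points with equal
  \<open>k\<close>-delay vectors have equal observations for ever. If they are independent, the parameters \<open>\<alpha>\<close> for which the delay
  vectors are \<open>\<epsilon>\<close>-close have measure \<open>O(\<epsilon>^k)\<close>; covering a set \<open>A\<close> of dimension less than \<open>k\<close>, for each fixed \<open>x\<close> almost
  no \<open>\<alpha>\<close> admits such a \<open>y \<in> A\<close> with an equal delay vector. By Fubini, for almost every \<open>\<alpha>\<close> this holds for almost every
  \<open>x\<close> and all \<open>y \<in> A\<close> at once. When \<open>A\<close> is \<open>\<sigma>\<close>-compact the good observables form a \<open>G\<^sub>\<delta>\<close>. Since \<open>y\<close> ranges over all of
  \<open>A\<close>, compactness of \<open>A\<close> yields continuity of the prediction map, and passing to a \<open>\<sigma>\<close>-compact forward invariant subset of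
  full measure makes it Borel without any selection theorem.\<close>

section \<open>Covers and packings\<close>

text \<open>Injectivity of the delay map is out of reach in general: periodic points and merging
  orbits can make the differences \<open>w\<close> dependent whatever the probe. Predictability asks
  for less, and in the dependent case the recurrence delivers it. The threshold is the dimension
  itself, not twice the dimension, because only \<open>y\<close> runs through a cover while
  \<open>x\<close> stays fixed until Fubini: a covering piece of diameter \<open>r\<close> costs
  parameter measure \<open>O(r^k)\<close> by a local Lipschitz bound, and the sum over the cover is
  arbitrarily small. The main obstacle is measurability, since the existence of a partner
  \<open>y\<close> is a projection. Pairs are therefore gathered in compact sets, whose projections
  are again compact. Independence is an open condition, so these sets are obtained by bounding the
  norms of dual vectors. The degree of independence, and with it the constant in
  \<open>O(r^k)\<close>, varies with the pair; hence the estimates are local in \<open>y\<close> and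
  are combined by Lindelof.\<close>

text \<open>Vanishing \<open>k\<close>-dimensional Hausdorff content. Upper bounds
  \<open>r i\<close> for the diameters stand in for \<open>diameter\<close>, so that boundedness of
  the pieces need not be recorded separately; spare pieces can be empty with
  \<open>r i = 0\<close>.\<close>

definition null_cover :: "nat \<Rightarrow> 'a::metric_space set \<Rightarrow> bool" where
  "null_cover k A \<longleftrightarrow> (\<forall>\<epsilon>>0. \<exists>C r. A \<subseteq> (\<Union>i::nat. C i) \<and>
     (\<forall>i. 0 \<le> r i \<and> (\<forall>y\<in>C i. \<forall>z\<in>C i. dist y z \<le> r i)) \<and>
     (\<Sum>i. ennreal (r i ^ k)) \<le> ennreal \<epsilon>)"

lemma null_cover_subset: "null_cover k B \<Longrightarrow> A \<subseteq> B \<Longrightarrow> null_cover k A"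
  unfolding null_cover_def by (meson subset_trans)

text \<open>Some \<open>s < k\<close> has vanishing Hausdorff measure; on sets of diameter at most 1
  the \<open>k\<close>-th power of the diameter is below its \<open>s\<close>-th power.\<close>

lemma hausdorff_dim_less_imp_null_cover:
  assumes dim: "hausdorff_dim A < of_nat k"
  shows "null_cover k A"
  unfolding null_cover_def
proof (intro allI impI)
  fix \<epsilon> :: real assume "\<epsilon> > 0"
  from dim obtain s where s: "0 < s" "hausdorff_measure s A = 0" "ennreal s < of_nat k"
    unfolding hausdorff_dim_def by (auto simp: Inf_less_iff)
  have sk: "s < real k"
    using s(1,3) by (metis ennreal_less_iff ennreal_of_nat_eq_real_of_nat less_eq_real_def)
  have "hausdorff_premeasure s 1 A \<le> hausdorff_measure s A"
    unfolding hausdorff_measure_def by (rule SUP_upper) auto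
  then have "hausdorff_premeasure s 1 A < ennreal \<epsilon>"
    using s(2) \<open>\<epsilon> > 0\<close> by (simp add: ennreal_zero_less_top)
  then obtain C :: "nat \<Rightarrow> 'a set" where C: "A \<subseteq> (\<Union>i. C i)" "\<And>i. bounded (C i)"
      "\<And>i. diameter (C i) \<le> 1" "(\<Sum>i. ennreal (diameter (C i) powr s)) < ennreal \<epsilon>"
    unfolding hausdorff_premeasure_def by (auto simp: Inf_less_iff)
  have nn: "0 \<le> diameter (C i)" for i
    using C(2) by (rule diameter_ge_0)
  have "diameter (C i) ^ k \<le> diameter (C i) powr s" for i
  proof (cases "diameter (C i) = 0")
    case True then show ?thesis using s(1) sk by (cases k) simp_all
  next
    case False
    then have "diameter (C i) powr real k \<le> diameter (C i) powr s"
      using nn[of i] C(3)[of i] sk by (intro powr_mono') auto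
    then show ?thesis using False nn[of i] by (simp add: powr_realpow)
  qed
  then have "(\<Sum>i. ennreal (diameter (C i) ^ k)) \<le> (\<Sum>i. ennreal (diameter (C i) powr s))"
    by (intro suminf_le ennreal_leI) auto
  also have "\<dots> \<le> ennreal \<epsilon>" using C(4) by simp
  finally show "\<exists>C r. A \<subseteq> (\<Union>i::nat. C i) \<and>
     (\<forall>i. 0 \<le> r i \<and> (\<forall>y\<in>C i. \<forall>z\<in>C i. dist y z \<le> r i)) \<and>
     (\<Sum>i. ennreal (r i ^ k)) \<le> ennreal \<epsilon>"
    using C(1,2) nn by (intro exI[of _ C] exI[of _ "\<lambda>i. diameter (C i)"])
      (auto intro: diameter_bounded_bound)
qed

text \<open>With \<open>N = CARD('n)\<close>, a grid of \<open>m ^ N\<close> cubes of side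
  \<open>2R/m\<close> costs \<open>m ^ N * (2RN/m) ^ (N+1)\<close>, which is of order
  \<open>1/m\<close>. This supplies the fallback exponent \<open>N + 1\<close> when no smaller one
  is admissible.\<close>

lemma bounded_null_cover:
  fixes A :: "(real ^ 'n) set"
  assumes "bounded A"
  shows "null_cover (Suc CARD('n)) A"
  unfolding null_cover_def
proof (intro allI impI)
  fix \<epsilon> :: real assume "\<epsilon> > 0"
  let ?N = "CARD('n)"
  obtain R where R: "R > 0" "\<And>x. x \<in> A \<Longrightarrow> norm x < R"
    using assms unfolding bounded_pos by (metis bounded_pos_less assms)
  obtain m0 :: nat where m0: "(2 * R * ?N) ^ Suc ?N / \<epsilon> < m0"
    using reals_Archimedean2 by blast
  define m where "m = Suc m0"
  have m: "m > 0" "(2 * R * ?N) ^ Suc ?N / m \<le> \<epsilon>"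
  proof -
    show "m > 0" by (simp add: m_def)
    have "(2 * R * ?N) ^ Suc ?N < \<epsilon> * m0" using m0 \<open>\<epsilon> > 0\<close>
      by (simp add: field_simps)
    also have "\<dots> \<le> \<epsilon> * m" using \<open>\<epsilon> > 0\<close> by (simp add: m_def)
    finally show "(2 * R * ?N) ^ Suc ?N / m \<le> \<epsilon>" using \<open>m > 0\<close> by (simp add: field_simps)
  qed
  define I where "I = (PiE (UNIV :: 'n set) (\<lambda>_. {..<m}))"
  have fI: "finite I" "card I = m ^ ?N"
    by (simp_all add: I_def card_PiE finite_PiE)
  define Q where "Q f = {x :: real ^ 'n. \<forall>i. -R + 2*R * real (f i) / m \<le> x $ i \<and>
      x $ i \<le> -R + 2*R * (real (f i) + 1) / m}" for f :: "'n \<Rightarrow> nat"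
  obtain e where e: "bij_betw e {0..<card I} I"
    using ex_bij_betw_nat_finite[OF fI(1)] by blast
  \<comment> \<open>The side length times \<open>CARD('n)\<close> bounds the diameter through the l1
    norm, hence the value of \<open>r\<close>. Indices beyond the grid get an empty piece of radius
    0, which turns the finite cover into a sequence.\<close>
  define C where "C j = (if j < card I then Q (e j) else {})" for j
  define r where "r j = (if j < card I then 2*R * ?N / m else 0)" for j
  have cov: "A \<subseteq> (\<Union>i. C i)"
  proof
    fix x assume "x \<in> A"
    then have x: "\<bar>x $ i\<bar> < R" for i
      using R(2)[of x] component_le_norm_cart[of x i] by linarith
    define f where "f i = nat \<lfloor>(x $ i + R) * m / (2*R)\<rfloor>" for i
    have f: "real (f i) \<le> (x $ i + R) * m / (2*R)" "(x $ i + R) * m / (2*R) < real (f i) + 1" for i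
    proof -
      have "0 \<le> (x $ i + R) * m / (2*R)" using x[of i] R(1) by (auto simp: abs_less_iff)
      then show "real (f i) \<le> (x $ i + R) * m / (2*R)" "(x $ i + R) * m / (2*R) < real (f i) + 1"
        unfolding f_def by (simp_all add: of_nat_nat)
    qed
    have "f i < m" for i
    proof -
      have "(x $ i + R) * m / (2*R) < m" using x[of i] R(1) m(1) by (simp add: field_simps abs_less_iff)
      then show ?thesis using f(1)[of i] by linarith
    qed
    then have "f \<in> I" by (auto simp: I_def)
    moreover have "x \<in> Q f" using f R(1) m(1)
      by (auto simp: Q_def field_simps intro!: less_imp_le)
    ultimately show "x \<in> (\<Union>i. C i)"
      using e unfolding bij_betw_def C_def by (force simp: image_iff)
  qed
  have diam: "dist y z \<le> r j" if "y \<in> C j" "z \<in> C j" for j y z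
  proof -
    from that have j: "j < card I" by (auto simp: C_def split: if_splits)
    have "\<bar>(y - z) $ i\<bar> \<le> 2*R / m" for i
      using that j R(1) m(1) unfolding C_def Q_def
      by (simp add: abs_le_iff add_divide_distrib ring_distribs) (smt (verit))
    then have "(\<Sum>i\<in>UNIV. \<bar>(y - z) $ i\<bar>) \<le> (\<Sum>i\<in>(UNIV::'n set). 2*R / m)"
      by (intro sum_mono) auto
    then show ?thesis
      using norm_le_l1_cart[of "y - z"] j by (simp add: dist_norm r_def mult.commute)
  qed
  have "(\<Sum>i. ennreal (r i ^ Suc ?N)) = (\<Sum>i<card I. ennreal (r i ^ Suc ?N))"
    by (rule suminf_finite) (auto simp: r_def)
  also have "\<dots> = (\<Sum>i<card I. ennreal ((2*R * ?N / m) ^ Suc ?N))"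
    by (rule sum.cong) (auto simp: r_def)
  also have "\<dots> = ennreal (m ^ ?N * (2*R * ?N / m) ^ Suc ?N)"
    using R(1) fI(2) by (subst sum_ennreal) auto
  also have "m ^ ?N * (2*R * ?N / m) ^ Suc ?N = (2 * R * ?N) ^ Suc ?N / m"
    using m(1) by (simp add: power_divide field_simps)
  also have "ennreal \<dots> \<le> ennreal \<epsilon>" using m(2) by (rule ennreal_leI)
  finally show "\<exists>C r. A \<subseteq> (\<Union>i::nat. C i) \<and>
     (\<forall>i. 0 \<le> r i \<and> (\<forall>y\<in>C i. \<forall>z\<in>C i. dist y z \<le> r i)) \<and>
     (\<Sum>i. ennreal (r i ^ Suc ?N)) \<le> ennreal \<epsilon>"
    using cov diam R(1) by (intro exI[of _ C] exI[of _ r]) (auto simp: r_def)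
qed

section \<open>Measure of the parameters satisfying k nearly independent slab conditions\<close>

lemma emeasure_lborel_translate:
  fixes S :: "'a::euclidean_space set"
  assumes "compact S"
  shows "emeasure lborel ((+) c ` S) = emeasure lborel S"
proof -
  have "compact ((+) c ` S)" using assms by (rule compact_translation)
  then have "(+) c ` S \<in> sets borel" by (rule borel_compact)
  then have "emeasure lborel ((+) c ` S) = emeasure (distr lborel borel ((+) c)) ((+) c ` S)"
    by (simp add: lborel_distr_plus)
  also have "\<dots> = emeasure lborel ((+) c -` ((+) c ` S) \<inter> space lborel)"
    using \<open>(+) c ` S \<in> sets borel\<close> by (intro emeasure_distr) auto
  also have "(+) c -` ((+) c ` S) \<inter> space lborel = S" by auto
  finally show ?thesis .
qed

text \<open>The translates of the set by the grid points \<open>\<Sum>l. (t l / n) b l\<close>, \<open>t l < n\<close>, are pairwise disjoint and lie in a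
  fixed ball. This replaces a change of variables and needs no determinant.\<close>

lemma packing_grid:
  fixes w b :: "nat \<Rightarrow> 'e::euclidean_space"
  assumes k: "k \<ge> 1"
    and near: "\<And>i l. i < k \<Longrightarrow> l < k \<Longrightarrow> \<bar>w i \<bullet> b l - (if i = l then 1 else 0)\<bar> \<le> 1 / (2 * real k)"
    and \<beta>: "\<And>l. l < k \<Longrightarrow> norm (b l) \<le> \<beta>"
    and n: "n > 0" "4 * \<epsilon> * real n < 1" and "\<epsilon> \<ge> 0"
  shows "of_nat (n ^ k) * emeasure lborel {\<alpha>\<in>cball 0 1. \<forall>i<k. \<bar>a i + w i \<bullet> \<alpha>\<bar> \<le> \<epsilon>}
           \<le> emeasure lborel (cball (0::'e) (1 + k * \<beta>))"
proof -
  let ?E = "{\<alpha>\<in>cball 0 1. \<forall>i<k. \<bar>a i + w i \<bullet> \<alpha>\<bar> \<le> \<epsilon>}"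
  define I where "I = (PiE {..<k} (\<lambda>_. {..<n}))"
  have fI: "finite I" "card I = n ^ k"
    by (simp_all add: I_def card_PiE finite_PiE)
  define c where "c t = (\<Sum>l<k. (real (t l) / n) *\<^sub>R b l)" for t :: "nat \<Rightarrow> nat"
  have "closed {\<alpha>. \<forall>i<k. \<bar>a i + w i \<bullet> \<alpha>\<bar> \<le> \<epsilon>}"
    by (intro closed_Collect_all closed_Collect_imp closed_Collect_le continuous_intros) auto
  then have "compact (cball 0 1 \<inter> {\<alpha>. \<forall>i<k. \<bar>a i + w i \<bullet> \<alpha>\<bar> \<le> \<epsilon>})"
    by (intro compact_Int_closed) auto
  then have cE: "compact ?E" by (simp add: Int_def)
  have disj: "disjoint_family_on (\<lambda>t. (+) (c t) ` ?E) I"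
    unfolding disjoint_family_on_def
  proof (intro ballI impI)
    fix t t' assume t: "t \<in> I" "t' \<in> I" "t \<noteq> t'"
    show "(+) (c t) ` ?E \<inter> (+) (c t') ` ?E = {}"
    proof (rule ccontr)
      assume "(+) (c t) ` ?E \<inter> (+) (c t') ` ?E \<noteq> {}"
      then obtain \<alpha> \<alpha>' where \<alpha>: "\<alpha> \<in> ?E" "\<alpha>' \<in> ?E" "c t + \<alpha> = c t' + \<alpha>'" by auto
      define d where "d l = (real (t l) - real (t' l)) / n" for l
      have eq: "(\<Sum>l<k. d l *\<^sub>R b l) = \<alpha>' - \<alpha>"
      proof -
        have "(\<Sum>l<k. d l *\<^sub>R b l) = c t - c t'"
          by (simp add: c_def d_def sum_subtractf[symmetric] scaleR_diff_left[symmetric] diff_divide_distrib)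
        also have "\<dots> = c t + \<alpha> - (c t' + \<alpha>)" by simp
        also have "\<dots> = \<alpha>' - \<alpha>" by (simp only: \<alpha>(3) add_diff_cancel_left)
        finally show ?thesis .
      qed
      \<comment> \<open>The coefficient of largest modulus is tested against its own row: the
        \<open>k\<close> errors, each at most \<open>1 / (2 * real k)\<close> times this modulus,
        add up to at most half of it and cannot cancel \<open>d i\<close>.\<close>
      have "finite ((\<lambda>l. \<bar>d l\<bar>) ` {..<k})" "(\<lambda>l. \<bar>d l\<bar>) ` {..<k} \<noteq> {}"
        using k by (auto simp: lessThan_empty_iff)
      then obtain i where i: "i < k" "\<And>l. l < k \<Longrightarrow> \<bar>d l\<bar> \<le> \<bar>d i\<bar>"
        using Max_in[of "(\<lambda>l. \<bar>d l\<bar>) ` {..<k}"] Max_ge[of "(\<lambda>l. \<bar>d l\<bar>) ` {..<k}"] by fastforce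
      obtain j where j: "j < k" "t j \<noteq> t' j"
        using t unfolding I_def by (metis PiE_ext lessThan_iff)
      have "1 \<le> \<bar>real (t j) - real (t' j)\<bar>" using j(2) by linarith
      then have "1 / n \<le> \<bar>d j\<bar>" using n(1) by (simp add: d_def abs_div divide_right_mono)
      then have di: "1 / n \<le> \<bar>d i\<bar>" using i(2)[OF j(1)] by simp
      have "d i - w i \<bullet> (\<Sum>l<k. d l *\<^sub>R b l) = (\<Sum>l<k. d l * ((if i = l then 1 else 0) - w i \<bullet> b l))"
        using i(1) by (simp add: inner_sum_right right_diff_distrib sum_subtractf
            if_distrib[where f = "\<lambda>x. _ * x"] cong: if_cong)
      also have "\<bar>\<dots>\<bar> \<le> (\<Sum>l<k. \<bar>d i\<bar> * (1 / (2 * real k)))"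
      proof (rule order_trans[OF sum_abs], rule sum_mono)
        fix l assume "l \<in> {..<k}"
        then have "l < k" by simp
        have "\<bar>(if i = l then 1 else 0) - w i \<bullet> b l\<bar> \<le> 1 / (2 * real k)"
          using near[OF i(1) \<open>l < k\<close>] by (subst abs_minus_commute)
        then show "\<bar>d l * ((if i = l then 1 else 0) - w i \<bullet> b l)\<bar> \<le> \<bar>d i\<bar> * (1 / (2 * real k))"
          unfolding abs_mult by (intro mult_mono i(2) \<open>l < k\<close>) auto
      qed
      also have "\<dots> = \<bar>d i\<bar> / 2" using k by simp
      finally have 1: "\<bar>d i - w i \<bullet> (\<alpha>' - \<alpha>)\<bar> \<le> \<bar>d i\<bar> / 2" by (simp only: eq)
      \<comment> \<open>Both parameters satisfy the slab condition for the same \<open>a i\<close>,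
        which cancels in the difference.\<close>
      have "\<bar>w i \<bullet> (\<alpha>' - \<alpha>)\<bar> \<le> 2 * \<epsilon>"
        using \<alpha>(1,2) i(1) unfolding inner_diff_right by (simp add: abs_le_iff) (smt (verit))
      then have "\<bar>d i\<bar> \<le> 4 * \<epsilon>" using 1 by linarith
      then have "1 / n \<le> 4 * \<epsilon>" using di by linarith
      then show False using n by (simp add: field_simps)
    qed
  qed
  have sub: "(+) (c t) ` ?E \<subseteq> cball 0 (1 + k * \<beta>)" if "t \<in> I" for t
  proof -
    have "norm (c t) \<le> (\<Sum>l<k. \<beta>)"
      unfolding c_def
    proof (rule sum_norm_le)
      fix l assume "l \<in> {..<k}"
      then have "t l < n" "l < k" using that by (auto simp: I_def PiE_def Pi_def)
      then have "real (t l) / n * norm (b l) \<le> 1 * \<beta>"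
        by (intro mult_mono \<beta>) (auto simp: field_simps)
      then show "norm ((real (t l) / n) *\<^sub>R b l) \<le> \<beta>" by simp
    qed
    then have "norm (c t + \<alpha>) \<le> 1 + k * \<beta>" if "norm \<alpha> \<le> 1" for \<alpha>
      using norm_triangle_ineq[of "c t" \<alpha>] that by simp
    then show ?thesis by auto
  qed
  have meas: "(+) (c t) ` ?E \<in> sets lborel" for t
    using compact_translation[OF cE, of "c t"] by (simp add: borel_compact)
  have "of_nat (n ^ k) * emeasure lborel ?E = (\<Sum>t\<in>I. emeasure lborel ((+) (c t) ` ?E))"
    by (simp only: emeasure_lborel_translate[OF cE] sum_constant fI)
  also have "\<dots> = emeasure lborel (\<Union>t\<in>I. (+) (c t) ` ?E)"
    using meas disj fI(1) by (intro sum_emeasure) auto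
  also have "\<dots> \<le> emeasure lborel (cball (0::'e) (1 + k * \<beta>))"
    using sub by (intro emeasure_mono) auto
  finally show ?thesis .
qed

text \<open>With \<open>n\<close> of order \<open>1/\<epsilon>\<close> grid points per direction the
  packing gives a bound of order \<open>\<epsilon> ^ k\<close>. The tolerance in \<open>near\<close>
  lets one family \<open>b\<close> serve all vectors \<open>w\<close> close to those it is dual to,
  with the same constant.\<close>

lemma packing_bound:
  fixes w b :: "nat \<Rightarrow> 'e::euclidean_space"
  assumes k: "k \<ge> 1"
    and near: "\<And>i l. i < k \<Longrightarrow> l < k \<Longrightarrow> \<bar>w i \<bullet> b l - (if i = l then 1 else 0)\<bar> \<le> 1 / (2 * real k)"
    and \<beta>: "\<And>l. l < k \<Longrightarrow> norm (b l) \<le> \<beta>" "\<beta> \<ge> 0"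
    and \<epsilon>: "\<epsilon> \<ge> 0"
  shows "emeasure lborel {\<alpha>\<in>cball 0 1. \<forall>i<k. \<bar>a i + w i \<bullet> \<alpha>\<bar> \<le> \<epsilon>}
           \<le> ennreal (measure lborel (cball (0::'e) (1 + k * \<beta>)) * (8 * \<epsilon>) ^ k)"
proof -
  let ?E = "{\<alpha>\<in>cball 0 1. \<forall>i<k. \<bar>a i + w i \<bullet> \<alpha>\<bar> \<le> \<epsilon>}" and ?B = "cball (0::'e) (1 + k * \<beta>)"
  define c where "c = measure lborel ?B"
  have B: "emeasure lborel ?B = ennreal c"
    unfolding c_def by (rule emeasure_eq_ennreal_measure)
      (metis emeasure_lborel_cball_finite infinity_ennreal_def less_irrefl)
  have c0: "c \<ge> 0" by (simp add: c_def)
  have EB: "emeasure lborel ?E \<le> ennreal c"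
  proof -
    have "?E \<subseteq> ?B" using \<beta>(2) by auto (smt (verit) mult_nonneg_nonneg of_nat_0_le_iff)
    then show ?thesis unfolding B[symmetric] by (intro emeasure_mono) auto
  qed
  then obtain e where e: "emeasure lborel ?E = ennreal e" "e \<ge> 0"
    by (cases "emeasure lborel ?E") (auto simp: top_unique)
  have grid: "n ^ k * e \<le> c" if "n > 0" "4 * \<epsilon> * real n < 1" for n
  proof -
    have "ennreal (real (n ^ k) * e) \<le> ennreal c"
      using packing_grid[OF k near \<beta>(1) that \<epsilon>, of a] e
      unfolding B e(1) by (simp add: ennreal_mult'' ennreal_of_nat_eq_real_of_nat)
    then show ?thesis using c0 by (simp add: ennreal_le_iff)
  qed
  have "e \<le> c * (8 * \<epsilon>) ^ k"
  proof (cases "\<epsilon> = 0")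
    case True
    have "e \<le> 0"
    proof (rule ccontr)
      assume "\<not> e \<le> 0"
      then obtain n :: nat where "c / e < n" using reals_Archimedean2 by blast
      then have "c < real (Suc n) * e" using \<open>\<not> e \<le> 0\<close> by (simp add: field_simps)
      also have "\<dots> \<le> real (Suc n) ^ k * e"
        using k e(2) by (intro mult_right_mono self_le_power) auto
      finally show False using grid[of "Suc n"] True by simp
    qed
    then show ?thesis using True k by (cases k) auto
  next
    case False
    then have "\<epsilon> > 0" using \<epsilon> by simp
    show ?thesis
    proof (cases "8 * \<epsilon> \<ge> 1")
      case True
      have "e \<le> c" using EB e c0 by (simp add: ennreal_le_iff)
      also have "\<dots> \<le> c * (8 * \<epsilon>) ^ k"
        using mult_left_mono[OF one_le_power[OF True, of k] c0] by simp
      finally show ?thesis .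
    next
      case False
      \<comment> \<open>The largest integer strictly below \<open>1 / (4 * \<epsilon>)\<close>. As
        that number exceeds 2, \<open>n\<close> is at least half of it, which is where the 8 in the
        bound comes from.\<close>
      define n where "n = nat (\<lceil>1 / (4 * \<epsilon>)\<rceil> - 1)"
      have 1: "1 / (4 * \<epsilon>) > 2" using False \<open>\<epsilon> > 0\<close> by (simp add: field_simps)
      have n: "real n < 1 / (4 * \<epsilon>)" "real n \<ge> 1 / (4 * \<epsilon>) - 1"
        using 1 unfolding n_def by linarith+
      have n8: "1 / (8 * \<epsilon>) \<le> real n" using n(2) 1 by (simp add: field_simps)
      have "n > 0" using n(2) 1 by (cases n) auto
      have "e / (8 * \<epsilon>) ^ k \<le> real n ^ k * e"
      proof -
        have "(1 / (8 * \<epsilon>)) ^ k \<le> real n ^ k" using n8 \<open>\<epsilon> > 0\<close> by (intro power_mono) auto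
        from mult_right_mono[OF this e(2)] show ?thesis by (simp add: power_divide)
      qed
      also have "\<dots> \<le> c" using grid[OF \<open>n > 0\<close>] n(1) \<open>\<epsilon> > 0\<close> by (simp add: field_simps)
      finally show ?thesis using \<open>\<epsilon> > 0\<close> by (simp add: divide_le_eq)
    qed
  qed
  then show ?thesis unfolding e(1) c_def[symmetric] by (rule ennreal_leI)
qed

section \<open>Interpolating polynomials\<close>

text \<open>The coordinates of \<open>monomials x\<close> are indexed by words over the variables and the constant \<open>1\<close>, with letters at the
  positions in \<open>'j\<close>. A monomial is listed once for each word representing it; this redundancy is harmless, and
  products of \<open>CARD('j)\<close> affine forms become linear functionals of \<open>monomials x\<close>.\<close>

definition affine_coord :: "real ^ 'n \<Rightarrow> 'n option \<Rightarrow> real" where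
  "affine_coord x v = (case v of None \<Rightarrow> 1 | Some i \<Rightarrow> x $ i)"

definition monomials :: "real ^ 'n \<Rightarrow> real ^ ('j::finite \<Rightarrow> 'n::finite option)" where
  "monomials x = (\<chi> w. \<Prod>s\<in>UNIV. affine_coord x (w s))"

text \<open>Distributivity: expanding the product picks one letter at each position, hence one
  summand per word.\<close>

lemma inner_monomials_prod:
  fixes c :: "'j::finite \<Rightarrow> 'n::finite option \<Rightarrow> real"
  shows "(\<chi> w. \<Prod>s\<in>UNIV. c s (w s)) \<bullet> monomials x = (\<Prod>s\<in>UNIV. \<Sum>v\<in>UNIV. c s v * affine_coord x v)"
proof -
  have "(\<Prod>s\<in>UNIV. \<Sum>v\<in>UNIV. c s v * affine_coord x v) =
      (\<Sum>w\<in>PiE UNIV (\<lambda>_. UNIV). \<Prod>s\<in>UNIV. c s (w s) * affine_coord x (w s))"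
    by (rule prod_sum_PiE) auto
  also have "PiE (UNIV :: 'j set) (\<lambda>_. UNIV :: 'n option set) = UNIV" by auto
  finally show ?thesis
    by (simp add: inner_vec_def monomials_def prod.distrib)
qed

text \<open>A Lagrange basis polynomial with one affine factor per position \<open>s\<close>, equal
  to 1 at \<open>z\<close> and vanishing at \<open>e s\<close>; positions with
  \<open>e s = z\<close> contribute the constant factor 1.\<close>

lemma monomials_separate:
  fixes z :: "real ^ 'n::finite" and e :: "'j::finite \<Rightarrow> real ^ 'n"
  shows "\<exists>b :: real ^ ('j \<Rightarrow> 'n option). b \<bullet> monomials z = 1 \<and>
    (\<forall>s. e s \<noteq> z \<longrightarrow> b \<bullet> monomials (e s) = 0)"
proof -
  have "\<exists>c. (\<Sum>v\<in>UNIV. c v * affine_coord z v) = 1 \<and>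
      (e s \<noteq> z \<longrightarrow> (\<Sum>v\<in>UNIV. c v * affine_coord (e s) v) = 0)" for s
  proof (cases "e s = z")
    case True
    then show ?thesis
      by (intro exI[of _ "\<lambda>v. if v = None then 1 else 0"])
        (simp add: affine_coord_def UNIV_option_conv sum.reindex)
  next
    case False
    then obtain i where i: "e s $ i \<noteq> z $ i" by (auto simp: vec_eq_iff)
    \<comment> \<open>The affine form \<open>(x $ i - e s $ i) / (z $ i - e s $ i)\<close> in a
      coordinate that separates the two points.\<close>
    define c where "c v = (case v of None \<Rightarrow> - (e s $ i) / (z $ i - e s $ i) |
      Some j \<Rightarrow> if j = i then 1 / (z $ i - e s $ i) else 0)" for v
    have "(\<Sum>v\<in>UNIV. c v * affine_coord x v) = (x $ i - e s $ i) / (z $ i - e s $ i)" for x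
      by (simp add: c_def affine_coord_def UNIV_option_conv sum.reindex diff_divide_distrib
          if_distrib[where f = "\<lambda>x. x * _"] cong: if_cong)
    then show ?thesis using i by (intro exI[of _ c]) auto
  qed
  then obtain c where c: "\<And>s. (\<Sum>v\<in>UNIV. c s v * affine_coord z v) = 1"
      "\<And>s. e s \<noteq> z \<Longrightarrow> (\<Sum>v\<in>UNIV. c s v * affine_coord (e s) v) = 0"
    by metis
  show ?thesis
  proof (intro exI[of _ "\<chi> w. \<Prod>s\<in>UNIV. c s (w s)"] conjI allI impI)
    show "(\<chi> w. \<Prod>s\<in>UNIV. c s (w s)) \<bullet> monomials z = 1"
      by (simp add: inner_monomials_prod c(1))
    show "(\<chi> w. \<Prod>s\<in>UNIV. c s (w s)) \<bullet> monomials (e s) = 0" if "e s \<noteq> z" for s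
      using c(2)[OF that] by (auto simp: inner_monomials_prod)
  qed
qed

lemma monomials_interpolate:
  fixes E :: "(real ^ 'n::finite) set" and g :: "real ^ 'n \<Rightarrow> real"
  assumes "finite E" "card E \<le> CARD('j::finite)"
  shows "\<exists>b :: real ^ ('j::finite \<Rightarrow> 'n::finite option). \<forall>z\<in>E. b \<bullet> monomials z = g z"
proof -
  obtain q :: "real ^ 'n \<Rightarrow> 'j" where q: "inj_on q E"
    using card_le_inj[OF assms(1), of "UNIV :: 'j set"] assms(2) by auto
  have "\<exists>b :: real ^ ('j \<Rightarrow> 'n option). b \<bullet> monomials z = 1 \<and>
      (\<forall>u\<in>E. u \<noteq> z \<longrightarrow> b \<bullet> monomials u = 0)" for z
  proof -
    \<comment> \<open>The nodes are listed by the positions through \<open>q\<close>. At positions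
      missed by \<open>q\<close>, \<open>inv_into\<close> returns an arbitrary point, where one more
      zero is harmless.\<close>
    obtain b :: "real ^ ('j \<Rightarrow> 'n option)" where b: "b \<bullet> monomials z = 1"
      "\<And>s. inv_into E q s \<noteq> z \<Longrightarrow> b \<bullet> monomials (inv_into E q s) = 0"
      using monomials_separate[of z "inv_into E q"] by blast
    have "b \<bullet> monomials u = 0" if "u \<in> E" "u \<noteq> z" for u
      using b(2)[of "q u"] that q by simp
    then show ?thesis using b(1) by blast
  qed
  then obtain b :: "real ^ 'n \<Rightarrow> real ^ ('j \<Rightarrow> 'n option)" where
    b: "\<And>z. b z \<bullet> monomials z = 1" "\<And>z u. u \<in> E \<Longrightarrow> u \<noteq> z \<Longrightarrow> b z \<bullet> monomials u = 0"
    by metis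
  show ?thesis
  proof (intro exI[of _ "\<Sum>z\<in>E. g z *\<^sub>R b z"] ballI)
    fix z assume "z \<in> E"
    have "(\<Sum>u\<in>E. g u *\<^sub>R b u) \<bullet> monomials z = (\<Sum>u\<in>E. if u = z then g z else 0)"
      unfolding inner_sum_left using b \<open>z \<in> E\<close> by (intro sum.cong) auto
    also have "\<dots> = g z" using assms(1) \<open>z \<in> E\<close> by simp
    finally show "(\<Sum>u\<in>E. g u *\<^sub>R b u) \<bullet> monomials z = g z" .
  qed
qed

text \<open>Boundedness is included so that the class is closed under products.\<close>

definition bounded_lipschitz_on :: "'a::metric_space set \<Rightarrow> ('a \<Rightarrow> real) \<Rightarrow> bool" where
  "bounded_lipschitz_on Y f \<longleftrightarrow> (\<exists>C\<ge>0. (\<forall>x\<in>Y. \<bar>f x\<bar> \<le> C) \<and> (\<forall>x\<in>Y. \<forall>y\<in>Y. \<bar>f x - f y\<bar> \<le> C * dist x y))"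

lemma bounded_lipschitz_on_mult:
  assumes "bounded_lipschitz_on Y f" "bounded_lipschitz_on Y g"
  shows "bounded_lipschitz_on Y (\<lambda>x. f x * g x)"
proof -
  obtain C D where C: "C \<ge> 0" "\<And>x. x \<in> Y \<Longrightarrow> \<bar>f x\<bar> \<le> C" "\<And>x y. x \<in> Y \<Longrightarrow> y \<in> Y \<Longrightarrow> \<bar>f x - f y\<bar> \<le> C * dist x y"
    and D: "D \<ge> 0" "\<And>x. x \<in> Y \<Longrightarrow> \<bar>g x\<bar> \<le> D" "\<And>x y. x \<in> Y \<Longrightarrow> y \<in> Y \<Longrightarrow> \<bar>g x - g y\<bar> \<le> D * dist x y"
    using assms unfolding bounded_lipschitz_on_def by blast
  have "\<bar>f x * g x\<bar> \<le> 2 * C * D" if "x \<in> Y" for x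
  proof -
    have "\<bar>f x * g x\<bar> \<le> C * D" unfolding abs_mult using C D that by (intro mult_mono) auto
    also have "\<dots> \<le> 2 * C * D" using mult_nonneg_nonneg[OF C(1) D(1)] by linarith
    finally show ?thesis .
  qed
  moreover have "\<bar>f x * g x - f y * g y\<bar> \<le> 2 * C * D * dist x y" if "x \<in> Y" "y \<in> Y" for x y
  proof -
    have "f x * g x - f y * g y = f x * (g x - g y) + (f x - f y) * g y" by (simp add: algebra_simps)
    also have "\<bar>\<dots>\<bar> \<le> \<bar>f x\<bar> * \<bar>g x - g y\<bar> + \<bar>f x - f y\<bar> * \<bar>g y\<bar>"
      by (metis abs_mult abs_triangle_ineq)
    also have "\<dots> \<le> C * (D * dist x y) + (C * dist x y) * D"
      using C D that by (intro add_mono mult_mono) auto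
    finally show ?thesis by (simp add: algebra_simps)
  qed
  moreover have "0 \<le> 2 * C * D" using C(1) D(1) by simp
  ultimately show ?thesis unfolding bounded_lipschitz_on_def by blast
qed

lemma bounded_lipschitz_on_prod:
  assumes "finite S" "\<And>s. s \<in> S \<Longrightarrow> bounded_lipschitz_on Y (f s)"
  shows "bounded_lipschitz_on Y (\<lambda>x. \<Prod>s\<in>S. f s x)"
  using assms
proof (induction S)
  case empty
  show ?case by (auto simp: bounded_lipschitz_on_def intro!: exI[of _ 1])
next
  case (insert s S)
  then show ?case by (simp add: bounded_lipschitz_on_mult)
qed

lemma monomials_lipschitz_bounded:
  assumes "bounded (Y :: (real ^ 'n) set)"
  obtains C where "C \<ge> 0" "\<And>x. x \<in> Y \<Longrightarrow> norm (monomials x :: real ^ ('j::finite \<Rightarrow> 'n::finite option)) \<le> C"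
    "C-lipschitz_on Y (monomials :: real ^ 'n \<Rightarrow> real ^ ('j \<Rightarrow> 'n option))"
proof -
  obtain R where R: "R > 0" "\<And>x. x \<in> Y \<Longrightarrow> norm x \<le> R"
    using assms unfolding bounded_pos by auto
  have "bounded_lipschitz_on Y (\<lambda>x. affine_coord x v)" for v :: "'n option"
  proof (cases v)
    case None
    then show ?thesis
      by (auto simp: bounded_lipschitz_on_def affine_coord_def intro!: exI[of _ 1])
  next
    case (Some i)
    \<comment> \<open>\<open>R + 1\<close> serves both purposes of the constant: it exceeds the
      bound \<open>R\<close> and the Lipschitz constant 1 of a coordinate.\<close>
    have 1: "\<bar>x $ i\<bar> \<le> R + 1" if "x \<in> Y" for x
      using R(2)[OF that] component_le_norm_cart[of x i] by linarith
    have 2: "\<bar>x $ i - y $ i\<bar> \<le> (R + 1) * dist x y" for x y :: "real ^ 'n"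
    proof -
      have "\<bar>x $ i - y $ i\<bar> \<le> dist x y"
        using component_le_norm_cart[of "x - y" i] by (simp add: dist_norm)
      also have "\<dots> \<le> (R + 1) * dist x y" using R(1) by (simp add: mult_le_cancel_right1)
      finally show ?thesis .
    qed
    show ?thesis using Some R(1) 1 2
      by (auto simp: bounded_lipschitz_on_def affine_coord_def intro!: exI[of _ "R + 1"])
  qed
  then have "bounded_lipschitz_on Y (\<lambda>x. monomials x $ w)" for w :: "'j \<Rightarrow> 'n option"
    unfolding monomials_def by (auto intro: bounded_lipschitz_on_prod)
  then have "\<exists>C. C \<ge> 0 \<and> (\<forall>x\<in>Y. \<bar>monomials x $ w\<bar> \<le> C) \<and>
      (\<forall>x\<in>Y. \<forall>y\<in>Y. \<bar>monomials x $ w - monomials y $ w\<bar> \<le> C * dist x y)" for w :: "'j \<Rightarrow> 'n option"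
    unfolding bounded_lipschitz_on_def by blast
  then obtain C :: "('j \<Rightarrow> 'n option) \<Rightarrow> real" where C: "\<And>w. C w \<ge> 0" "\<And>w x. x \<in> Y \<Longrightarrow> \<bar>monomials x $ w\<bar> \<le> C w"
    "\<And>w x y. x \<in> Y \<Longrightarrow> y \<in> Y \<Longrightarrow> \<bar>monomials x $ w - monomials y $ w\<bar> \<le> C w * dist x y"
    by metis
  show thesis
  proof (rule that[of "\<Sum>w\<in>UNIV. C w"])
    show "0 \<le> (\<Sum>w\<in>UNIV. C w)" using C(1) by (simp add: sum_nonneg)
    show "norm (monomials x :: real ^ ('j \<Rightarrow> 'n option)) \<le> (\<Sum>w\<in>UNIV. C w)" if "x \<in> Y" for x
      using C(2)[OF that] by (intro order_trans[OF norm_le_l1_cart] sum_mono) auto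
    show "(\<Sum>w\<in>UNIV. C w)-lipschitz_on Y (monomials :: real ^ 'n \<Rightarrow> real ^ ('j \<Rightarrow> 'n option))"
    proof (rule lipschitz_onI)
      fix x y assume "x \<in> Y" "y \<in> Y"
      then show "dist (monomials x :: real ^ ('j \<Rightarrow> 'n option)) (monomials y) \<le> (\<Sum>w\<in>UNIV. C w) * dist x y"
        unfolding dist_norm sum_distrib_right using C(3)
        by (intro order_trans[OF norm_le_l1_cart] sum_mono) (auto simp: dist_norm)
    qed (use C(1) in \<open>simp add: sum_nonneg\<close>)
  qed
qed

section \<open>Dual families, linear dependence and the recurrence between observations\<close>

text \<open>The part \<open>z\<close> of \<open>w l\<close> orthogonal to the other vectors is
  nonzero by independence, and \<open>z\<close> divided by \<open>z \<bullet> z\<close> is the dual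
  vector. Independence refers to coefficient sequences, so a repeated vector counts as a
  dependence.\<close>

lemma dual_family_or_dependent:
  fixes w :: "nat \<Rightarrow> 'e::euclidean_space"
  assumes "\<And>c j. j < k \<Longrightarrow> c j \<noteq> 0 \<Longrightarrow> (\<Sum>i<k. c i *\<^sub>R w i) \<noteq> 0"
  shows "\<exists>b. \<forall>i<k. \<forall>l<k. w i \<bullet> b l = (if i = l then 1 else 0)"
proof -
  have "\<exists>b. \<forall>i<k. w i \<bullet> b = (if i = l then 1 else 0)" if "l < k" for l
  proof -
    let ?S = "w ` ({..<k} - {l})"
    \<comment> \<open>Explicit combinations over indices: an element of the span of the image set
      has to yield coefficients for the sequence \<open>w\<close>, whose values may repeat.\<close>
    define V where "V = range (\<lambda>c. \<Sum>i\<in>{..<k} - {l}. c i *\<^sub>R w i)"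
    have "subspace V"
      unfolding subspace_def V_def
    proof (intro conjI ballI allI)
      show "0 \<in> range (\<lambda>c. \<Sum>i\<in>{..<k} - {l}. c i *\<^sub>R w i)"
        by (rule range_eqI[of _ _ "\<lambda>_. 0"]) simp
      fix x assume "x \<in> range (\<lambda>c. \<Sum>i\<in>{..<k} - {l}. c i *\<^sub>R w i)"
      then obtain c where c: "x = (\<Sum>i\<in>{..<k} - {l}. c i *\<^sub>R w i)" by auto
      show "t *\<^sub>R x \<in> range (\<lambda>c. \<Sum>i\<in>{..<k} - {l}. c i *\<^sub>R w i)" for t
        unfolding c scaleR_sum_right by (rule range_eqI[of _ _ "\<lambda>i. t * c i"]) simp
      fix y assume "y \<in> range (\<lambda>c. \<Sum>i\<in>{..<k} - {l}. c i *\<^sub>R w i)"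
      then obtain d where d: "y = (\<Sum>i\<in>{..<k} - {l}. d i *\<^sub>R w i)" by auto
      show "x + y \<in> range (\<lambda>c. \<Sum>i\<in>{..<k} - {l}. c i *\<^sub>R w i)"
        unfolding c d sum.distrib[symmetric]
        by (rule range_eqI[of _ _ "\<lambda>i. c i + d i"]) (simp add: scaleR_left_distrib)
    qed
    moreover have "?S \<subseteq> V"
    proof (rule image_subsetI)
      fix i assume "i \<in> {..<k} - {l}"
      then show "w i \<in> V" unfolding V_def
        by (intro range_eqI[of _ _ "\<lambda>j. if j = i then 1 else 0"])
          (simp add: if_distrib[where f = "\<lambda>x. x *\<^sub>R _"] cong: if_cong)
    qed
    ultimately have span: "span ?S \<subseteq> V" by (metis span_minimal)
    obtain y z where yz: "y \<in> span ?S" "\<And>u. u \<in> span ?S \<Longrightarrow> orthogonal z u" "w l = y + z"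
      using orthogonal_subspace_decomp_exists[of ?S "w l"] by blast
    obtain c where c: "y = (\<Sum>i\<in>{..<k} - {l}. c i *\<^sub>R w i)"
      using yz(1) span unfolding V_def by auto
    have "z \<noteq> 0"
    proof
      assume "z = 0"
      have "(\<Sum>i<k. (if i = l then -1 else c i) *\<^sub>R w i) =
          - w l + (\<Sum>i\<in>{..<k} - {l}. (if i = l then -1 else c i) *\<^sub>R w i)"
        using that by (subst sum.remove[of _ l]) auto
      also have "(\<Sum>i\<in>{..<k} - {l}. (if i = l then -1 else c i) *\<^sub>R w i) = y"
        unfolding c by (rule sum.cong) auto
      also have "- w l + y = 0" using yz(3) \<open>z = 0\<close> by simp
      finally show False
        using assms[of l "\<lambda>i. if i = l then -1 else c i"] that by simp
    qed
    have "w i \<bullet> ((1 / (z \<bullet> z)) *\<^sub>R z) = (if i = l then 1 else 0)" if "i < k" for i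
    proof (cases "i = l")
      case True
      have "y \<bullet> z = 0" using yz(2)[OF yz(1)] by (simp add: orthogonal_def inner_commute)
      then show ?thesis using True yz(3) \<open>z \<noteq> 0\<close>
        by (simp add: inner_add_left)
    next
      case False
      then have "z \<bullet> w i = 0"
        using yz(2)[of "w i"] \<open>i < k\<close> by (auto simp: orthogonal_def intro: span_base)
      then show ?thesis using False by (simp add: inner_commute)
    qed
    then show ?thesis by blast
  qed
  then obtain b where "\<And>l i. l < k \<Longrightarrow> i < k \<Longrightarrow> w i \<bullet> b l = (if i = l then 1 else 0)"
    by metis
  then show ?thesis by blast
qed

text \<open>Applying the relation to the observables \<open>h \<circ> T ^^ m\<close> turns it into a linear recurrence.\<close>

lemma dependent_differences_propagate:
  fixes T :: "'a \<Rightarrow> 'a" and h :: "'a \<Rightarrow> real"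
  assumes c: "j < k" "c j \<noteq> (0::real)"
    and rel: "\<And>g :: 'a \<Rightarrow> real. (\<Sum>i<k. c i * (g ((T ^^ i) x) - g ((T ^^ i) y))) = 0"
    and eq: "\<And>i. i < k \<Longrightarrow> h ((T ^^ i) x) = h ((T ^^ i) y)"
  shows "h ((T ^^ n) x) = h ((T ^^ n) y)"
proof -
  \<comment> \<open>The last index with a nonzero coefficient: the relation can be solved for the
    term at time \<open>m + p\<close> in terms of earlier ones.\<close>
  define p where "p = Max {i. i < k \<and> c i \<noteq> 0}"
  have fin: "finite {i. i < k \<and> c i \<noteq> 0}" "{i. i < k \<and> c i \<noteq> 0} \<noteq> {}" using c by auto
  have p: "p < k" "c p \<noteq> 0" using Max_in[OF fin] by (auto simp: p_def)
  have pmax: "c i = 0" if "i < k" "p < i" for i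
  proof (rule ccontr)
    assume "c i \<noteq> 0"
    then have "i \<le> p" unfolding p_def using fin(1) that(1) by (intro Max_ge) auto
    then show False using that(2) by simp
  qed
  show ?thesis
  proof (induction n rule: less_induct)
    case (less n)
    show ?case
    proof (cases "n < k")
      case True then show ?thesis by (rule eq)
    next
      case False
      \<comment> \<open>Here \<open>n \<ge> k > p\<close>, so the subtraction is not truncated.
        Terms with \<open>i < p\<close> have time below \<open>n\<close> and vanish by induction,
        those with \<open>i > p\<close> by the choice of \<open>p\<close>.\<close>
      define m where "m = n - p"
      have n: "n = m + p" using False p(1) by (simp add: m_def)
      define d where "d i = h ((T ^^ (m + i)) x) - h ((T ^^ (m + i)) y)" for i
      have "0 = (\<Sum>i<k. c i * d i)"
        using rel[of "\<lambda>z. h ((T ^^ m) z)"] by (simp add: d_def funpow_add)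
      also have "\<dots> = c p * d p + (\<Sum>i\<in>{..<k} - {p}. c i * d i)"
        using p(1) by (subst sum.remove[of _ p]) auto
      also have "(\<Sum>i\<in>{..<k} - {p}. c i * d i) = 0"
      proof (rule sum.neutral, rule ballI)
        fix i assume i: "i \<in> {..<k} - {p}"
        show "c i * d i = 0"
        proof (cases "i < p")
          case True
          then show ?thesis using less.IH[of "m + i"] by (simp add: d_def n)
        next
          case False
          then show ?thesis using i pmax[of i] by simp
        qed
      qed
      finally show ?thesis using p(2) by (simp add: d_def n)
    qed
  qed
qed

text \<open>The vectors \<open>F (T^i x) - F (T^i y)\<close>, \<open>i < k\<close>, are linearly independent, witnessed by a dual family.\<close>

definition dual_pair :: "('a \<Rightarrow> 'e::real_inner) \<Rightarrow> ('a \<Rightarrow> 'a) \<Rightarrow> nat \<Rightarrow> 'a \<Rightarrow> 'a \<Rightarrow> bool" where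
  "dual_pair F T k x y \<longleftrightarrow> (\<exists>b. \<forall>i<k. \<forall>l<k.
     (F ((T ^^ i) x) - F ((T ^^ i) y)) \<bullet> b l = (if i = l then 1 else 0))"

lemma not_dual_pair_propagate:
  fixes x y :: "real ^ 'n::finite"
  assumes "\<not> dual_pair (monomials :: real ^ 'n \<Rightarrow> real ^ ('j::finite \<Rightarrow> 'n option)) T k x y"
    and k: "2 * k \<le> CARD('j)"
    and eq: "\<And>i. i < k \<Longrightarrow> h ((T ^^ i) x) = (h ((T ^^ i) y) :: real)"
  shows "h ((T ^^ n) x) = h ((T ^^ n) y)"
proof -
  let ?F = "monomials :: real ^ 'n \<Rightarrow> real ^ ('j \<Rightarrow> 'n option)"
  let ?w = "\<lambda>i. ?F ((T ^^ i) x) - ?F ((T ^^ i) y)"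
  have "\<exists>c j. j < k \<and> c j \<noteq> 0 \<and> (\<Sum>i<k. c i *\<^sub>R ?w i) = 0"
  proof (rule ccontr)
    assume indep: "\<not> (\<exists>c j. j < k \<and> c j \<noteq> 0 \<and> (\<Sum>i<k. c i *\<^sub>R ?w i) = 0)"
    have "dual_pair ?F T k x y"
      unfolding dual_pair_def
    proof (rule dual_family_or_dependent[of k ?w])
      fix c :: "nat \<Rightarrow> real" and j assume j: "j < k" "c j \<noteq> 0"
      show "(\<Sum>i<k. c i *\<^sub>R ?w i) \<noteq> 0"
      proof
        assume "(\<Sum>i<k. c i *\<^sub>R ?w i) = 0"
        with j have "\<exists>c j. j < k \<and> c j \<noteq> 0 \<and> (\<Sum>i<k. c i *\<^sub>R ?w i) = 0"
          by (intro exI[of _ c] exI[of _ j] conjI)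
        with indep show False by contradiction
      qed
    qed
    then show False using assms(1) by contradiction
  qed
  then obtain c j where c: "j < k" "c j \<noteq> 0" "(\<Sum>i<k. c i *\<^sub>R ?w i) = 0"
    by (elim exE conjE)
  have "(\<Sum>i<k. c i * (g ((T ^^ i) x) - g ((T ^^ i) y))) = 0" for g :: "real ^ 'n \<Rightarrow> real"
  proof -
    \<comment> \<open>The nodes are collected as a set, so coinciding orbit points impose no
      conflicting conditions; at most \<open>2 * k\<close> remain, which is the reason for the bound
      on \<open>CARD('j)\<close>.\<close>
    let ?E = "(\<lambda>i. (T ^^ i) x) ` {..<k} \<union> (\<lambda>i. (T ^^ i) y) ` {..<k}"
    have "card ?E \<le> card ((\<lambda>i. (T ^^ i) x) ` {..<k}) + card ((\<lambda>i. (T ^^ i) y) ` {..<k})"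
      by (rule card_Un_le)
    also have "\<dots> \<le> card {..<k} + card {..<k}" by (intro add_mono card_image_le) auto
    also have "\<dots> \<le> CARD('j)" using k by simp
    finally have "card ?E \<le> CARD('j)" .
    moreover have "finite ?E" by simp
    ultimately obtain b :: "real ^ ('j \<Rightarrow> 'n option)" where b: "\<And>z. z \<in> ?E \<Longrightarrow> b \<bullet> ?F z = g z"
      using monomials_interpolate[of ?E g] by blast
    have "c i * (g ((T ^^ i) x) - g ((T ^^ i) y)) = b \<bullet> (c i *\<^sub>R ?w i)" if "i < k" for i
    proof -
      have "b \<bullet> ?F ((T ^^ i) x) = g ((T ^^ i) x)" "b \<bullet> ?F ((T ^^ i) y) = g ((T ^^ i) y)"
        using that by (intro b; simp)+
      then show ?thesis by (simp only: inner_scaleR_right inner_diff_right)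
    qed
    then have "(\<Sum>i<k. c i * (g ((T ^^ i) x) - g ((T ^^ i) y))) = (\<Sum>i<k. b \<bullet> (c i *\<^sub>R ?w i))"
      by (intro sum.cong) auto
    also have "\<dots> = 0" by (simp only: inner_sum_right[symmetric] c(3) inner_zero_right)
    finally show ?thesis .
  qed
  from dependent_differences_propagate[where h = h, OF c(1,2) this eq] show ?thesis .
qed

section \<open>The metric space of locally Lipschitz functions\<close>

lemma lip_norm_cong:
  assumes "\<And>x. x \<in> Y \<Longrightarrow> f x = g x"
  shows "lip_norm Y f = lip_norm Y g"
proof -
  have "(SUP x\<in>Y. ennreal \<bar>f x\<bar>) = (SUP x\<in>Y. ennreal \<bar>g x\<bar>)"
    by (intro SUP_cong) (use assms in auto)
  moreover have "(SUP (x, y) \<in> {(x, y). x \<in> Y \<and> y \<in> Y \<and> x \<noteq> y}. ennreal (\<bar>f x - f y\<bar> / norm (x - y))) =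
     (SUP (x, y) \<in> {(x, y). x \<in> Y \<and> y \<in> Y \<and> x \<noteq> y}. ennreal (\<bar>g x - g y\<bar> / norm (x - y)))"
    by (intro SUP_cong) (use assms in auto)
  ultimately show ?thesis by (simp add: lip_norm_def)
qed

lemma lip_norm_uminus: "lip_norm Y (\<lambda>x. - f x) = lip_norm Y f"
  unfolding lip_norm_def by (simp add: abs_minus_commute)

lemma lip_norm_ge: "x \<in> Y \<Longrightarrow> ennreal \<bar>f x\<bar> \<le> lip_norm Y f"
  unfolding lip_norm_def by (rule order_trans[OF SUP_upper, of x]) auto

lemma lip_norm_le:
  assumes "\<And>x. x \<in> Y \<Longrightarrow> \<bar>f x\<bar> \<le> B" "\<And>x y. x \<in> Y \<Longrightarrow> y \<in> Y \<Longrightarrow> \<bar>f x - f y\<bar> \<le> L * norm (x - y)"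
  shows "lip_norm Y f \<le> ennreal B + ennreal L"
  unfolding lip_norm_def
proof (intro add_mono SUP_least)
  fix p assume "p \<in> {(x, y). x \<in> Y \<and> y \<in> Y \<and> x \<noteq> y}"
  then obtain x y where p: "p = (x, y)" "x \<in> Y" "y \<in> Y" "x \<noteq> y" by auto
  then have "\<bar>f x - f y\<bar> / norm (x - y) \<le> L"
    using assms(2)[of x y] by (simp add: divide_le_eq)
  then show "(case p of (x, y) \<Rightarrow> ennreal (\<bar>f x - f y\<bar> / norm (x - y))) \<le> ennreal L"
    unfolding p(1) by (simp add: ennreal_leI)
qed (use assms(1) in \<open>auto intro: ennreal_leI\<close>)

lemma lip_norm_triangle:
  "lip_norm Y (\<lambda>x. f x + g x) \<le> lip_norm Y f + lip_norm Y g"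
proof -
  let ?P = "{(x, y). x \<in> Y \<and> y \<in> Y \<and> x \<noteq> y}"
  let ?q = "\<lambda>f (x, y). ennreal (\<bar>f x - f y\<bar> / norm (x - y))"
  have 1: "(SUP x\<in>Y. ennreal \<bar>f x + g x\<bar>) \<le> (SUP x\<in>Y. ennreal \<bar>f x\<bar>) + (SUP x\<in>Y. ennreal \<bar>g x\<bar>)"
  proof (rule SUP_least)
    fix x assume "x \<in> Y"
    have "ennreal \<bar>f x + g x\<bar> \<le> ennreal \<bar>f x\<bar> + ennreal \<bar>g x\<bar>"
      by (simp add: ennreal_plus[symmetric] abs_triangle_ineq ennreal_leI del: ennreal_plus)
    also have "\<dots> \<le> (SUP x\<in>Y. ennreal \<bar>f x\<bar>) + (SUP x\<in>Y. ennreal \<bar>g x\<bar>)"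
      using \<open>x \<in> Y\<close> by (intro add_mono SUP_upper)
    finally show "ennreal \<bar>f x + g x\<bar> \<le> (SUP x\<in>Y. ennreal \<bar>f x\<bar>) + (SUP x\<in>Y. ennreal \<bar>g x\<bar>)" .
  qed
  have 2: "(SUP p\<in>?P. ?q (\<lambda>x. f x + g x) p) \<le> (SUP p\<in>?P. ?q f p) + (SUP p\<in>?P. ?q g p)"
  proof (rule SUP_least)
    fix p assume "p \<in> ?P"
    obtain x y where p: "p = (x, y)" by (cases p)
    have "\<bar>(f x + g x) - (f y + g y)\<bar> / norm (x - y) \<le> \<bar>f x - f y\<bar> / norm (x - y) + \<bar>g x - g y\<bar> / norm (x - y)"
      unfolding add_divide_distrib[symmetric] by (intro divide_right_mono) auto
    then have "?q (\<lambda>x. f x + g x) p \<le> ?q f p + ?q g p"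
      unfolding p by (simp add: ennreal_plus[symmetric] ennreal_leI del: ennreal_plus)
    also have "\<dots> \<le> (SUP p\<in>?P. ?q f p) + (SUP p\<in>?P. ?q g p)"
      using \<open>p \<in> ?P\<close> by (intro add_mono SUP_upper)
    finally show "?q (\<lambda>x. f x + g x) p \<le> (SUP p\<in>?P. ?q f p) + (SUP p\<in>?P. ?q g p)" .
  qed
  show ?thesis
    using add_mono[OF 1 2] by (simp add: lip_norm_def add_ac)
qed

abbreviation lip_seminorm :: "'a::real_normed_vector set \<Rightarrow> ('a \<Rightarrow> real) \<Rightarrow> real" where
  "lip_seminorm Y f \<equiv> enn2real (min 1 (lip_norm Y f))"

lemma lip_seminorm_bounds: "0 \<le> lip_seminorm Y f" "lip_seminorm Y f \<le> 1"
proof -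
  have "lip_seminorm Y f \<le> enn2real 1" by (rule enn2real_mono) (auto simp: min_def)
  then show "lip_seminorm Y f \<le> 1" by simp
qed simp

lemma lip_seminorm_ge:
  assumes "x \<in> Y"
  shows "min 1 \<bar>f x\<bar> \<le> lip_seminorm Y f"
proof -
  have "ennreal (min 1 \<bar>f x\<bar>) \<le> min 1 (lip_norm Y f)"
    by (intro min.boundedI order_trans[OF ennreal_leI lip_norm_ge[OF assms]]) simp_all
  then have "enn2real (ennreal (min 1 \<bar>f x\<bar>)) \<le> lip_seminorm Y f"
    by (rule enn2real_mono) (rule le_less_trans[of _ 1], auto)
  then show ?thesis by simp
qed

lemma lip_seminorm_le:
  assumes "lip_norm Y f \<le> ennreal C" "C \<ge> 0"
  shows "lip_seminorm Y f \<le> min 1 C"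
proof -
  have "lip_seminorm Y f \<le> enn2real (ennreal C)"
    by (rule enn2real_mono) (use assms(1) in \<open>simp_all add: min.coboundedI2\<close>)
  then show ?thesis using assms(2) lip_seminorm_bounds(2) by simp
qed

lemma lip_seminorm_triangle:
  "lip_seminorm Y (\<lambda>x. f x + g x) \<le> lip_seminorm Y f + lip_seminorm Y g"
proof -
  have fin: "min 1 a < \<top>" for a :: ennreal
    by (rule le_less_trans[of _ 1]) auto
  have "min 1 (lip_norm Y (\<lambda>x. f x + g x)) \<le> min 1 (lip_norm Y f + lip_norm Y g)"
    by (intro min.mono order_refl lip_norm_triangle)
  also have "\<dots> \<le> min 1 (lip_norm Y f) + min 1 (lip_norm Y g)"
    by (auto simp: min_def add_increasing add_increasing2)
  finally have "lip_seminorm Y (\<lambda>x. f x + g x) \<le> enn2real (min 1 (lip_norm Y f) + min 1 (lip_norm Y g))"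
    by (rule enn2real_mono) (simp add: fin)
  also have "\<dots> = lip_seminorm Y f + lip_seminorm Y g"
    by (rule enn2real_plus) (simp_all add: fin)
  finally show ?thesis .
qed

lemma half_power_sums: "(\<lambda>n. (1/2) ^ Suc n :: real) sums 1"
  using power_half_series by simp

lemma summable_lip_dist: "summable (\<lambda>n. (1/2) ^ Suc n * lip_seminorm (Y n) (f n))"
proof (rule summable_comparison_test')
  show "summable (\<lambda>n. (1/2) ^ Suc n :: real)" using half_power_sums by (rule sums_summable)
  show "norm ((1/2) ^ Suc n * lip_seminorm (Y n) (f n)) \<le> (1/2) ^ Suc n" if "n \<ge> 0" for n
    using lip_seminorm_bounds[of "Y n" "f n"] by (simp add: mult_left_le)
qed

lemma lip_dist_term_le:
  "(1/2) ^ Suc n * lip_seminorm (U n \<inter> X) (\<lambda>x. h x - h' x) \<le> lip_dist U X h h'"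
proof -
  have "(\<Sum>i\<in>{n}. (1/2) ^ Suc i * lip_seminorm (U i \<inter> X) (\<lambda>x. h x - h' x)) \<le> lip_dist U X h h'"
    unfolding lip_dist_def
    by (rule sum_le_suminf[OF summable_lip_dist]) (auto simp: lip_seminorm_bounds)
  then show ?thesis by simp
qed

text \<open>The weight of \<open>U n\<close> converts closeness in the metric into uniform closeness
  on \<open>U n\<close>. Truncation hides the size of differences above 1, hence
  \<open>\<delta> \<le> 1\<close>.\<close>

lemma lip_dist_less_imp:
  assumes "lip_dist U X h h' < (1/2) ^ Suc n * \<delta>" "\<delta> \<le> 1" "x \<in> U n" "x \<in> X"
  shows "\<bar>h x - h' x\<bar> < \<delta>"
proof -
  have "(1/2) ^ Suc n * min 1 \<bar>h x - h' x\<bar> \<le> (1/2) ^ Suc n * lip_seminorm (U n \<inter> X) (\<lambda>x. h x - h' x)"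
    using assms(3,4) by (intro mult_left_mono lip_seminorm_ge) auto
  also have "\<dots> < (1/2) ^ Suc n * \<delta>" using lip_dist_term_le assms(1) by (rule le_less_trans)
  finally have "min 1 \<bar>h x - h' x\<bar> < \<delta>" by simp
  then show ?thesis using assms(2) by linarith
qed

lemma lip_dist_cong:
  assumes "\<And>x. x \<in> X \<Longrightarrow> f x - g x = f' x - g' x"
  shows "lip_dist U X f g = lip_dist U X f' g'"
proof -
  have "lip_norm (U n \<inter> X) (\<lambda>x. f x - g x) = lip_norm (U n \<inter> X) (\<lambda>x. f' x - g' x)" for n
    by (rule lip_norm_cong) (use assms in auto)
  then show ?thesis by (simp add: lip_dist_def)
qed

locale lip_space =
  fixes U :: "nat \<Rightarrow> 'a::real_normed_vector set" and X :: "'a set"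
  assumes basis: "topological_basis (range U)"
begin

lemma covers: "\<exists>n. x \<in> U n"
  using topological_basisE[OF basis open_UNIV, of x] by blast

lemma open_U: "open (U n)"
  using topological_basis_open[OF basis] by blast

sublocale Metric_space "lip_loc X" "lip_dist U X"
proof
  fix f g h
  show "0 \<le> lip_dist U X f g"
    unfolding lip_dist_def by (intro suminf_nonneg summable_lip_dist) (simp add: lip_seminorm_bounds)
  show "lip_dist U X f g = lip_dist U X g f"
    unfolding lip_dist_def using lip_norm_uminus[of _ "\<lambda>x. f x - g x"] by simp
  show "lip_dist U X f g = 0 \<longleftrightarrow> f = g" if "f \<in> lip_loc X" "g \<in> lip_loc X"
  proof
    assume 0: "lip_dist U X f g = 0"
    have "f x = g x" if "x \<in> X" for x
    proof (rule ccontr)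
      assume "f x \<noteq> g x"
      obtain n where "x \<in> U n" using covers by blast
      \<comment> \<open>At distance 0 the tolerance may depend on the point; taking the supposed
        difference itself, capped at 1, is contradictory.\<close>
      have "\<bar>f x - g x\<bar> < min 1 \<bar>f x - g x\<bar>"
        by (rule lip_dist_less_imp[of U X f g n]) (use 0 \<open>f x \<noteq> g x\<close> \<open>x \<in> U n\<close> that in auto)
      then show False by simp
    qed
    then show "f = g" using that unfolding lip_loc_def by (blast intro: extensionalityI)
  next
    assume "f = g"
    have "lip_seminorm Y (\<lambda>x. 0) \<le> min 1 0" for Y :: "'a set"
      by (rule lip_seminorm_le) (use lip_norm_le[of Y "\<lambda>_. 0" 0 0] in auto)
    then have "lip_seminorm Y (\<lambda>x. 0) = 0" for Y :: "'a set"
      using lip_seminorm_bounds(1)[of Y "\<lambda>_. 0"] by (simp add: antisym)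
    then show "lip_dist U X f g = 0" unfolding lip_dist_def \<open>f = g\<close> by simp
  qed
  show "lip_dist U X f h \<le> lip_dist U X f g + lip_dist U X g h"
  proof -
    have "lip_seminorm (U n \<inter> X) (\<lambda>x. f x - h x) \<le>
        lip_seminorm (U n \<inter> X) (\<lambda>x. f x - g x) + lip_seminorm (U n \<inter> X) (\<lambda>x. g x - h x)" for n
      using lip_seminorm_triangle[of "U n \<inter> X" "\<lambda>x. f x - g x" "\<lambda>x. g x - h x"] by simp
    then show ?thesis unfolding lip_dist_def
      by (subst suminf_add[OF summable_lip_dist summable_lip_dist])
        (intro suminf_le summable_lip_dist summable_add, simp_all add: distrib_left[symmetric])
  qed
qed

lemma mtopology_eq: "mtopology = lip_topology U X"
  by (simp add: lip_topology_def)

text \<open>Finitely many basis sets cover \<open>K\<close>, so only finitely many weights have to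
  be beaten.\<close>

lemma uniform_on_compact:
  assumes "compact K" "K \<subseteq> X" "\<delta> > 0"
  obtains \<eta> where "\<eta> > 0" "\<And>h h' x. lip_dist U X h h' < \<eta> \<Longrightarrow> x \<in> K \<Longrightarrow> \<bar>h x - h' x\<bar> < \<delta>"
proof -
  have "K \<subseteq> (\<Union>n\<in>UNIV. U n)" using covers by auto
  from compactE_image[OF assms(1) open_U this]
  obtain I where I: "finite I" "K \<subseteq> (\<Union>n\<in>I. U n)" by auto
  define \<delta>' where "\<delta>' = min 1 \<delta>"
  \<comment> \<open>The extra 1 keeps the minimum over a nonempty set when \<open>I\<close> is
    empty.\<close>
  define \<eta> where "\<eta> = Min (insert 1 ((\<lambda>n. (1/2) ^ Suc n * \<delta>') ` I))"
  have fin: "finite (insert 1 ((\<lambda>n. (1/2) ^ Suc n * \<delta>') ` I))" using I(1) by simp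
  show thesis
  proof
    show "\<eta> > 0" unfolding \<eta>_def using assms(3) fin by (subst Min_gr_iff) (auto simp: \<delta>'_def)
    fix h h' x assume h: "lip_dist U X h h' < \<eta>" and "x \<in> K"
    then obtain n where n: "n \<in> I" "x \<in> U n" using I(2) by auto
    have "\<eta> \<le> (1/2) ^ Suc n * \<delta>'" unfolding \<eta>_def using n fin by (intro Min_le) auto
    then have "lip_dist U X h h' < (1/2) ^ Suc n * \<delta>'" using h by linarith
    moreover have "\<delta>' \<le> 1" by (simp add: \<delta>'_def)
    moreover have "x \<in> X" using \<open>x \<in> K\<close> assms(2) by blast
    ultimately have "\<bar>h x - h' x\<bar> < \<delta>'" using n(2) by (intro lip_dist_less_imp)
    then show "\<bar>h x - h' x\<bar> < \<delta>" by (simp add: \<delta>'_def)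
  qed
qed

end

section \<open>Closure properties of locally Lipschitz maps\<close>

lemma locally_lipschitz_on_imp_continuous_on:
  assumes "locally_lipschitz_on X f"
  shows "continuous_on X f"
  unfolding continuous_on_eq_continuous_within
proof
  fix x assume "x \<in> X"
  then obtain W L where W: "open W" "x \<in> W" "L-lipschitz_on (W \<inter> X) f"
    using assms unfolding locally_lipschitz_on_def by blast
  have "continuous_on (W \<inter> X) f" using W(3) by (rule lipschitz_on_continuous_on)
  then have "continuous (at x within W \<inter> X) f"
    using W(2) \<open>x \<in> X\<close> by (simp add: continuous_on_eq_continuous_within)
  moreover have "at x within W \<inter> X = at x within X"
    using W(2,1) by (rule at_within_nhd) auto
  ultimately show "continuous (at x within X) f"
    unfolding continuous_within by simp
qed

lemma locally_lipschitz_on_compose: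
  assumes f: "locally_lipschitz_on X f" and g: "locally_lipschitz_on Y g" and XY: "f \<in> X \<rightarrow> Y"
  shows "locally_lipschitz_on X (\<lambda>x. g (f x))"
  unfolding locally_lipschitz_on_def
proof
  fix x assume x: "x \<in> X"
  obtain W L where W: "open W" "x \<in> W" "L-lipschitz_on (W \<inter> X) f"
    using f x unfolding locally_lipschitz_on_def by blast
  obtain V M where V: "open V" "f x \<in> V" "M-lipschitz_on (V \<inter> Y) g"
    using g x XY unfolding locally_lipschitz_on_def by blast
  have "continuous_on X f" using f by (rule locally_lipschitz_on_imp_continuous_on)
  then obtain V' where V': "open V'" "V' \<inter> X = f -` V \<inter> X"
    using V(1) unfolding continuous_on_open_invariant by metis
  have "(M * L)-lipschitz_on ((W \<inter> V') \<inter> X) (\<lambda>x. g (f x))"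
  proof (rule lipschitz_on_compose2[where f = f and g = g])
    show "L-lipschitz_on ((W \<inter> V') \<inter> X) f" using W(3) by (rule lipschitz_on_subset) auto
    show "M-lipschitz_on (f ` ((W \<inter> V') \<inter> X)) g"
      using V(3) by (rule lipschitz_on_subset) (use V'(2) XY in auto)
  qed
  moreover have "x \<in> W \<inter> V'" using W(2) V(2) V'(2) x by blast
  ultimately show "\<exists>W. open W \<and> x \<in> W \<and> (\<exists>L. L-lipschitz_on (W \<inter> X) (\<lambda>x. g (f x)))"
    using open_Int[OF W(1) V'(1)] by blast
qed

lemma locally_lipschitz_on_funpow:
  assumes "locally_lipschitz_on X T" "T \<in> X \<rightarrow> X"
  shows "locally_lipschitz_on X (T ^^ i)"
proof (induction i)
  case 0
  have "1-lipschitz_on (UNIV \<inter> X) (\<lambda>x. x)" by (rule lipschitz_on_id)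
  then show ?case unfolding locally_lipschitz_on_def id_def funpow.simps(1)
    by (intro ballI exI[of _ UNIV] conjI exI[of _ 1]) auto
next
  case (Suc i)
  from locally_lipschitz_on_compose[OF assms(1) Suc assms(2)] show ?case
    unfolding funpow_Suc_right o_def .
qed

lemma funpow_in: "T \<in> X \<rightarrow> X \<Longrightarrow> x \<in> X \<Longrightarrow> (T ^^ i) x \<in> X"
  by (induction i) auto

lemma locally_lipschitz_on_monomials:
  "locally_lipschitz_on X (monomials :: real ^ 'n::finite \<Rightarrow> real ^ ('j::finite \<Rightarrow> 'n option))"
  unfolding locally_lipschitz_on_def
proof
  fix x assume "x \<in> X"
  have "bounded (ball x 1 \<inter> X)" by (simp add: bounded_Int)
  then obtain C where "C-lipschitz_on (ball x 1 \<inter> X) (monomials :: real ^ 'n \<Rightarrow> real ^ ('j \<Rightarrow> 'n option))"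
    by (rule monomials_lipschitz_bounded)
  then show "\<exists>W. open W \<and> x \<in> W \<and> (\<exists>L. L-lipschitz_on (W \<inter> X)
      (monomials :: real ^ 'n \<Rightarrow> real ^ ('j \<Rightarrow> 'n option)))"
    by (intro exI[of _ "ball x 1"]) auto
qed

lemma locally_lipschitz_on_inner_left:
  assumes "locally_lipschitz_on X f"
  shows "locally_lipschitz_on X (\<lambda>x. \<alpha> \<bullet> f x)"
proof (rule locally_lipschitz_on_compose[OF assms, of UNIV])
  obtain L where "L-lipschitz_on UNIV (\<lambda>x. \<alpha> \<bullet> x)"
    by (rule bounded_linear.lipschitz_boundE[OF bounded_linear_inner_right])
  then show "locally_lipschitz_on UNIV (\<lambda>x. \<alpha> \<bullet> x)"
    unfolding locally_lipschitz_on_def by (auto intro!: exI[of _ UNIV])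
qed auto

lemma locally_lipschitz_on_add:
  fixes f g :: "'a::metric_space \<Rightarrow> 'b::real_normed_vector"
  assumes "locally_lipschitz_on X f" "locally_lipschitz_on X g"
  shows "locally_lipschitz_on X (\<lambda>x. f x + g x)"
  unfolding locally_lipschitz_on_def
proof
  fix x assume x: "x \<in> X"
  obtain W L where W: "open W" "x \<in> W" "L-lipschitz_on (W \<inter> X) f"
    using assms(1) x unfolding locally_lipschitz_on_def by blast
  obtain V M where V: "open V" "x \<in> V" "M-lipschitz_on (V \<inter> X) g"
    using assms(2) x unfolding locally_lipschitz_on_def by blast
  have "(L + M)-lipschitz_on ((W \<inter> V) \<inter> X) (\<lambda>x. f x + g x)"
    by (intro lipschitz_on_add lipschitz_on_subset[OF W(3)] lipschitz_on_subset[OF V(3)]) auto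
  then show "\<exists>W. open W \<and> x \<in> W \<and> (\<exists>L. L-lipschitz_on (W \<inter> X) (\<lambda>x. f x + g x))"
    using W V by (intro exI[of _ "W \<inter> V"]) auto
qed

lemma restrict_in_lip_loc:
  assumes "locally_lipschitz_on X f"
  shows "restrict f X \<in> lip_loc X"
proof -
  have "L-lipschitz_on (W \<inter> X) (restrict f X) \<longleftrightarrow> L-lipschitz_on (W \<inter> X) f" for L W
    by (rule lipschitz_on_cong) auto
  then show ?thesis using assms by (simp add: lip_loc_def locally_lipschitz_on_def)
qed

lemma add_in_lip_loc:
  assumes "v \<in> lip_loc X" "e \<in> lip_loc X"
  shows "(\<lambda>x\<in>X. v x + e x) \<in> lip_loc X"
  using assms by (intro restrict_in_lip_loc locally_lipschitz_on_add) (auto simp: lip_loc_def)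

section \<open>The probe family and the measure witnessing prevalence\<close>

definition probe :: "(real ^ 'n::finite) set \<Rightarrow> real ^ ('j::finite \<Rightarrow> 'n option) \<Rightarrow> real ^ 'n \<Rightarrow> real" where
  "probe X \<alpha> = (\<lambda>x\<in>X. \<alpha> \<bullet> monomials x)"

lemma probe_in_lip_loc: "probe X \<alpha> \<in> lip_loc X"
  unfolding probe_def
  by (intro restrict_in_lip_loc locally_lipschitz_on_inner_left locally_lipschitz_on_monomials)

lemma space_borel_of: "space (borel_of \<tau>) = topspace \<tau>"
  unfolding borel_of_def by (rule space_measure_of) (auto dest: openin_subset)

lemma sets_borel_of: "sets (borel_of \<tau>) = sigma_sets (topspace \<tau>) {W. openin \<tau> W}"
  unfolding borel_of_def by (rule sets_measure_of) (auto dest: openin_subset)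

lemma openin_sets_borel_of: "openin \<tau> W \<Longrightarrow> W \<in> sets (borel_of \<tau>)"
  unfolding sets_borel_of by auto

lemma closedin_sets_borel_of:
  assumes "closedin \<tau> W" shows "W \<in> sets (borel_of \<tau>)"
proof -
  have "topspace \<tau> - (topspace \<tau> - W) \<in> sets (borel_of \<tau>)"
    using assms sets.compl_sets[OF openin_sets_borel_of, of \<tau> "topspace \<tau> - W"]
    by (simp add: closedin_def space_borel_of)
  then show ?thesis using closedin_subset[OF assms] by (simp add: double_diff)
qed

lemma continuous_map_measurable_borel_of:
  assumes "continuous_map \<sigma> \<tau> f"
  shows "f \<in> borel_of \<sigma> \<rightarrow>\<^sub>M borel_of \<tau>"
  unfolding borel_of_def[of \<tau>]
proof (rule measurable_measure_of)
  show "{W. openin \<tau> W} \<subseteq> Pow (topspace \<tau>)" by (auto dest: openin_subset)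
  show "f \<in> space (borel_of \<sigma>) \<rightarrow> topspace \<tau>"
    using assms by (auto simp: continuous_map_def space_borel_of)
  fix W assume "W \<in> {W. openin \<tau> W}"
  then have "openin \<sigma> {x \<in> topspace \<sigma>. f x \<in> W}" using assms by (simp add: continuous_map_def)
  then show "f -` W \<inter> space (borel_of \<sigma>) \<in> sets (borel_of \<sigma>)"
    by (simp add: space_borel_of vimage_def Int_def conj_commute openin_sets_borel_of)
qed

lemma borel_of_euclidean: "borel_of euclidean = (borel :: 'a::topological_space measure)"
  by (simp add: borel_of_def borel_def)

locale lip_space_cart = lip_space U X
  for U :: "nat \<Rightarrow> (real ^ 'n::finite) set" and X +
  assumes bounded_U: "\<And>n. bounded (U n)"
begin

text \<open>On each bounded \<open>U n\<close> the norm of a probe is at most a constant times the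
  norm of its parameter, but these constants are not controlled as \<open>n\<close> grows.
  Truncation at 1 and the summable weights give a dominated series, whose sum depends continuously
  on the parameter difference.\<close>

lemma continuous_probe:
  "continuous_map euclidean mtopology (probe X :: real ^ ('j::finite \<Rightarrow> 'n option) \<Rightarrow> _)"
  unfolding continuous_map_to_metric
proof (intro ballI allI impI)
  fix \<alpha> :: "real ^ ('j \<Rightarrow> 'n option)" and \<epsilon> :: real assume "\<epsilon> > 0"
  let ?F = "monomials :: real ^ 'n \<Rightarrow> real ^ ('j \<Rightarrow> 'n option)"
  have "\<exists>C. C \<ge> 0 \<and> (\<forall>x\<in>U n \<inter> X. norm (?F x) \<le> C) \<and> C-lipschitz_on (U n \<inter> X) ?F" for n
    using monomials_lipschitz_bounded[of "U n \<inter> X", where ?'j = 'j] bounded_U[of n]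
    by (metis bounded_Int)
  then obtain C where C: "\<And>n. C n \<ge> 0" "\<And>n x. x \<in> U n \<inter> X \<Longrightarrow> norm (?F x) \<le> C n"
      "\<And>n. (C n)-lipschitz_on (U n \<inter> X) ?F"
    by metis
  \<comment> \<open>Majorant of the \<open>n\<close>-th term of the distance at parameter difference
    \<open>t\<close>; the factor 2 adds the supremum part and the Lipschitz part of
    \<open>lip_norm\<close>.\<close>
  define g where "g t n = (1/2) ^ Suc n * min 1 (2 * C n * \<bar>t\<bar>)" for t :: real and n
  have g: "norm (g t n) \<le> (1/2) ^ Suc n" for t n
    using C(1)[of n] by (simp add: g_def mult_left_le abs_mult)
  have sg: "summable (\<lambda>n. (1/2) ^ Suc n :: real)" using half_power_sums by (rule sums_summable)
  have "uniform_limit UNIV (\<lambda>n t. \<Sum>i<n. g t i) (\<lambda>t. suminf (g t)) sequentially"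
    using g sg by (intro Weierstrass_m_test)
  then have "continuous_on UNIV (\<lambda>t. suminf (g t))"
    by (rule uniform_limit_theorem[rotated])
      (auto simp: g_def intro!: always_eventually continuous_intros)
  moreover have "suminf (g 0) = 0"
  proof -
    have "g 0 = (\<lambda>n. 0)" by (rule ext) (simp add: g_def)
    then show ?thesis by simp
  qed
  ultimately obtain \<delta> where \<delta>: "\<delta> > 0" "\<And>t. \<bar>t\<bar> < \<delta> \<Longrightarrow> \<bar>suminf (g t)\<bar> < \<epsilon>"
    using \<open>\<epsilon> > 0\<close> unfolding continuous_on_iff by (metis UNIV_I diff_zero dist_real_def)
  have le: "lip_dist U X (probe X \<alpha>) (probe X \<beta>) \<le> suminf (g (norm (\<alpha> - \<beta>)))" for \<beta>
    unfolding lip_dist_def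
  proof (rule suminf_le)
    show "summable (g (norm (\<alpha> - \<beta>)))"
      using g sg by (rule summable_comparison_test'[rotated, where N = 0])
    show "summable (\<lambda>n. (1/2) ^ Suc n * lip_seminorm (U n \<inter> X) (\<lambda>x. probe X \<alpha> x - probe X \<beta> x))"
      by (rule summable_lip_dist)
    fix n
    let ?t = "norm (\<alpha> - \<beta>)" and ?f = "\<lambda>x. probe X \<alpha> x - probe X \<beta> x"
    have f: "?f x = (\<alpha> - \<beta>) \<bullet> ?F x" if "x \<in> U n \<inter> X" for x
      using that by (simp add: probe_def inner_diff_left)
    have "lip_norm (U n \<inter> X) ?f \<le> ennreal (C n * ?t) + ennreal (C n * ?t)"
    proof (rule lip_norm_le)
      fix x assume x: "x \<in> U n \<inter> X"
      have "\<bar>(\<alpha> - \<beta>) \<bullet> ?F x\<bar> \<le> ?t * norm (?F x)" by (rule Cauchy_Schwarz_ineq2)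
      also have "\<dots> \<le> ?t * C n" using C(2)[OF x] by (intro mult_left_mono) auto
      finally show "\<bar>?f x\<bar> \<le> C n * ?t" by (simp only: f[OF x] mult.commute)
      fix y assume y: "y \<in> U n \<inter> X"
      have "\<bar>(\<alpha> - \<beta>) \<bullet> (?F x - ?F y)\<bar> \<le> ?t * norm (?F x - ?F y)" by (rule Cauchy_Schwarz_ineq2)
      also have "\<dots> \<le> ?t * (C n * norm (x - y))"
        using lipschitz_onD[OF C(3) x y] by (intro mult_left_mono) (auto simp: dist_norm)
      finally show "\<bar>?f x - ?f y\<bar> \<le> C n * ?t * norm (x - y)"
        by (simp only: f[OF x] f[OF y] inner_diff_right mult_ac)
    qed
    also have "\<dots> = ennreal (2 * C n * \<bar>?t\<bar>)" using C(1)[of n] by (simp flip: ennreal_plus)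
    finally have "lip_seminorm (U n \<inter> X) ?f \<le> min 1 (2 * C n * \<bar>?t\<bar>)"
      using C(1)[of n] by (intro lip_seminorm_le) auto
    then show "(1/2) ^ Suc n * lip_seminorm (U n \<inter> X) ?f \<le> g ?t n"
      unfolding g_def by (intro mult_left_mono) auto
  qed
  have "probe X \<beta> \<in> mball (probe X \<alpha>) \<epsilon>" if "\<beta> \<in> ball \<alpha> \<delta>" for \<beta>
    using le[of \<beta>] \<delta>(2)[of "norm (\<alpha> - \<beta>)"] that
    by (simp add: probe_in_lip_loc dist_norm)
  then show "\<exists>V. openin euclidean V \<and> \<alpha> \<in> V \<and> (\<forall>\<beta>\<in>V. probe X \<beta> \<in> mball (probe X \<alpha>) \<epsilon>)"
    using \<delta>(1) by (intro exI[of _ "ball \<alpha> \<delta>"]) auto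
qed

text \<open>Translations are isometries of \<open>lip_dist\<close>.\<close>

lemma continuous_translation:
  assumes "v \<in> lip_loc X"
  shows "continuous_map mtopology mtopology (\<lambda>e. \<lambda>x\<in>X. v x + e x)"
  unfolding continuous_map_to_metric
proof (intro ballI allI impI)
  fix e \<epsilon> assume e: "e \<in> topspace mtopology" and "\<epsilon> > (0::real)"
  have "lip_dist U X (\<lambda>x\<in>X. v x + e x) (\<lambda>x\<in>X. v x + e' x) = lip_dist U X e e'" for e'
    by (rule lip_dist_cong) simp
  then have "(\<lambda>x\<in>X. v x + e' x) \<in> mball (\<lambda>x\<in>X. v x + e x) \<epsilon>" if "e' \<in> mball e \<epsilon>" for e'
    using that assms by (simp add: add_in_lip_loc)
  then show "\<exists>V. openin mtopology V \<and> e \<in> V \<and>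
      (\<forall>e'\<in>V. (\<lambda>x\<in>X. v x + e' x) \<in> mball (\<lambda>x\<in>X. v x + e x) \<epsilon>)"
    using e \<open>\<epsilon> > 0\<close> by (intro exI[of _ "mball e \<epsilon>"]) auto
qed

text \<open>The witness is the law of \<open>probe X \<alpha>\<close> for \<open>\<alpha>\<close>
  uniform in the closed unit ball. It is concentrated on the compact image of that ball, and almost
  sure statements about it become statements about Lebesgue almost every \<open>\<alpha>\<close> in
  the ball.\<close>

lemma borel_prevalentI:
  assumes S: "S \<in> sets (borel_of (lip_topology U X))"
    and AE: "\<And>v. v \<in> lip_loc X \<Longrightarrow> AE \<alpha> :: real ^ ('j::finite \<Rightarrow> 'n option) in lborel.
      norm \<alpha> \<le> 1 \<longrightarrow> (\<lambda>x\<in>X. v x + probe X \<alpha> x) \<in> S"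
  shows "borel_prevalent U X S"
proof -
  let ?B = "cball (0 :: real ^ ('j \<Rightarrow> 'n option)) 1"
  let ?P = "uniform_measure lborel ?B"
  let ?N = "borel_of (lip_topology U X)"
  define \<nu> where "\<nu> = distr ?P ?N (probe X)"
  have B: "emeasure lborel ?B \<noteq> 0" "emeasure lborel ?B \<noteq> \<infinity>"
  proof -
    show "emeasure lborel ?B \<noteq> 0"
      using content_cball_pos[of 1 "0 :: real ^ ('j \<Rightarrow> 'n option)"] by (auto simp: measure_def)
    show "emeasure lborel ?B \<noteq> \<infinity>"
      by (metis emeasure_lborel_cball_finite less_irrefl)
  qed
  have meas: "probe X \<in> ?P \<rightarrow>\<^sub>M ?N"
    using continuous_map_measurable_borel_of[OF continuous_probe]
    by (simp add: borel_of_euclidean mtopology_eq cong: measurable_cong_sets)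
  interpret P: prob_space ?P using B by (rule prob_space_uniform_measure)
  interpret \<nu>: prob_space \<nu> unfolding \<nu>_def by (rule P.prob_space_distr[OF meas])
  define K where "K = probe X ` ?B"
  have cK: "compactin mtopology K"
    unfolding K_def by (rule image_compactin[OF _ continuous_probe]) simp
  then have K: "K \<in> sets ?N"
    using compactin_imp_closedin[OF Hausdorff_space_mtopology] mtopology_eq
    by (metis closedin_sets_borel_of)
  have "AE e in \<nu>. e \<in> K"
    unfolding \<nu>_def
    by (subst AE_distr_iff[OF meas]) (use K in \<open>auto simp: K_def intro!: AE_uniform_measureI\<close>)
  then have "emeasure \<nu> K = 1" using K by (intro \<nu>.emeasure_eq_1_AE) (auto simp: \<nu>_def)
  moreover have "AE e in \<nu>. (\<lambda>x\<in>X. v x + e x) \<in> S" if v: "v \<in> lip_loc X" for v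
  proof -
    have "{e \<in> space ?N. (\<lambda>x\<in>X. v x + e x) \<in> S} \<in> sets ?N"
      using measurable_sets[OF continuous_map_measurable_borel_of[OF continuous_translation[OF v]], of S] S
      unfolding mtopology_eq by (simp add: vimage_def Int_def conj_commute)
    then show ?thesis
      unfolding \<nu>_def by (subst AE_distr_iff[OF meas]) (use AE[OF v] in \<open>auto intro!: AE_uniform_measureI\<close>)
  qed
  ultimately show ?thesis
    unfolding borel_prevalent_def using S cK
    by (intro conjI exI[of _ \<nu>] exI[of _ K]) (auto simp: \<nu>_def mtopology_eq)
qed

end

section \<open>Exceptional parameters\<close>

text \<open>Sets of exceptional parameters are not known to be measurable; intersecting measurable
  supersets of measure at most \<open>1 / Suc n\<close> gives a null superset.\<close>

lemma null_set_by_approximation: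
  assumes "\<And>\<epsilon>. \<epsilon> > 0 \<Longrightarrow> \<exists>S\<in>sets M. N \<subseteq> S \<and> emeasure M S \<le> ennreal \<epsilon>"
  shows "\<exists>N'\<in>null_sets M. N \<subseteq> N'"
proof -
  have "\<exists>S\<in>sets M. N \<subseteq> S \<and> emeasure M S \<le> ennreal (1 / Suc n)" for n
    by (rule assms) simp
  then obtain S where S: "\<And>n. S n \<in> sets M" "\<And>n. N \<subseteq> S n" "\<And>n. emeasure M (S n) \<le> ennreal (1 / Suc n)"
    by metis
  have sets: "(\<Inter>n. S n) \<in> sets M" using S(1) by (intro sets.countable_INT) auto
  have "emeasure M (\<Inter>n. S n) \<le> 0"
  proof (rule ennreal_le_epsilon)
    fix e :: real assume "e > 0"
    then obtain n where n: "1 / Suc n < e" using nat_approx_posE by blast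
    have "emeasure M (\<Inter>n. S n) \<le> emeasure M (S n)" using S(1) by (intro emeasure_mono) auto
    also have "\<dots> \<le> ennreal e" using S(3)[of n] n by (meson ennreal_leI less_imp_le order_trans)
    finally show "emeasure M (\<Inter>n. S n) \<le> 0 + ennreal e" by simp
  qed
  then show ?thesis using sets S(2) by (intro bexI[of _ "\<Inter>n. S n"]) (auto intro!: null_setsI)
qed

lemma compact_sublevel:
  fixes g :: "'i \<Rightarrow> 'a::t2_space \<Rightarrow> real"
  assumes "compact C" "\<And>i. i \<in> I \<Longrightarrow> continuous_on C (g i)"
  shows "compact {z\<in>C. \<forall>i\<in>I. g i z \<le> c i}"
proof (cases "I = {}")
  case True then show ?thesis using assms(1) by simp
next
  case False
  have "closedin (top_of_set C) (\<Inter>i\<in>I. C \<inter> g i -` {..c i})"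
    using False assms(2) by (intro closedin_INT continuous_closedin_preimage) auto
  moreover have "(\<Inter>i\<in>I. C \<inter> g i -` {..c i}) = {z\<in>C. \<forall>i\<in>I. g i z \<le> c i}"
    using False by auto
  ultimately show ?thesis using closedin_compact[OF assms(1)] by simp
qed

lemma compact_solution_set:
  fixes g :: "'i \<Rightarrow> 'a::t2_space \<Rightarrow> real"
  assumes "compact C" "\<And>i. i \<in> I \<Longrightarrow> continuous_on C (g i)"
  shows "compact {z\<in>C. \<forall>i\<in>I. g i z = c i}"
proof -
  have "compact {z\<in>C. \<forall>i\<in>I. \<bar>g i z - c i\<bar> \<le> 0}"
    using assms by (intro compact_sublevel continuous_intros)
  then show ?thesis by simp
qed

lemma locally_lipschitz_on_finite:
  assumes "finite I" "\<And>i. i \<in> I \<Longrightarrow> locally_lipschitz_on X (f i)" "x \<in> X"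
  shows "\<exists>W L. open W \<and> x \<in> W \<and> L \<ge> 0 \<and> (\<forall>i\<in>I. L-lipschitz_on (W \<inter> X) (f i))"
  using assms(1,2)
proof (induction I)
  case empty
  show ?case by (intro exI[of _ UNIV] exI[of _ 0]) auto
next
  case (insert i I)
  then obtain W L where W: "open W" "x \<in> W" "L \<ge> 0" "\<forall>i\<in>I. L-lipschitz_on (W \<inter> X) (f i)"
    by auto
  have "locally_lipschitz_on X (f i)" by (rule insert.prems) simp
  then obtain V M where V: "open V" "x \<in> V" "M-lipschitz_on (V \<inter> X) (f i)"
    using assms(3) unfolding locally_lipschitz_on_def by blast
  have "(max L M)-lipschitz_on (W \<inter> V \<inter> X) (f j)" if "j \<in> insert i I" for j
  proof (cases "j = i")
    case True
    then show ?thesis using V(3) by (auto intro: lipschitz_on_mono)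
  next
    case False
    then have "L-lipschitz_on (W \<inter> X) (f j)" using W(4) that by blast
    then show ?thesis by (rule lipschitz_on_mono) auto
  qed
  then show ?case using W(1-3) V(1,2)
    by (intro exI[of _ "W \<inter> V"] exI[of _ "max L M"]) auto
qed

text \<open>A dual family at \<open>y0\<close> remains nearly dual for all \<open>y\<close> in a
  small ball, so one packing constant serves the whole ball. If the delay vectors of
  \<open>x\<close> and \<open>z\<close> agree for \<open>\<alpha>\<close>, those of \<open>x\<close>
  and the base point \<open>y j\<close> of a piece containing \<open>z\<close> differ entrywise by
  at most \<open>2 * L * r j\<close>; so this piece accounts for parameters of measure at most
  \<open>c * r j ^ k\<close>.\<close>

lemma null_parameters_local:
  fixes F :: "'a::metric_space \<Rightarrow> 'e::euclidean_space" and v :: "'a \<Rightarrow> real"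
  assumes v: "locally_lipschitz_on X v" and F: "locally_lipschitz_on X F"
    and T: "locally_lipschitz_on X T" "T \<in> X \<rightarrow> X"
    and K: "K \<subseteq> X" "null_cover k K" and k: "k \<ge> 1"
    and y0: "y0 \<in> X" "dual_pair F T k x y0"
  shows "\<exists>V N. open V \<and> y0 \<in> V \<and> N \<in> null_sets lborel \<and>
    {\<alpha>\<in>cball 0 1. \<exists>y\<in>K \<inter> V. \<forall>i<k. v ((T ^^ i) x) + \<alpha> \<bullet> F ((T ^^ i) x) = v ((T ^^ i) y) + \<alpha> \<bullet> F ((T ^^ i) y)} \<subseteq> N"
proof -
  define w where "w y i = F ((T ^^ i) x) - F ((T ^^ i) y)" for y i
  obtain b where b: "\<And>i l. i < k \<Longrightarrow> l < k \<Longrightarrow> w y0 i \<bullet> b l = (if i = l then 1 else 0)"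
    using y0(2) unfolding dual_pair_def w_def by blast
  have Ti: "locally_lipschitz_on X (T ^^ i)" "(T ^^ i) \<in> X \<rightarrow> X" for i
    using locally_lipschitz_on_funpow[OF T] funpow_in[OF T(2)] by auto
  obtain W1 L1 where W1: "open W1" "y0 \<in> W1" "L1 \<ge> 0" "\<And>i. i < k \<Longrightarrow> L1-lipschitz_on (W1 \<inter> X) (\<lambda>y. v ((T ^^ i) y))"
    using locally_lipschitz_on_finite[of "{..<k}" X "\<lambda>i y. v ((T ^^ i) y)" y0] y0(1)
      locally_lipschitz_on_compose[OF Ti(1) v Ti(2)] by auto
  obtain W2 L2 where W2: "open W2" "y0 \<in> W2" "L2 \<ge> 0" "\<And>i. i < k \<Longrightarrow> L2-lipschitz_on (W2 \<inter> X) (\<lambda>y. F ((T ^^ i) y))"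
    using locally_lipschitz_on_finite[of "{..<k}" X "\<lambda>i y. F ((T ^^ i) y)" y0] y0(1)
      locally_lipschitz_on_compose[OF Ti(1) F Ti(2)] by auto
  define L where "L = L1 + L2"
  have L: "L \<ge> 0" using W1(3) W2(3) by (simp add: L_def)
  define \<beta> where "\<beta> = (\<Sum>l<k. norm (b l))"
  have \<beta>: "norm (b l) \<le> \<beta>" if "l < k" for l
    unfolding \<beta>_def using that by (intro member_le_sum) auto
  have \<beta>0: "\<beta> \<ge> 0" by (simp add: \<beta>_def sum_nonneg)
  \<comment> \<open>Chosen so that \<open>(L + 1) * \<delta> * (\<beta> + 1)\<close> is exactly the
    tolerance \<open>1 / (2 * real k)\<close> of the packing bound; adding 1 avoids zero
    denominators.\<close>
  define \<delta> where "\<delta> = 1 / (2 * real k * (L + 1) * (\<beta> + 1))"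
  have \<delta>: "\<delta> > 0" using k L \<beta>0 by (simp add: \<delta>_def)
  define V where "V = W1 \<inter> W2 \<inter> ball y0 \<delta>"
  have V: "open V" "y0 \<in> V" using W1 W2 \<delta> by (auto simp: V_def)
  have lipv: "\<bar>v ((T ^^ i) y) - v ((T ^^ i) z)\<bar> \<le> L * dist y z" if "i < k" "y \<in> V \<inter> X" "z \<in> V \<inter> X" for i y z
  proof -
    have "\<bar>v ((T ^^ i) y) - v ((T ^^ i) z)\<bar> \<le> L1 * dist y z"
      using lipschitz_onD[OF W1(4)[OF that(1)], of y z] that(2,3) by (simp add: V_def dist_real_def)
    also have "\<dots> \<le> L * dist y z" using W2(3) by (simp add: L_def mult_right_mono)
    finally show ?thesis .
  qed
  have lipF: "norm (F ((T ^^ i) y) - F ((T ^^ i) z)) \<le> L * dist y z" if "i < k" "y \<in> V \<inter> X" "z \<in> V \<inter> X" for i y z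
  proof -
    have "norm (F ((T ^^ i) y) - F ((T ^^ i) z)) \<le> L2 * dist y z"
      using lipschitz_onD[OF W2(4)[OF that(1)], of y z] that(2,3) by (simp add: V_def dist_norm)
    also have "\<dots> \<le> L * dist y z" using W1(3) by (simp add: L_def mult_right_mono)
    finally show ?thesis .
  qed
  have near: "\<bar>w y i \<bullet> b l - (if i = l then 1 else 0)\<bar> \<le> 1 / (2 * real k)" if "y \<in> V \<inter> X" "i < k" "l < k" for y i l
  proof -
    have "w y i \<bullet> b l - (if i = l then 1 else 0) = (F ((T ^^ i) y0) - F ((T ^^ i) y)) \<bullet> b l"
      unfolding b[OF that(2,3), symmetric] by (simp add: w_def inner_diff_left)
    also have "\<bar>\<dots>\<bar> \<le> norm (F ((T ^^ i) y0) - F ((T ^^ i) y)) * norm (b l)" by (rule Cauchy_Schwarz_ineq2)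
    also have "\<dots> \<le> (L * dist y0 y) * \<beta>"
      using L V(2) y0(1) that by (intro mult_mono lipF \<beta>) auto
    also have "\<dots> \<le> ((L + 1) * \<delta>) * (\<beta> + 1)"
      using L \<beta>0 \<delta> that(1) by (intro mult_mono) (auto simp: V_def)
    also have "\<dots> = 1 / (2 * real k)" using L \<beta>0 k by (simp add: \<delta>_def divide_simps)
    finally show ?thesis .
  qed
  \<comment> \<open>\<open>16 * L\<close> is the 8 of the packing bound times the tolerance
    \<open>2 * L * r j\<close>, with \<open>r j\<close> split off.\<close>
  define c where "c = measure lborel (cball (0::'e) (1 + k * \<beta>)) * (16 * L) ^ k"
  have c: "c \<ge> 0" using L by (simp add: c_def)
  let ?N = "{\<alpha>\<in>cball 0 1. \<exists>y\<in>K \<inter> V. \<forall>i<k. v ((T ^^ i) x) + \<alpha> \<bullet> F ((T ^^ i) x) = v ((T ^^ i) y) + \<alpha> \<bullet> F ((T ^^ i) y)}"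
  have "\<exists>N'\<in>null_sets lborel. ?N \<subseteq> N'"
  proof (rule null_set_by_approximation)
    fix \<epsilon> :: real assume "\<epsilon> > 0"
    \<comment> \<open>Dividing by \<open>c + 1\<close> makes the total at most
      \<open>\<epsilon>\<close> even for \<open>c = 0\<close>.\<close>
    then have "\<epsilon> / (c + 1) > 0" using c by simp
    then obtain C r where C: "K \<subseteq> (\<Union>j::nat. C j)" "\<And>j. 0 \<le> r j"
        "\<And>j y z. y \<in> C j \<Longrightarrow> z \<in> C j \<Longrightarrow> dist y z \<le> r j" "(\<Sum>j. ennreal (r j ^ k)) \<le> ennreal (\<epsilon> / (c + 1))"
      using K(2) unfolding null_cover_def by metis
    \<comment> \<open>A base point in each piece that meets \<open>K\<close> inside
      \<open>V\<close>; the other pieces get \<open>S j = {}\<close>, where the arbitrary choice is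
      never consulted.\<close>
    define y where "y j = (SOME y. y \<in> C j \<inter> K \<inter> V)" for j
    define E where "E j = {\<alpha>\<in>cball 0 1. \<forall>i<k. \<bar>(v ((T ^^ i) x) - v ((T ^^ i) (y j))) + w (y j) i \<bullet> \<alpha>\<bar> \<le> 2 * L * r j}" for j
    define S where "S j = (if C j \<inter> K \<inter> V = {} then {} else E j)" for j
    have "closed {\<alpha>. \<forall>i<k. \<bar>(v ((T ^^ i) x) - v ((T ^^ i) (y j))) + w (y j) i \<bullet> \<alpha>\<bar> \<le> 2 * L * r j}" for j
      by (intro closed_Collect_all closed_Collect_imp closed_Collect_le continuous_intros) auto
    then have "closed (E j)" for j
      unfolding E_def Collect_conj_eq Collect_mem_eq by (intro closed_Int closed_cball)
    then have S: "S j \<in> sets lborel" for j by (simp add: S_def borel_closed)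
    have "emeasure lborel (S j) \<le> ennreal c * ennreal (r j ^ k)" for j
    proof (cases "C j \<inter> K \<inter> V = {}")
      case True then show ?thesis by (simp add: S_def)
    next
      case False
      then have yj: "y j \<in> C j \<inter> K \<inter> V" unfolding y_def some_in_eq .
      have "emeasure lborel (E j) \<le> ennreal (measure lborel (cball (0::'e) (1 + k * \<beta>)) * (8 * (2 * L * r j)) ^ k)"
        unfolding E_def
      proof (rule packing_bound[OF k _ \<beta> \<beta>0])
        show "\<bar>w (y j) i \<bullet> b l - (if i = l then 1 else 0)\<bar> \<le> 1 / (2 * real k)" if "i < k" "l < k" for i l
          using yj K(1) that by (intro near) auto
        show "0 \<le> 2 * L * r j" using L C(2) by simp
      qed
      also have "8 * (2 * L * r j) = 16 * L * r j" by simp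
      also have "measure lborel (cball (0::'e) (1 + k * \<beta>)) * (16 * L * r j) ^ k = c * r j ^ k"
        by (simp only: c_def power_mult_distrib mult.assoc)
      also have "ennreal (c * r j ^ k) = ennreal c * ennreal (r j ^ k)"
        using c C(2) by (simp add: ennreal_mult)
      finally show ?thesis using False by (simp add: S_def)
    qed
    then have "emeasure lborel (\<Union>j. S j) \<le> (\<Sum>j. ennreal c * ennreal (r j ^ k))"
      using S by (intro order_trans[OF emeasure_subadditive_countably] suminf_le) auto
    also have "\<dots> = ennreal c * (\<Sum>j. ennreal (r j ^ k))" by (rule ennreal_suminf_cmult)
    also have "\<dots> \<le> ennreal c * ennreal (\<epsilon> / (c + 1))" using C(4) by (intro mult_left_mono) auto
    also have "\<dots> = ennreal (c * (\<epsilon> / (c + 1)))"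
      using c \<open>\<epsilon> > 0\<close> by (intro ennreal_mult[symmetric]) auto
    also have "\<dots> \<le> ennreal \<epsilon>" using c \<open>\<epsilon> > 0\<close> by (intro ennreal_leI) (simp add: field_simps)
    finally have "emeasure lborel (\<Union>j. S j) \<le> ennreal \<epsilon>" .
    moreover have "?N \<subseteq> (\<Union>j. S j)"
    proof
      fix \<alpha> assume "\<alpha> \<in> ?N"
      then obtain z where z: "norm \<alpha> \<le> 1" "z \<in> K" "z \<in> V"
        "\<And>i. i < k \<Longrightarrow> v ((T ^^ i) x) + \<alpha> \<bullet> F ((T ^^ i) x) = v ((T ^^ i) z) + \<alpha> \<bullet> F ((T ^^ i) z)" by auto
      then obtain j where j: "z \<in> C j" using C(1) by blast
      then have ne: "C j \<inter> K \<inter> V \<noteq> {}" using z by blast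
      then have yj: "y j \<in> C j \<inter> K \<inter> V" unfolding y_def some_in_eq .
      have "\<bar>(v ((T ^^ i) x) - v ((T ^^ i) (y j))) + w (y j) i \<bullet> \<alpha>\<bar> \<le> 2 * L * r j" if i: "i < k" for i
      proof -
        have zy: "z \<in> V \<inter> X" "y j \<in> V \<inter> X" "dist z (y j) \<le> r j"
          using z yj K(1) C(3)[OF j, of "y j"] by auto
        \<comment> \<open>Agreement of the observations at \<open>x\<close> and \<open>z\<close>
          removes \<open>x\<close> from the expression and leaves increments between two points of
          \<open>V\<close>.\<close>
        have "(v ((T ^^ i) x) - v ((T ^^ i) (y j))) + w (y j) i \<bullet> \<alpha> =
            (v ((T ^^ i) z) - v ((T ^^ i) (y j))) + (F ((T ^^ i) z) - F ((T ^^ i) (y j))) \<bullet> \<alpha>"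
          using z(4)[OF i] by (simp add: w_def inner_diff_left inner_commute[of \<alpha>])
        also have "\<bar>\<dots>\<bar> \<le> L * dist z (y j) + L * dist z (y j) * 1"
        proof (rule order_trans[OF abs_triangle_ineq], rule add_mono)
          show "\<bar>v ((T ^^ i) z) - v ((T ^^ i) (y j))\<bar> \<le> L * dist z (y j)" using i zy by (intro lipv)
          have "\<bar>(F ((T ^^ i) z) - F ((T ^^ i) (y j))) \<bullet> \<alpha>\<bar> \<le> norm (F ((T ^^ i) z) - F ((T ^^ i) (y j))) * norm \<alpha>"
            by (rule Cauchy_Schwarz_ineq2)
          also have "\<dots> \<le> L * dist z (y j) * 1" using i zy L z(1) by (intro mult_mono lipF) auto
          finally show "\<bar>(F ((T ^^ i) z) - F ((T ^^ i) (y j))) \<bullet> \<alpha>\<bar> \<le> L * dist z (y j) * 1" .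
        qed
        also have "\<dots> = 2 * L * dist z (y j)" by simp
        also have "\<dots> \<le> 2 * L * r j" using zy(3) L by (intro mult_left_mono) auto
        finally show ?thesis .
      qed
      then have "\<alpha> \<in> S j" using ne z(1) by (simp add: S_def E_def)
      then show "\<alpha> \<in> (\<Union>j. S j)" by blast
    qed
    moreover have "(\<Union>j. S j) \<in> sets lborel" using S by blast
    ultimately show "\<exists>S\<in>sets lborel. ?N \<subseteq> S \<and> emeasure lborel S \<le> ennreal \<epsilon>" by blast
  qed
  then show ?thesis using V by blast
qed

text \<open>The partners \<open>y\<close> with a dual family need not form a compact set, so the
  local exceptional sets are combined through a countable subcover given by Lindelof.\<close>

lemma null_parameters:
  fixes F :: "'a::{metric_space,second_countable_topology} \<Rightarrow> 'e::euclidean_space" and v :: "'a \<Rightarrow> real"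
  assumes v: "locally_lipschitz_on X v" and F: "locally_lipschitz_on X F"
    and T: "locally_lipschitz_on X T" "T \<in> X \<rightarrow> X"
    and K: "K \<subseteq> X" "null_cover k K" and k: "k \<ge> 1"
  shows "AE \<alpha> in lborel. norm \<alpha> \<le> 1 \<longrightarrow> \<not> (\<exists>y\<in>K. dual_pair F T k x y \<and>
    (\<forall>i<k. v ((T ^^ i) x) + \<alpha> \<bullet> F ((T ^^ i) x) = v ((T ^^ i) y) + \<alpha> \<bullet> F ((T ^^ i) y)))"
proof -
  let ?eq = "\<lambda>\<alpha> y. \<forall>i<k. v ((T ^^ i) x) + \<alpha> \<bullet> F ((T ^^ i) x) = v ((T ^^ i) y) + \<alpha> \<bullet> F ((T ^^ i) y)"
  let ?Y = "{y\<in>K. dual_pair F T k x y}"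
  have "\<forall>y\<in>?Y. \<exists>V N. open V \<and> y \<in> V \<and> N \<in> null_sets lborel \<and> {\<alpha>\<in>cball 0 1. \<exists>y\<in>K \<inter> V. ?eq \<alpha> y} \<subseteq> N"
  proof
    fix y assume "y \<in> ?Y"
    then have "y \<in> X" "dual_pair F T k x y" using K(1) by auto
    then show "\<exists>V N. open V \<and> y \<in> V \<and> N \<in> null_sets lborel \<and> {\<alpha>\<in>cball 0 1. \<exists>y\<in>K \<inter> V. ?eq \<alpha> y} \<subseteq> N"
      by (rule null_parameters_local[OF v F T K k])
  qed
  from bchoice[OF this] obtain V where V: "\<forall>y\<in>?Y. \<exists>N. open (V y) \<and> y \<in> V y \<and> N \<in> null_sets lborel \<and>
      {\<alpha>\<in>cball 0 1. \<exists>z\<in>K \<inter> V y. ?eq \<alpha> z} \<subseteq> N" ..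
  from bchoice[OF V] obtain N where N: "\<forall>y\<in>?Y. open (V y) \<and> y \<in> V y \<and> N y \<in> null_sets lborel \<and>
      {\<alpha>\<in>cball 0 1. \<exists>z\<in>K \<inter> V y. ?eq \<alpha> z} \<subseteq> N y" ..
  note VN = N[THEN bspec, THEN conjunct1] N[THEN bspec, THEN conjunct2, THEN conjunct1]
    N[THEN bspec, THEN conjunct2, THEN conjunct2, THEN conjunct1]
    N[THEN bspec, THEN conjunct2, THEN conjunct2, THEN conjunct2]
  have V_open: "open S" if "S \<in> V ` ?Y" for S using that VN(1) by (elim imageE) simp
  obtain \<V> where \<V>: "\<V> \<subseteq> V ` ?Y" "countable \<V>" "\<Union>\<V> = \<Union>(V ` ?Y)"
    by (rule Lindelof[of "V ` ?Y", OF V_open], assumption, rule that)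
  from iffD1[OF countable_subset_image, OF conjI[OF \<V>(2,1)]]
  obtain Z where Z: "Z \<subseteq> ?Y" "countable Z" "\<V> = V ` Z" by (elim exE conjE) (rule that)
  have N: "(\<Union>z\<in>Z. N z) \<in> null_sets lborel"
    using Z(2) by (rule null_sets_UN') (rule VN(3)[OF subsetD[OF Z(1)]])
  have "\<alpha> \<in> (\<Union>z\<in>Z. N z)" if "norm \<alpha> \<le> 1" "y \<in> K" "dual_pair F T k x y" "?eq \<alpha> y" for \<alpha> y
  proof -
    have y: "y \<in> ?Y" using that(2,3) by simp
    have "y \<in> \<Union>\<V>" unfolding \<V>(3) by (rule UN_I) (rule y, rule VN(2)[OF y])
    then obtain z where z: "z \<in> Z" "y \<in> V z" unfolding Z(3) by auto
    have "z \<in> ?Y" using Z(1) z(1) by (rule subsetD)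
    moreover have "\<alpha> \<in> {\<alpha>\<in>cball 0 1. \<exists>y\<in>K \<inter> V z. ?eq \<alpha> y}"
      using that(1,2,4) z(2) by (intro CollectI conjI bexI[of _ y]) simp_all
    ultimately have "\<alpha> \<in> N z" by (rule subsetD[OF VN(4)])
    with z(1) show ?thesis by (rule UN_I)
  qed
  note N_covers = this
  show ?thesis
  proof (rule AE_I'[OF N], rule subsetI)
    fix \<alpha> assume "\<alpha> \<in> {\<alpha> \<in> space lborel. \<not> (norm \<alpha> \<le> 1 \<longrightarrow> \<not> (\<exists>y\<in>K. dual_pair F T k x y \<and> ?eq \<alpha> y))}"
    then obtain y where "norm \<alpha> \<le> 1" "y \<in> K" "dual_pair F T k x y" "?eq \<alpha> y" by blast
    then show "\<alpha> \<in> (\<Union>z\<in>Z. N z)" by (rule N_covers)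
  qed
qed

section \<open>Points with a coinciding partner: null sets and openness\<close>

text \<open>A point is bad as soon as a single partner exists. \<open>Q\<close> restricts the
  admissible pairs so that, for compact \<open>Q\<close> and continuous observations, this
  projection is compact.\<close>

definition coincidence_set :: "('a \<times> 'a) set \<Rightarrow> ('a \<Rightarrow> 'a) \<Rightarrow> nat \<Rightarrow> ('a \<Rightarrow> real) \<Rightarrow> 'a set" where
  "coincidence_set Q T k h = {x. \<exists>y. (x, y) \<in> Q \<and> (\<forall>i<k. h ((T ^^ i) x) = h ((T ^^ i) y))}"

text \<open>Each fixed \<open>x\<close> is bad for almost no \<open>\<alpha>\<close>; Fubini
  reverses the order of the two quantifiers once the set of bad pairs of \<open>x\<close> and
  \<open>\<alpha>\<close> is known to be Borel.\<close>

lemma coincidence_set_null: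
  fixes F :: "'a::euclidean_space \<Rightarrow> 'e::euclidean_space" and v :: "'a \<Rightarrow> real"
  assumes M: "finite_measure M" "sets M = sets borel"
    and v: "locally_lipschitz_on X v" and F: "locally_lipschitz_on X F"
    and T: "locally_lipschitz_on X T" "T \<in> X \<rightarrow> X" and k: "k \<ge> 1"
    and Q: "compact Q" "Q \<subseteq> X \<times> X" "\<And>x y. (x, y) \<in> Q \<Longrightarrow> dual_pair F T k x y" "null_cover k (snd ` Q)"
  shows "AE \<alpha> in lborel. norm \<alpha> \<le> 1 \<longrightarrow> emeasure M (coincidence_set Q T k (\<lambda>x. v x + \<alpha> \<bullet> F x)) = 0"
proof -
  interpret M: finite_measure M by (rule M(1))
  interpret pair_sigma_finite M "lborel :: 'e measure" ..
  let ?eq = "\<lambda>x y \<alpha>. \<forall>i<k. v ((T ^^ i) x) + \<alpha> \<bullet> F ((T ^^ i) x) = v ((T ^^ i) y) + \<alpha> \<bullet> F ((T ^^ i) y)"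
  let ?P = "\<lambda>x \<alpha>. norm \<alpha> \<le> 1 \<longrightarrow> \<not> (\<exists>y. (x, y) \<in> Q \<and> ?eq x y \<alpha>)"
  have Ti: "locally_lipschitz_on X (T ^^ i)" "(T ^^ i) \<in> X \<rightarrow> X" for i
    using locally_lipschitz_on_funpow[OF T] funpow_in[OF T(2)] by auto
  have cont: "continuous_on X (\<lambda>x. v ((T ^^ i) x))" "continuous_on X (\<lambda>x. F ((T ^^ i) x))" for i
    by (rule locally_lipschitz_on_imp_continuous_on[OF locally_lipschitz_on_compose[OF Ti(1) v Ti(2)]],
        rule locally_lipschitz_on_imp_continuous_on[OF locally_lipschitz_on_compose[OF Ti(1) F Ti(2)]])
  \<comment> \<open>Triples of \<open>x\<close>, \<open>y\<close> and \<open>\<alpha>\<close> with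
    coinciding observations. The set is compact, so projecting \<open>y\<close> away leaves a
    compact, hence Borel, set of bad pairs.\<close>
  define R where "R = {z \<in> Q \<times> cball (0::'e) 1. \<forall>i\<in>{..<k}.
      (v ((T ^^ i) (fst (fst z))) + snd z \<bullet> F ((T ^^ i) (fst (fst z)))) -
      (v ((T ^^ i) (snd (fst z))) + snd z \<bullet> F ((T ^^ i) (snd (fst z)))) = 0}"
  have "compact R"
    unfolding R_def
  proof (rule compact_solution_set)
    show "compact (Q \<times> cball (0::'e) 1)" using Q(1) by (intro compact_Times) auto
    fix i
    have 1: "continuous_on (Q \<times> cball (0::'e) 1) (\<lambda>z. g (fst (fst z)))"
      "continuous_on (Q \<times> cball (0::'e) 1) (\<lambda>z. g (snd (fst z)))"
      if "continuous_on X g" for g :: "'a \<Rightarrow> 'c::topological_space"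
      by (rule continuous_on_compose2[OF that]; use Q(2) in \<open>force intro!: continuous_intros\<close>)+
    show "continuous_on (Q \<times> cball 0 1) (\<lambda>z. (v ((T ^^ i) (fst (fst z))) + snd z \<bullet> F ((T ^^ i) (fst (fst z)))) -
        (v ((T ^^ i) (snd (fst z))) + snd z \<bullet> F ((T ^^ i) (snd (fst z)))))"
      by (intro continuous_on_diff continuous_on_add continuous_on_inner 1 cont continuous_intros)
  qed
  then have "compact ((\<lambda>z. (fst (fst z), snd z)) ` R)"
    by (intro compact_continuous_image continuous_intros)
  moreover have "(\<lambda>z. (fst (fst z), snd z)) ` R = {z. \<not> ?P (fst z) (snd z)}"
  proof (intro set_eqI iffI)
    fix z assume "z \<in> {z. \<not> ?P (fst z) (snd z)}"
    then obtain y where "norm (snd z) \<le> 1" "(fst z, y) \<in> Q" "?eq (fst z) y (snd z)" by auto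
    then show "z \<in> (\<lambda>z. (fst (fst z), snd z)) ` R"
      by (intro image_eqI[of _ _ "((fst z, y), snd z)"]) (auto simp: R_def)
  qed (auto simp: R_def)
  ultimately have "{z. \<not> ?P (fst z) (snd z)} \<in> sets borel" by (simp add: borel_compact)
  from sets.compl_sets[OF this]
  have "UNIV - {z. \<not> ?P (fst z) (snd z)} \<in> sets (borel :: ('a \<times> 'e) measure)"
    by (simp only: space_borel)
  moreover have "UNIV - {z. \<not> ?P (fst z) (snd z)} = {z \<in> space (M \<Otimes>\<^sub>M lborel). ?P (fst z) (snd z)}"
    using sets_eq_imp_space_eq[OF M(2)] by (auto simp: space_pair_measure)
  moreover have "sets (M \<Otimes>\<^sub>M lborel) = sets (borel :: ('a \<times> 'e) measure)"
    unfolding borel_prod[symmetric] by (rule sets_pair_measure_cong) (use M(2) in auto)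
  ultimately have meas: "{z \<in> space (M \<Otimes>\<^sub>M lborel). ?P (fst z) (snd z)} \<in> sets (M \<Otimes>\<^sub>M lborel)" by simp
  have "AE \<alpha> in lborel. ?P x \<alpha>" for x
  proof -
    have "snd ` Q \<subseteq> X" using Q(2) by auto
    from null_parameters[OF v F T this Q(4) k, of x] show ?thesis
      by eventually_elim (use Q(3) in force)
  qed
  then have "AE x in M. AE \<alpha> in lborel. ?P x \<alpha>" by simp
  then have "AE \<alpha> in lborel. AE x in M. ?P x \<alpha>" unfolding AE_commute[OF meas] .
  then show ?thesis
  proof eventually_elim
    fix \<alpha> assume \<alpha>: "AE x in M. ?P x \<alpha>"
    show "norm \<alpha> \<le> 1 \<longrightarrow> emeasure M (coincidence_set Q T k (\<lambda>x. v x + \<alpha> \<bullet> F x)) = 0"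
    proof
      assume "norm \<alpha> \<le> 1"
      then have "AE x in M. x \<notin> coincidence_set Q T k (\<lambda>x. v x + \<alpha> \<bullet> F x)"
        using \<alpha> by (auto simp: coincidence_set_def)
      from emeasure_eq_0_AE[OF this]
      show "emeasure M (coincidence_set Q T k (\<lambda>x. v x + \<alpha> \<bullet> F x)) = 0"
        using sets_eq_imp_space_eq[OF M(2)] by simp
    qed
  qed
qed

text \<open>Having a dual family is not a closed condition, as dual vectors may escape to infinity;
  a bound \<open>p\<close> on their norms makes it one. For each \<open>l\<close> separately the
  vector \<open>b\<close> is projected out of a compact set, and these projections are
  intersected.\<close>

lemma compact_dual_pairs:
  fixes F :: "'a::euclidean_space \<Rightarrow> 'e::euclidean_space"
  assumes F: "continuous_on X F" and T: "\<And>i. continuous_on X (T ^^ i)" "T \<in> X \<rightarrow> X"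
    and K: "compact K" "K \<subseteq> X" and K': "compact K'" "K' \<subseteq> X" and k: "k \<ge> 1"
  shows "compact {(x, y) \<in> K \<times> K'. \<forall>l<k. \<exists>b\<in>cball 0 p. \<forall>i<k.
    (F ((T ^^ i) x) - F ((T ^^ i) y)) \<bullet> b = (if i = l then 1 else 0)}"
proof -
  let ?C = "(K \<times> K') \<times> cball (0::'e) p"
  let ?g = "\<lambda>i z. (F ((T ^^ i) (fst (fst z))) - F ((T ^^ i) (snd (fst z)))) \<bullet> snd z"
  define S where "S l = fst ` {z \<in> ?C. \<forall>i\<in>{..<k}. ?g i z = (if i = l then 1 else 0)}" for l
  have FT: "continuous_on X (\<lambda>x. F ((T ^^ i) x))" for i
    by (rule continuous_on_compose2[OF F T(1)]) (use funpow_in[OF T(2)] in auto)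
  have "compact (S l)" for l
    unfolding S_def
  proof (rule compact_continuous_image[OF continuous_on_fst[OF continuous_on_id]], rule compact_solution_set)
    show "compact ?C" using K(1) K'(1) by (intro compact_Times) auto
    fix i
    have 1: "continuous_on ?C (\<lambda>z. F ((T ^^ i) (fst (fst z))))"
      by (rule continuous_on_compose2[OF FT]) (use K(2) in \<open>auto intro!: continuous_intros\<close>)
    have 2: "continuous_on ?C (\<lambda>z. F ((T ^^ i) (snd (fst z))))"
      by (rule continuous_on_compose2[OF FT]) (use K'(2) in \<open>auto intro!: continuous_intros\<close>)
    show "continuous_on ?C (?g i)"
      by (intro continuous_on_inner continuous_on_diff 1 2 continuous_on_snd continuous_on_id)
  qed
  then have "compact (\<Inter>l\<in>{..<k}. S l)"
    using k by (intro compact_Inter) (auto simp: lessThan_empty_iff)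
  moreover have "(\<Inter>l\<in>{..<k}. S l) = {(x, y) \<in> K \<times> K'. \<forall>l<k. \<exists>b\<in>cball 0 p. \<forall>i<k.
    (F ((T ^^ i) x) - F ((T ^^ i) y)) \<bullet> b = (if i = l then 1 else 0)}" (is "_ = ?R")
  proof (intro set_eqI iffI)
    fix z assume z: "z \<in> (\<Inter>l\<in>{..<k}. S l)"
    obtain x y where xy: "z = (x, y)" by (cases z)
    have "(x, y) \<in> S 0" using z k xy by auto
    then have "x \<in> K" "y \<in> K'" by (auto simp: S_def)
    moreover have "\<exists>b\<in>cball 0 p. \<forall>i<k. (F ((T ^^ i) x) - F ((T ^^ i) y)) \<bullet> b = (if i = l then 1 else 0)" if "l < k" for l
    proof -
      have "(x, y) \<in> S l" using z that xy by blast
      then obtain u where "u \<in> ?C" "\<forall>i\<in>{..<k}. ?g i u = (if i = l then 1 else 0)" "fst u = (x, y)"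
        unfolding S_def by (elim imageE CollectE conjE) simp
      then show ?thesis by (intro bexI[of _ "snd u"]) auto
    qed
    ultimately show "z \<in> ?R" using xy by simp
  next
    fix z assume z: "z \<in> ?R"
    obtain x y where xy: "z = (x, y)" by (cases z)
    show "z \<in> (\<Inter>l\<in>{..<k}. S l)"
    proof
      fix l assume "l \<in> {..<k}"
      then obtain b where "b \<in> cball 0 p" "\<forall>i<k. (F ((T ^^ i) x) - F ((T ^^ i) y)) \<bullet> b = (if i = l then 1 else 0)"
        using z xy by auto
      then show "z \<in> S l" unfolding S_def
        by (intro image_eqI[of _ _ "((x, y), b)"]) (use z xy in auto)
    qed
  qed
  ultimately show ?thesis by simp
qed

text \<open>Upper semicontinuity of the measure of a coincidence set: the compact sets of points
  with a partner up to tolerance \<open>1 / Suc n\<close> decrease to the exact coincidence set, and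
  continuity from above applies.\<close>

lemma coincidence_set_compact_nbhd:
  fixes h :: "'a::euclidean_space \<Rightarrow> real"
  assumes M: "finite_measure M" "sets M = sets borel"
    and hT: "\<And>i. continuous_on X (\<lambda>x. h ((T ^^ i) x))"
    and Q: "compact Q" "Q \<subseteq> X \<times> X"
    and less: "emeasure M (coincidence_set Q T k h) < c"
  shows "\<exists>\<epsilon>>0. \<exists>B\<in>sets M. emeasure M B < c \<and>
    (\<forall>x y. (x, y) \<in> Q \<longrightarrow> (\<forall>i<k. \<bar>h ((T ^^ i) x) - h ((T ^^ i) y)\<bar> \<le> \<epsilon>) \<longrightarrow> x \<in> B)"
proof -
  interpret finite_measure M by (rule M(1))
  let ?g = "\<lambda>i z. \<bar>h ((T ^^ i) (fst z)) - h ((T ^^ i) (snd z))\<bar>"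
  define R where "R n = {z\<in>Q. \<forall>i\<in>{..<k}. ?g i z \<le> 1 / real (Suc n)}" for n
  have g: "continuous_on Q (?g i)" for i
  proof -
    have 1: "continuous_on Q (\<lambda>z. h ((T ^^ i) (fst z)))"
      by (rule continuous_on_compose2[OF hT]) (use Q(2) in \<open>auto intro!: continuous_intros\<close>)
    have 2: "continuous_on Q (\<lambda>z. h ((T ^^ i) (snd z)))"
      by (rule continuous_on_compose2[OF hT]) (use Q(2) in \<open>auto intro!: continuous_intros\<close>)
    show ?thesis by (intro continuous_on_rabs continuous_on_diff 1 2)
  qed
  have R: "compact (R n)" for n
    unfolding R_def using Q(1) g by (rule compact_sublevel)
  have R_mono: "R n \<subseteq> R m" if "m \<le> n" for m n
  proof -
    have "1 / real (Suc n) \<le> 1 / real (Suc m)" using that by (simp add: frac_le)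
    then show ?thesis unfolding R_def by (blast intro: order_trans)
  qed
  define B where "B n = fst ` R n" for n
  have "compact (B n)" for n
    unfolding B_def by (intro compact_continuous_image R continuous_intros)
  then have B: "B n \<in> sets M" for n using M(2) by (simp add: borel_compact)
  have "(\<Inter>n. B n) \<subseteq> coincidence_set Q T k h"
  proof
    fix x assume x: "x \<in> (\<Inter>n. B n)"
    \<comment> \<open>The partners of \<open>x\<close> at tolerance \<open>1 / Suc n\<close> form
      nested nonempty compact sets, so one partner is good for every tolerance.\<close>
    define P where "P n = R n \<inter> {z. fst z = x}" for n
    have "closed {z :: 'a \<times> 'a. fst z = x}" by (intro closed_Collect_eq continuous_intros)
    then have "compact (P n)" for n unfolding P_def using R by (intro compact_Int_closed)
    moreover have "P n \<noteq> {}" for n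
    proof -
      have "x \<in> B n" using x by blast
      then show ?thesis by (auto simp: B_def P_def)
    qed
    moreover have "P n \<subseteq> P m" if "m \<le> n" for m n using R_mono[OF that] by (auto simp: P_def)
    ultimately have "\<Inter>(range P) \<noteq> {}" by (rule compact_nest)
    then obtain z where z: "\<And>n. z \<in> R n" "fst z = x" by (auto simp: P_def)
    have "?g i z = 0" if "i < k" for i
    proof (rule ccontr)
      assume "?g i z \<noteq> 0"
      then have "?g i z > 0" by simp
      then obtain n where "1 / real (Suc n) < ?g i z" using nat_approx_posE by blast
      moreover have "?g i z \<le> 1 / real (Suc n)" using z(1)[of n] that unfolding R_def by blast
      ultimately show False by linarith
    qed
    then show "x \<in> coincidence_set Q T k h"
      using z(1)[of 0] z(2) unfolding coincidence_set_def R_def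
      by (intro CollectI exI[of _ "snd z"]) auto
  qed
  moreover have "coincidence_set Q T k h \<subseteq> (\<Inter>n. B n)"
  proof (intro subsetI INT_I)
    fix x n assume "x \<in> coincidence_set Q T k h"
    then obtain y where "(x, y) \<in> Q" "\<forall>i<k. h ((T ^^ i) x) = h ((T ^^ i) y)"
      unfolding coincidence_set_def by blast
    then show "x \<in> B n" unfolding B_def R_def by (intro image_eqI[of _ _ "(x, y)"]) auto
  qed
  ultimately have eq: "(\<Inter>n. B n) = coincidence_set Q T k h" by blast
  have "(\<lambda>n. emeasure M (B n)) \<longlonglongrightarrow> emeasure M (\<Inter>n. B n)"
  proof (rule Lim_emeasure_decseq)
    show "range B \<subseteq> sets M" using B by blast
    show "decseq B" unfolding decseq_def B_def using R_mono by (blast intro: image_mono)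
    show "emeasure M (B n) \<noteq> \<infinity>" for n by simp
  qed
  then have "\<forall>\<^sub>F n in sequentially. emeasure M (B n) < c"
    unfolding eq using less by (rule order_tendstoD(2))
  then obtain n where n: "emeasure M (B n) < c" by (auto simp: eventually_sequentially)
  have "x \<in> B n" if "(x, y) \<in> Q" "\<forall>i<k. \<bar>h ((T ^^ i) x) - h ((T ^^ i) y)\<bar> \<le> 1 / real (Suc n)" for x y
    unfolding B_def by (rule image_eqI[of _ _ "(x, y)"]) (use that in \<open>auto simp: R_def\<close>)
  moreover have "0 < 1 / real (Suc n)" by simp
  ultimately show ?thesis using n B[of n] by blast
qed

text \<open>Only finitely many iterates of a compact set of points are observed, and there a nearby
  \<open>f\<close> differs from \<open>h\<close> by less than \<open>\<epsilon> / 2\<close>; an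
  exact coincidence for \<open>f\<close> is then one up to \<open>\<epsilon>\<close> for
  \<open>h\<close>.\<close>

lemma (in lip_space_cart) openin_coincidence_less:
  assumes M: "finite_measure M" "sets M = sets borel"
    and T: "\<And>i. continuous_on X (T ^^ i)" "T \<in> X \<rightarrow> X"
    and Q: "compact Q" "Q \<subseteq> X \<times> X"
  shows "openin mtopology {h \<in> lip_loc X. emeasure M (coincidence_set Q T k h) < c}"
  unfolding openin_mtopology
proof (intro conjI allI impI)
  fix h assume "h \<in> {h \<in> lip_loc X. emeasure M (coincidence_set Q T k h) < c}"
  then have h: "h \<in> lip_loc X" "emeasure M (coincidence_set Q T k h) < c" by auto
  have "continuous_on X h"
    using h(1) by (auto simp: lip_loc_def intro: locally_lipschitz_on_imp_continuous_on)
  then have "continuous_on X (\<lambda>x. h ((T ^^ i) x))" for i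
    by (rule continuous_on_compose2[OF _ T(1)]) (use funpow_in[OF T(2)] in auto)
  from coincidence_set_compact_nbhd[OF M this Q h(2)]
  obtain \<epsilon> B where \<epsilon>: "\<epsilon> > 0" and B: "B \<in> sets M" "emeasure M B < c"
    "\<And>x y. (x, y) \<in> Q \<Longrightarrow> (\<forall>i<k. \<bar>h ((T ^^ i) x) - h ((T ^^ i) y)\<bar> \<le> \<epsilon>) \<Longrightarrow> x \<in> B"
    by blast
  define K where "K = (\<Union>i\<in>{..<k}. (T ^^ i) ` (fst ` Q \<union> snd ` Q))"
  have QX: "fst ` Q \<union> snd ` Q \<subseteq> X" using Q(2) by auto
  have "compact (fst ` Q \<union> snd ` Q)"
    using Q(1) by (intro compact_Un compact_continuous_image continuous_intros)
  then have "compact K"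
    unfolding K_def using QX
    by (intro compact_UN compact_continuous_image continuous_on_subset[OF T(1)]) auto
  moreover have "K \<subseteq> X" using QX funpow_in[OF T(2)] by (auto simp: K_def)
  ultimately obtain \<eta> where \<eta>: "\<eta> > 0"
    "\<And>f f' x. lip_dist U X f f' < \<eta> \<Longrightarrow> x \<in> K \<Longrightarrow> \<bar>f x - f' x\<bar> < \<epsilon> / 2"
    using \<epsilon> by (auto elim: uniform_on_compact[of K "\<epsilon> / 2"])
  have "emeasure M (coincidence_set Q T k f) < c" if f: "lip_dist U X h f < \<eta>" for f
  proof -
    have "coincidence_set Q T k f \<subseteq> B"
    proof
      fix x assume "x \<in> coincidence_set Q T k f"
      then obtain y where y: "(x, y) \<in> Q" "\<And>i. i < k \<Longrightarrow> f ((T ^^ i) x) = f ((T ^^ i) y)"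
        by (auto simp: coincidence_set_def)
      have "\<bar>h ((T ^^ i) x) - h ((T ^^ i) y)\<bar> \<le> \<epsilon>" if i: "i < k" for i
      proof -
        have "(T ^^ i) x \<in> K" "(T ^^ i) y \<in> K"
          unfolding K_def using i y(1) by (force intro!: UN_I[of i])+
        then show ?thesis using \<eta>(2)[OF f] y(2)[OF i] by (smt (verit) field_sum_of_halves)
      qed
      then show "x \<in> B" using B(3)[OF y(1)] by blast
    qed
    then have "emeasure M (coincidence_set Q T k f) \<le> emeasure M B"
      using B(1) by (rule emeasure_mono)
    then show ?thesis using B(2) by (rule le_less_trans)
  qed
  then have "mball h \<eta> \<subseteq> {h \<in> lip_loc X. emeasure M (coincidence_set Q T k h) < c}" by auto
  then show "\<exists>r>0. mball h r \<subseteq> {h \<in> lip_loc X. emeasure M (coincidence_set Q T k h) < c}"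
    using \<eta>(1) by blast
qed auto

text \<open>Dual pairs over the union of the \<open>K n\<close> are exhausted by countably many
  compact sets \<open>Q m n p\<close>, with \<open>p\<close> bounding the dual vectors. Measure zero
  of a coincidence set amounts to the open conditions \<open>< 1 / Suc r\<close>, and the
  exceptional set \<open>N\<close> is the union of these coincidence sets.\<close>

lemma (in lip_space_cart) prevalent_no_dual_coincidences:
  fixes K :: "nat \<Rightarrow> (real ^ 'n) set"
  defines "F \<equiv> monomials :: real ^ 'n \<Rightarrow> real ^ ('j::finite \<Rightarrow> 'n option)"
  assumes M: "finite_measure M" "sets M = sets borel"
    and T: "locally_lipschitz_on X T" "T \<in> X \<rightarrow> X"
    and K: "\<And>n. compact (K n)" "\<And>n. K n \<subseteq> X" "\<And>n. null_cover k (K n)"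
    and k: "1 \<le> k"
  shows "\<exists>S. borel_prevalent U X S \<and> (\<forall>h\<in>S. \<exists>N\<in>null_sets M.
    \<forall>x\<in>(\<Union>n. K n) - N. \<forall>y\<in>(\<Union>n. K n). dual_pair F T k x y \<longrightarrow> (\<exists>i<k. h ((T ^^ i) x) \<noteq> h ((T ^^ i) y)))"
proof -
  interpret finite_measure M by (rule M(1))
  have F: "locally_lipschitz_on X F" unfolding F_def by (rule locally_lipschitz_on_monomials)
  have Tc: "continuous_on X (T ^^ i)" for i
    by (rule locally_lipschitz_on_imp_continuous_on[OF locally_lipschitz_on_funpow[OF T]])
  define Q where "Q m n p = {(x, y) \<in> K m \<times> K n. \<forall>l<k. \<exists>b\<in>cball 0 (real p). \<forall>i<k.
    (F ((T ^^ i) x) - F ((T ^^ i) y)) \<bullet> b = (if i = l then 1 else 0)}" for m n p :: nat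
  have Q: "compact (Q m n p)" for m n p
    unfolding Q_def
    by (rule compact_dual_pairs[OF locally_lipschitz_on_imp_continuous_on[OF F] Tc T(2) K(1,2) K(1,2) k])
  have QK: "Q m n p \<subseteq> K m \<times> K n" for m n p by (auto simp: Q_def)
  then have QX: "Q m n p \<subseteq> X \<times> X" for m n p using K(2) by blast
  have Q_dual: "dual_pair F T k x y" if "(x, y) \<in> Q m n p" for x y m n p
  proof -
    have "\<forall>l<k. \<exists>b\<in>cball 0 (real p). \<forall>i<k. (F ((T ^^ i) x) - F ((T ^^ i) y)) \<bullet> b = (if i = l then 1 else 0)"
      using that unfolding Q_def mem_Collect_eq prod.case by (rule conjunct2)
    then have "\<forall>l\<in>{..<k}. \<exists>b. \<forall>i<k. (F ((T ^^ i) x) - F ((T ^^ i) y)) \<bullet> b = (if i = l then 1 else 0)"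
      by blast
    from bchoice[OF this] obtain b where
      "\<forall>l\<in>{..<k}. \<forall>i<k. (F ((T ^^ i) x) - F ((T ^^ i) y)) \<bullet> b l = (if i = l then 1 else 0)" ..
    then have "\<forall>i<k. \<forall>l<k. (F ((T ^^ i) x) - F ((T ^^ i) y)) \<bullet> b l = (if i = l then 1 else 0)"
      by (intro allI impI) (elim ballE allE impE, assumption+, simp)
    then show ?thesis unfolding dual_pair_def by (intro exI[of _ b])
  qed
  have Q_cov: "\<exists>p. (x, y) \<in> Q m n p" if xy: "x \<in> K m" "y \<in> K n" "dual_pair F T k x y" for x y m n
  proof -
    obtain b where b: "\<And>i l. i < k \<Longrightarrow> l < k \<Longrightarrow> (F ((T ^^ i) x) - F ((T ^^ i) y)) \<bullet> b l = (if i = l then 1 else 0)"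
      using xy(3) unfolding dual_pair_def by blast
    obtain p :: nat where p: "(\<Sum>l<k. norm (b l)) \<le> p" using real_arch_simple by blast
    have "norm (b l) \<le> p" if "l < k" for l
      using p member_le_sum[of l "{..<k}" "\<lambda>l. norm (b l)"] that by auto
    then have "\<exists>c\<in>cball 0 (real p). \<forall>i<k. (F ((T ^^ i) x) - F ((T ^^ i) y)) \<bullet> c = (if i = l then 1 else 0)" if "l < k" for l
      using b that by (intro bexI[of _ "b l"]) auto
    then show ?thesis using xy(1,2) by (intro exI[of _ p]) (simp add: Q_def)
  qed
  define S where "S = (\<Inter>m n p r. {h \<in> lip_loc X. emeasure M (coincidence_set (Q m n p) T k h) < ennreal (1 / Suc r)})"
  have S_iff: "h \<in> S \<longleftrightarrow> h \<in> lip_loc X \<and> (\<forall>m n p. emeasure M (coincidence_set (Q m n p) T k h) = 0)" for h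
  proof -
    have "a = 0" if "\<And>r. a < ennreal (1 / Suc r)" for a
    proof (rule ccontr)
      assume "a \<noteq> 0"
      have "a < \<top>" using that[of 0] by (rule less_trans) simp
      then obtain t where t: "a = ennreal t" "t \<ge> 0" by (cases a) auto
      then have "t > 0" using \<open>a \<noteq> 0\<close> by (cases "t = 0") auto
      then obtain r where "1 / Suc r < t" using nat_approx_posE by blast
      then show False using that[of r] t by (simp add: ennreal_less_iff)
    qed
    then have "(\<forall>r. a < ennreal (1 / Suc r)) \<longleftrightarrow> a = 0" for a by auto
    then show ?thesis unfolding S_def by auto
  qed
  have "S \<in> sets (borel_of (lip_topology U X))"
    unfolding S_def
    by (intro sets.countable_INT image_subsetI openin_sets_borel_of
        openin_coincidence_less[OF M Tc T(2) Q QX, unfolded mtopology_eq]) auto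
  moreover have "AE \<alpha> :: real ^ ('j \<Rightarrow> 'n option) in lborel. norm \<alpha> \<le> 1 \<longrightarrow> (\<lambda>x\<in>X. v x + probe X \<alpha> x) \<in> S"
    if v: "v \<in> lip_loc X" for v
  proof -
    have lv: "locally_lipschitz_on X v" using v by (simp add: lip_loc_def)
    have "null_cover k (snd ` Q m n p)" for m n p
      using K(3)[of n] by (rule null_cover_subset) (use QK[of m n p] in auto)
    then have "AE \<alpha> in lborel. norm \<alpha> \<le> 1 \<longrightarrow> emeasure M (coincidence_set (Q m n p) T k (\<lambda>x. v x + \<alpha> \<bullet> F x)) = 0" for m n p
      by (intro coincidence_set_null[OF M lv F T k Q QX Q_dual])
    then have "AE \<alpha> in lborel. \<forall>m n p. norm \<alpha> \<le> 1 \<longrightarrow> emeasure M (coincidence_set (Q m n p) T k (\<lambda>x. v x + \<alpha> \<bullet> F x)) = 0"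
      unfolding AE_all_countable by (intro allI)
    then show ?thesis
    proof eventually_elim
      fix \<alpha> :: "real ^ ('j \<Rightarrow> 'n option)"
      assume \<alpha>: "\<forall>m n p. norm \<alpha> \<le> 1 \<longrightarrow> emeasure M (coincidence_set (Q m n p) T k (\<lambda>x. v x + \<alpha> \<bullet> F x)) = 0"
      \<comment> \<open>Restricting to \<open>X\<close> changes no value along the orbits, which
        stay in \<open>X\<close>.\<close>
      have "coincidence_set (Q m n p) T k (\<lambda>x\<in>X. v x + probe X \<alpha> x) = coincidence_set (Q m n p) T k (\<lambda>x. v x + \<alpha> \<bullet> F x)" for m n p
      proof -
        have "(\<lambda>x\<in>X. v x + probe X \<alpha> x) ((T ^^ i) x) = v ((T ^^ i) x) + \<alpha> \<bullet> F ((T ^^ i) x)" if "x \<in> X" for x i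
          using funpow_in[OF T(2) that] by (simp add: probe_def F_def)
        note h_eq = this
        show ?thesis
          unfolding coincidence_set_def
        proof (intro Collect_cong ex_cong1 conj_cong refl)
          fix x y assume "(x, y) \<in> Q m n p"
          then have "x \<in> X" "y \<in> X" using QX[of m n p] by auto
          then show "(\<forall>i<k. (\<lambda>x\<in>X. v x + probe X \<alpha> x) ((T ^^ i) x) = (\<lambda>x\<in>X. v x + probe X \<alpha> x) ((T ^^ i) y)) =
              (\<forall>i<k. v ((T ^^ i) x) + \<alpha> \<bullet> F ((T ^^ i) x) = v ((T ^^ i) y) + \<alpha> \<bullet> F ((T ^^ i) y))"
            by (simp only: h_eq)
        qed
      qed
      then show "norm \<alpha> \<le> 1 \<longrightarrow> (\<lambda>x\<in>X. v x + probe X \<alpha> x) \<in> S"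
        using \<alpha> v by (simp add: S_iff add_in_lip_loc probe_in_lip_loc)
    qed
  qed
  ultimately have "borel_prevalent U X S" by (rule borel_prevalentI)
  moreover have "\<exists>N\<in>null_sets M. \<forall>x\<in>(\<Union>n. K n) - N. \<forall>y\<in>(\<Union>n. K n).
      dual_pair F T k x y \<longrightarrow> (\<exists>i<k. h ((T ^^ i) x) \<noteq> h ((T ^^ i) y))" if h: "h \<in> S" for h
  proof -
    have hT: "continuous_on X (\<lambda>x. h ((T ^^ i) x))" for i
    proof -
      have "continuous_on X h"
        using h by (auto simp: S_iff lip_loc_def intro: locally_lipschitz_on_imp_continuous_on)
      then show ?thesis
        by (rule continuous_on_compose2[OF _ Tc]) (use funpow_in[OF T(2)] in auto)
    qed
    define N where "N = (\<Union>m n p. coincidence_set (Q m n p) T k h)"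
    have "coincidence_set (Q m n p) T k h \<in> sets M" for m n p
    proof -
      have 1: "continuous_on (Q m n p) (\<lambda>z. h ((T ^^ i) (fst z)) - h ((T ^^ i) (snd z)))" for i
        using QX[of m n p]
        by (intro continuous_on_diff continuous_on_compose2[OF hT] continuous_on_fst continuous_on_snd continuous_on_id) auto
      have "compact {z \<in> Q m n p. \<forall>i\<in>{..<k}. h ((T ^^ i) (fst z)) - h ((T ^^ i) (snd z)) = 0}"
        using Q 1 by (rule compact_solution_set)
      then have "compact (fst ` {z \<in> Q m n p. \<forall>i\<in>{..<k}. h ((T ^^ i) (fst z)) - h ((T ^^ i) (snd z)) = 0})"
        by (intro compact_continuous_image continuous_intros)
      also have "fst ` {z \<in> Q m n p. \<forall>i\<in>{..<k}. h ((T ^^ i) (fst z)) - h ((T ^^ i) (snd z)) = 0} = coincidence_set (Q m n p) T k h"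
        unfolding coincidence_set_def by force
      finally show ?thesis using M(2) by (simp add: borel_compact)
    qed
    then have "N \<in> null_sets M"
      unfolding N_def using h by (intro null_sets_UN null_setsI) (auto simp: S_iff)
    moreover have "\<exists>i<k. h ((T ^^ i) x) \<noteq> h ((T ^^ i) y)"
      if xy: "x \<in> (\<Union>n. K n) - N" "y \<in> (\<Union>n. K n)" "dual_pair F T k x y" for x y
    proof (rule ccontr)
      assume "\<not> (\<exists>i<k. h ((T ^^ i) x) \<noteq> h ((T ^^ i) y))"
      moreover obtain m n p where "(x, y) \<in> Q m n p" using xy Q_cov by blast
      ultimately have "x \<in> N" unfolding N_def coincidence_set_def by blast
      then show False using xy(1) by simp
    qed
    ultimately show ?thesis by blast
  qed
  ultimately show ?thesis by blast
qed

section \<open>Prediction\<close>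

definition determines_orbit :: "('a \<Rightarrow> 'a) \<Rightarrow> ('a \<Rightarrow> real) \<Rightarrow> nat \<Rightarrow> 'a set \<Rightarrow> 'a set \<Rightarrow> bool" where
  "determines_orbit T h k G A \<longleftrightarrow> (\<forall>x\<in>G. \<forall>y\<in>A. (\<forall>i<k. h ((T ^^ i) x) = h ((T ^^ i) y)) \<longrightarrow>
     (\<forall>n. h ((T ^^ n) x) = h ((T ^^ n) y)))"

lemma delay_map_eq_iff: "delay_map T h k x = delay_map T h k y \<longleftrightarrow> (\<forall>i<k. h ((T ^^ i) x) = h ((T ^^ i) y))"
  by (auto simp: delay_map_def fun_eq_iff)

lemma determines_orbit_delay_map:
  assumes "determines_orbit T h k G A" "k \<le> k'" "x \<in> G" "y \<in> A" "delay_map T h k' x = delay_map T h k' y"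
  shows "delay_map T h k' (T x) = delay_map T h k' (T y)"
proof -
  have "\<forall>i<k. h ((T ^^ i) x) = h ((T ^^ i) y)"
    using assms(2,5) unfolding delay_map_eq_iff by auto
  then have "h ((T ^^ Suc i) x) = h ((T ^^ Suc i) y)" for i
    using assms(1,3,4) unfolding determines_orbit_def by blast
  then show ?thesis unfolding delay_map_eq_iff by (simp add: funpow_Suc_right del: funpow.simps)
qed

text \<open>Determining the whole orbit for the least exponent \<open>k\<close> above the dimension settles all larger ones. The cut-off at
  \<open>N + 1\<close> bounds the number of interpolation points, hence the index type of the probe polynomials.\<close>

lemma least_admissible_exponent:
  assumes "\<And>k. k \<ge> 1 \<Longrightarrow> d < of_nat k \<Longrightarrow> P k" "P (Suc N)"
  shows "\<exists>k. 1 \<le> k \<and> k \<le> Suc N \<and> P k \<and> (\<forall>k'\<ge>1. d < (of_nat k' :: ennreal) \<longrightarrow> k \<le> k')"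
proof (cases "\<exists>k. 1 \<le> k \<and> k \<le> N \<and> d < of_nat k")
  case True
  define k where "k = (LEAST k. 1 \<le> k \<and> d < of_nat k)"
  obtain k0 where k0: "1 \<le> k0" "k0 \<le> N" "d < of_nat k0" using True by blast
  have "1 \<le> k \<and> d < of_nat k" unfolding k_def by (rule LeastI[of _ k0]) (use k0 in simp)
  moreover have "k \<le> k'" if "1 \<le> k'" "d < of_nat k'" for k'
    unfolding k_def by (rule Least_le) (use that in simp)
  moreover from this[OF k0(1,3)] have "k \<le> Suc N" using k0(2) by simp
  ultimately show ?thesis using assms(1) by blast
next
  case False
  then have "Suc N \<le> k'" if "1 \<le> k'" "d < of_nat k'" for k'
    using that by (meson not_less_eq_eq)
  then show ?thesis using assms(2) by (intro exI[of _ "Suc N"]) auto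
qed

text \<open>Inner regularity yields compact subsets of measure above
  \<open>1 - 1 / Suc n\<close>.\<close>

lemma full_measure_sigma_compact:
  fixes M :: "'a::{second_countable_topology, complete_space} measure"
  assumes "prob_space M" "sets M = sets borel" "A \<in> sets borel" "emeasure M A = 1"
  shows "\<exists>K::nat \<Rightarrow> 'a set. (\<forall>n. compact (K n) \<and> K n \<subseteq> A) \<and> emeasure M (\<Union>n. K n) = 1"
proof -
  interpret M: prob_space M by (rule assms(1))
  have sup: "(SUP K \<in> {K. K \<subseteq> A \<and> compact K}. emeasure M K) = 1"
    using inner_regular[OF assms(2) _ assms(3)] assms(4) by simp
  have "\<exists>K. K \<subseteq> A \<and> compact K \<and> y < emeasure M K" if "y < 1" for y
  proof -
    have "y < (SUP K \<in> {K. K \<subseteq> A \<and> compact K}. emeasure M K)" using that by (simp only: sup)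
    then show ?thesis unfolding less_SUP_iff by blast
  qed
  then have "\<exists>K. K \<subseteq> A \<and> compact K \<and> ennreal (1 - 1 / Suc n) < emeasure M K" for n
    by (simp add: ennreal_less_one_iff)
  then obtain K where K: "\<And>n. K n \<subseteq> A" "\<And>n. compact (K n)" "\<And>n. ennreal (1 - 1 / Suc n) < emeasure M (K n)"
    by metis
  have "(\<Union>n. K n) \<in> sets M" using K(2) assms(2) by (auto intro: borel_compact)
  have "1 - 1 / Suc n \<le> M.prob (\<Union>n. K n)" for n
  proof -
    have "ennreal (1 - 1 / Suc n) \<le> emeasure M (\<Union>n. K n)"
      using K(3)[of n] \<open>(\<Union>n. K n) \<in> sets M\<close> by (intro order_trans[OF less_imp_le emeasure_mono]) auto
    then show ?thesis by (simp add: M.emeasure_eq_measure)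
  qed
  moreover have "(\<lambda>n. 1 - 1 / real (Suc n)) \<longlonglongrightarrow> 1 - 0"
    by (intro tendsto_diff tendsto_const LIMSEQ_inverse_real_of_nat[unfolded inverse_eq_divide])
  ultimately have "1 - 0 \<le> M.prob (\<Union>n. K n)" by (intro LIMSEQ_le_const2) auto
  then have "M.prob (\<Union>n. K n) = 1" by (intro antisym M.prob_le_1) simp
  then have "emeasure M (\<Union>n. K n) = 1" by (simp add: M.emeasure_eq_measure)
  then show ?thesis using K by blast
qed

lemma compact_Int_closedin:
  assumes "compact K" "K \<subseteq> X" "closedin (top_of_set X) C"
  shows "compact (K \<inter> C)"
proof -
  obtain D where D: "closed D" "C = X \<inter> D" using assms(3) unfolding closedin_closed by blast
  then have "K \<inter> C = K \<inter> D" using assms(2) by blast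
  then show ?thesis using assms(1) D(1) by (simp add: compact_Int_closed)
qed

lemma continuous_map_delay_map:
  assumes "\<And>i. i < k \<Longrightarrow> continuous_on X (\<lambda>x. h ((T ^^ i) x))"
  shows "continuous_map (top_of_set X) (Euclidean_space k) (delay_map T h k)"
  unfolding delay_map_def continuous_map_componentwise_Euclidean_space
  using assms by simp

lemma Hausdorff_Euclidean_space: "Hausdorff_space (Euclidean_space k)"
  unfolding Euclidean_space_def
  by (intro Hausdorff_space_subtopology) (simp add: Hausdorff_space_product_topology)

text \<open>A delay map that is not injective still takes compact sets to closed ones. Both the
  Borel and the continuity statement rest on this.\<close>

lemma closedin_delay_map_image:
  assumes "continuous_map (top_of_set X) (Euclidean_space k) (delay_map T h k)" "compact K" "K \<subseteq> X"
  shows "closedin (Euclidean_space k) (delay_map T h k ` K)"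
  using assms
  by (intro compactin_imp_closedin[OF Hausdorff_Euclidean_space] image_compactin)
    (auto simp: compactin_subtopology)

locale observed_system = lip_space_cart U X + prob_space \<mu>
  for U :: "nat \<Rightarrow> (real ^ 'n::finite) set" and X and \<mu> :: "(real ^ 'n) measure" +
  fixes T :: "real ^ 'n \<Rightarrow> real ^ 'n"
  assumes X_borel: "X \<in> sets borel" and sets_observed: "sets \<mu> = sets (restrict_space borel X)"
    and T_in: "T \<in> X \<rightarrow> X" and T_lip: "locally_lipschitz_on X T"
begin

text \<open>The measure \<open>\<mu>\<close> lives on \<open>X\<close>; its extension to the whole
  space has the Borel sigma-algebra that the inner regularity and Fubini arguments
  presuppose.\<close>

definition ambient :: "(real ^ 'n) measure" where
  "ambient = distr \<mu> borel (\<lambda>x. x)"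

lemma space_observed: "space \<mu> = X"
  using sets_eq_imp_space_eq[OF sets_observed] by (simp add: space_restrict_space)

lemma sets_observed_iff: "A \<in> sets \<mu> \<longleftrightarrow> A \<subseteq> X \<and> A \<in> sets borel"
  unfolding sets_observed using X_borel by (subst sets_restrict_space_iff) auto

lemma sets_ambient [simp]: "sets ambient = sets borel"
  by (simp add: ambient_def)

lemma measurable_id_observed: "(\<lambda>x. x) \<in> \<mu> \<rightarrow>\<^sub>M borel"
  using X_borel by (intro measurableI) (auto simp: sets_observed_iff space_observed)

lemma emeasure_ambient: "A \<in> sets borel \<Longrightarrow> emeasure ambient A = emeasure \<mu> (A \<inter> X)"
  unfolding ambient_def by (subst emeasure_distr[OF measurable_id_observed]) (auto simp: space_observed)

lemma prob_space_ambient: "prob_space ambient"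
  unfolding ambient_def by (rule prob_space_distr[OF measurable_id_observed])

lemma full_measure_set_iff: "full_measure_set \<mu> A \<longleftrightarrow> A \<subseteq> X \<and> A \<in> sets borel \<and> emeasure ambient A = 1"
proof (cases "A \<in> sets \<mu>")
  case True
  then have A: "A \<subseteq> X" "A \<in> sets borel" by (auto simp: sets_observed_iff)
  have "emeasure \<mu> (space \<mu> - A) = 0 \<longleftrightarrow> emeasure \<mu> A = 1"
    using prob_compl[OF True] by (auto simp: emeasure_eq_measure)
  then show ?thesis using True A emeasure_ambient[OF A(2)]
    by (simp add: full_measure_set_def Int_absorb2)
next
  case False
  then show ?thesis by (auto simp: full_measure_set_def sets_observed_iff)
qed

lemma continuous_on_funpow: "continuous_on X (T ^^ i)"
  by (rule locally_lipschitz_on_imp_continuous_on[OF locally_lipschitz_on_funpow[OF T_lip T_in]])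

lemma continuous_on_observable:
  assumes "h \<in> lip_loc X" shows "continuous_on X (\<lambda>x. h ((T ^^ i) x))"
proof -
  have "continuous_on X h"
    using assms by (auto simp: lip_loc_def intro: locally_lipschitz_on_imp_continuous_on)
  then show ?thesis
    by (rule continuous_on_compose2[OF _ continuous_on_funpow]) (use funpow_in[OF T_in] in auto)
qed

lemma prevalent_determines_orbit:
  fixes K :: "nat \<Rightarrow> (real ^ 'n) set"
  assumes K: "\<And>n. compact (K n)" "\<And>n. K n \<subseteq> X" "\<And>n. null_cover k (K n)"
    and full: "emeasure ambient (\<Union>n. K n) = 1"
    and k: "1 \<le> k" "k \<le> Suc CARD('n)"
  shows "\<exists>S. borel_prevalent U X S \<and> (\<forall>h\<in>S. h \<in> lip_loc X \<and>
    (\<exists>G. full_measure_set \<mu> G \<and> G \<subseteq> (\<Union>n. K n) \<and> determines_orbit T h k G (\<Union>n. K n)))"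
proof -
  interpret ambient: prob_space ambient by (rule prob_space_ambient)
  \<comment> \<open>The index type has \<open>2 * (CARD('n) + 1)\<close> elements, enough to
    interpolate at \<open>2 * k\<close> points for every \<open>k\<close> allowed by the
    cut-off.\<close>
  let ?F = "monomials :: real ^ 'n \<Rightarrow> real ^ (('n option + 'n option) \<Rightarrow> 'n option)"
  let ?A = "\<Union>n. K n"
  from prevalent_no_dual_coincidences[where ?'j = "'n option + 'n option" and K = K and k = k,
      OF ambient.finite_measure_axioms sets_ambient T_lip T_in K k(1)]
  obtain S where S: "borel_prevalent U X S" "\<forall>h\<in>S. \<exists>N\<in>null_sets ambient.
      \<forall>x\<in>?A - N. \<forall>y\<in>?A. dual_pair ?F T k x y \<longrightarrow> (\<exists>i<k. h ((T ^^ i) x) \<noteq> h ((T ^^ i) y))"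
    by (elim exE conjE) (rule that)
  have "S \<in> sets (borel_of (lip_topology U X))" using S(1) by (simp add: borel_prevalent_def)
  then have S_lip: "S \<subseteq> lip_loc X"
    using sets.sets_into_space by (fastforce simp: space_borel_of mtopology_eq[symmetric])
  have "\<exists>G. full_measure_set \<mu> G \<and> G \<subseteq> ?A \<and> determines_orbit T h k G ?A" if h: "h \<in> S" for h
  proof -
    from bspec[OF S(2) h] obtain N where N: "N \<in> null_sets ambient"
      "\<forall>x\<in>?A - N. \<forall>y\<in>?A. dual_pair ?F T k x y \<longrightarrow> (\<exists>i<k. h ((T ^^ i) x) \<noteq> h ((T ^^ i) y))"
      by (rule bexE) (rule that)
    have A: "?A \<in> sets borel" using K(1) by (auto intro: borel_compact)
    have "emeasure ambient (?A - N) = 1"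
      using emeasure_Diff_null_set[OF N(1), of ?A] A full by simp
    moreover have "?A - N \<in> sets borel" using A null_setsD2[OF N(1)] by auto
    moreover have "?A - N \<subseteq> X" using K(2) by auto
    moreover have "determines_orbit T h k (?A - N) ?A"
      unfolding determines_orbit_def
    proof (intro ballI impI allI)
      fix x y n assume xy: "x \<in> ?A - N" "y \<in> ?A" and eq: "\<forall>i<k. h ((T ^^ i) x) = h ((T ^^ i) y)"
      have "\<not> dual_pair ?F T k x y" using bspec[OF bspec[OF N(2) xy(1)] xy(2)] eq by blast
      moreover have "2 * k \<le> CARD('n option + 'n option)" using k(2) by simp
      ultimately show "h ((T ^^ n) x) = h ((T ^^ n) y)"
        by (rule not_dual_pair_propagate[OF _ _ eq[rule_format]])
    qed
    ultimately show ?thesis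
      by (intro exI[of _ "?A - N"]) (simp add: full_measure_set_iff Diff_subset)
  qed
  then show ?thesis using S(1) S_lip by blast
qed

lemma predictability_setI:
  assumes "full_measure_set \<mu> G" "G \<subseteq> A" "determines_orbit T h k G A" "k \<le> k'"
  shows "predictability_set \<mu> T k' h G"
  unfolding predictability_set_def
  using assms(1,2) determines_orbit_delay_map[OF assms(3,4)] by blast

lemma as_predictableI:
  assumes h: "h \<in> lip_loc X" and G: "predictability_set \<mu> T k h G"
  shows "as_predictable \<mu> T k h"
proof -
  have "h \<in> borel_measurable (restrict_space borel X)"
    using continuous_on_observable[OF h, of 0] by (intro borel_measurable_continuous_on_restrict) simp
  then have "h \<in> borel_measurable \<mu>"
    using measurable_cong_sets[OF sets_observed refl] by blast
  then show ?thesis using G unfolding as_predictable_def by blast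
qed

text \<open>The points whose whole orbit stays in \<open>G\<close> form a set \<open>H\<close> of
  full measure by invariance, but \<open>H\<close> need not be sigma-compact. A sigma-compact subset
  of \<open>H\<close> of full measure need not be invariant; adding all its forward images restores
  invariance, keeps sigma-compactness and stays inside \<open>G\<close>.\<close>

lemma invariant_sigma_compact_subset:
  assumes inv: "invariant_measure \<mu> T" and G: "full_measure_set \<mu> G"
  shows "\<exists>L :: nat \<Rightarrow> (real ^ 'n) set. (\<forall>n. compact (L n)) \<and> (\<Union>n. L n) \<subseteq> G \<and>
    T ` (\<Union>n. L n) \<subseteq> (\<Union>n. L n) \<and> full_measure_set \<mu> (\<Union>n. L n)"
proof -
  interpret ambient: prob_space ambient by (rule prob_space_ambient)
  have G': "G \<subseteq> X" "G \<in> sets borel" "emeasure ambient G = 1" using G by (auto simp: full_measure_set_iff)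
  define E where "E n = {x \<in> X. (T ^^ n) x \<in> G}" for n
  have E_sets: "E n \<in> sets \<mu>" for n
  proof -
    have "(T ^^ n) \<in> borel_measurable (restrict_space borel X)"
      by (rule borel_measurable_continuous_on_restrict[OF continuous_on_funpow])
    then have "(T ^^ n) -` G \<inter> space (restrict_space borel X) \<in> sets (restrict_space borel X)"
      using G'(2) by (rule measurable_sets)
    moreover have "(T ^^ n) -` G \<inter> space (restrict_space borel X) = E n"
      by (auto simp: E_def space_restrict_space)
    ultimately show ?thesis by (simp add: sets_observed)
  qed
  have E_full: "emeasure \<mu> (E n) = 1" for n
  proof (induction n)
    case 0
    have "E 0 = G" using G'(1) by (auto simp: E_def)
    then show ?case using G' emeasure_ambient[OF G'(2)] by (simp add: Int_absorb2)
  next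
    case (Suc n)
    have "E (Suc n) = T -` E n \<inter> space \<mu>"
      using T_in by (auto simp: E_def space_observed funpow_Suc_right simp del: funpow.simps)
    then show ?case using inv E_sets Suc unfolding invariant_measure_def by simp
  qed
  define H where "H = (\<Inter>n. E n)"
  have "H \<in> sets \<mu>" unfolding H_def using E_sets by (intro sets.countable_INT) auto
  then have H: "H \<subseteq> X" "H \<in> sets borel" by (auto simp: sets_observed_iff)
  have "AE x in \<mu>. x \<in> E n" for n
    using E_full E_sets by (subst AE_in_set_eq_1) (auto simp: emeasure_eq_measure)
  then have "AE x in \<mu>. x \<in> H" by (simp add: H_def AE_all_countable)
  then have "emeasure \<mu> H = 1" by (rule emeasure_eq_1_AE[OF \<open>H \<in> sets \<mu>\<close>])
  then have "emeasure ambient H = 1" using H by (simp add: emeasure_ambient Int_absorb2)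
  from full_measure_sigma_compact[OF prob_space_ambient sets_ambient H(2) this]
  obtain K :: "nat \<Rightarrow> (real ^ 'n) set" where K: "\<And>n. compact (K n)" "\<And>n. K n \<subseteq> H" "emeasure ambient (\<Union>n. K n) = 1"
    by blast
  \<comment> \<open>\<open>prod_decode\<close> enumerates the pairs of an iterate and a compact
    piece.\<close>
  define L where "L m = (T ^^ fst (prod_decode m)) ` K (snd (prod_decode m))" for m
  have L_UN: "(\<Union>m. L m) = (\<Union>i n. (T ^^ i) ` K n)"
  proof
    show "(\<Union>i n. (T ^^ i) ` K n) \<subseteq> (\<Union>m. L m)"
    proof clarify
      fix i n x assume "x \<in> K n"
      then show "(T ^^ i) x \<in> (\<Union>m. L m)"
        by (intro UN_I[of "prod_encode (i, n)"]) (auto simp: L_def)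
    qed
  qed (auto simp: L_def)
  have L: "compact (L m)" for m
    unfolding L_def
    by (intro compact_continuous_image continuous_on_subset[OF continuous_on_funpow] K(1))
      (use K(2) H(1) in blast)
  have "(T ^^ i) x \<in> G" if "x \<in> K n" for i n x
    using that K(2)[of n] by (auto simp: H_def E_def)
  then have LG: "(\<Union>m. L m) \<subseteq> G" unfolding L_UN by blast
  moreover have "T ` (\<Union>m. L m) \<subseteq> (\<Union>m. L m)"
    unfolding L_UN
  proof clarify
    fix i n x assume x: "x \<in> K n"
    have "T ((T ^^ i) x) \<in> (T ^^ Suc i) ` K n"
      by (rule image_eqI[OF _ x]) simp
    then show "T ((T ^^ i) x) \<in> (\<Union>i n. (T ^^ i) ` K n)" by blast
  qed
  moreover have "full_measure_set \<mu> (\<Union>m. L m)"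
  proof -
    have "(\<Union>m. L m) \<in> sets borel" using L by (auto intro: borel_compact)
    moreover have "(\<Union>n. K n) \<subseteq> (\<Union>m. L m)"
    proof clarify
      fix x n assume "x \<in> K n"
      then have "x \<in> (T ^^ 0) ` K n" by simp
      then show "x \<in> (\<Union>m. L m)" unfolding L_UN by blast
    qed
    ultimately have "1 \<le> emeasure ambient (\<Union>m. L m)"
      unfolding K(3)[symmetric] by (intro emeasure_mono) auto
    then have "emeasure ambient (\<Union>m. L m) = 1" using ambient.emeasure_le_1 by (intro antisym)
    then show ?thesis using \<open>(\<Union>m. L m) \<in> sets borel\<close> LG G'(1) by (auto simp: full_measure_set_iff)
  qed
  ultimately show ?thesis using L by blast
qed

text \<open>Only the values on the image of \<open>Xh\<close> matter; elsewhere the choice is from an empty predicate.\<close>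

definition predictor :: "nat \<Rightarrow> (real ^ 'n \<Rightarrow> real) \<Rightarrow> (real ^ 'n) set \<Rightarrow> (nat \<Rightarrow> real) \<Rightarrow> nat \<Rightarrow> real" where
  "predictor k h Xh z = delay_map T h k (T (SOME x. x \<in> Xh \<and> delay_map T h k x = z))"

lemma predictor_delay_map:
  assumes "predictability_set \<mu> T k h Xh" "x \<in> Xh"
  shows "predictor k h Xh (delay_map T h k x) = delay_map T h k (T x)"
proof -
  have "(SOME y. y \<in> Xh \<and> delay_map T h k y = delay_map T h k x) \<in> Xh \<and>
      delay_map T h k (SOME y. y \<in> Xh \<and> delay_map T h k y = delay_map T h k x) = delay_map T h k x"
    by (rule someI[of _ x]) (use assms(2) in simp)
  then show ?thesis
    using assms unfolding predictability_set_def predictor_def by blast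
qed

lemma prediction_map_predictor:
  assumes "predictability_set \<mu> T k h Xh"
  shows "prediction_map X T k h Xh (predictor k h Xh)"
proof -
  have "Xh \<subseteq> X" using assms by (simp add: predictability_set_def full_measure_set_iff)
  then show ?thesis
    unfolding prediction_map_def using predictor_delay_map[OF assms] T_in by force
qed

text \<open>Preimages of closed sets under the predictor are delay images of sigma-compact sets: the
  condition is imposed on the delay vector of \<open>T x\<close> in phase space, where it is closed,
  and compact pieces map to closed sets.\<close>

lemma borel_invariant_prediction_predictor:
  fixes L :: "nat \<Rightarrow> (real ^ 'n) set"
  assumes h: "h \<in> lip_loc X" and Xh: "predictability_set \<mu> T k h (\<Union>n. L n)"
    and L: "\<And>n. compact (L n)" and inv: "T ` (\<Union>n. L n) \<subseteq> (\<Union>n. L n)"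
  shows "borel_invariant_prediction T k h (\<Union>n. L n) (predictor k h (\<Union>n. L n))"
proof -
  let ?X = "\<Union>n. L n" and ?d = "delay_map T h k" and ?E = "Euclidean_space k"
  let ?S = "predictor k h ?X"
  have LX: "L n \<subseteq> X" for n using Xh by (auto simp: predictability_set_def full_measure_set_iff)
  have d: "continuous_map (top_of_set X) ?E ?d"
    by (rule continuous_map_delay_map) (rule continuous_on_observable[OF h])
  have dT: "continuous_map (top_of_set X) ?E (\<lambda>x. ?d (T x))"
  proof -
    have "continuous_map (top_of_set X) (top_of_set X) T"
      using T_in locally_lipschitz_on_imp_continuous_on[OF T_lip] by auto
    from continuous_map_compose[OF this d] show ?thesis by (simp add: o_def)
  qed
  have img: "?d ` (\<Union>n. M n) \<in> sets (borel_of ?E)" if "\<And>n. compact (M n)" "\<And>n. M n \<subseteq> X" for M :: "nat \<Rightarrow> _"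
    unfolding image_UN
    by (intro sets.countable_UN image_subsetI closedin_sets_borel_of closedin_delay_map_image[OF d] that)
  have S_in: "?S \<in> ?d ` ?X \<rightarrow> ?d ` ?X"
  proof (rule funcsetI)
    fix z assume "z \<in> ?d ` ?X"
    then obtain x where x: "x \<in> ?X" "z = ?d x" by (elim imageE) (rule that)
    have "T x \<in> ?X" using inv imageI[OF x(1)] by (rule subsetD)
    then show "?S z \<in> ?d ` ?X" unfolding x(2) predictor_delay_map[OF Xh x(1)] by (rule imageI)
  qed
  have dE: "?d x \<in> topspace ?E" for x by (simp add: delay_map_def topspace_Euclidean_space)
  have dX: "?d ` ?X \<in> sets (borel_of ?E)" by (rule img[of L, OF L LX])
  define R where "R = restrict_space (borel_of ?E) (?d ` ?X)"
  have space_R: "space R = ?d ` ?X"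
    using dE by (auto simp: R_def space_restrict_space space_borel_of)
  have sets_R: "A \<in> sets R \<longleftrightarrow> A \<subseteq> ?d ` ?X \<and> A \<in> sets (borel_of ?E)" for A
    unfolding R_def using dX by (subst sets_restrict_space_iff) auto
  have "?S \<in> R \<rightarrow>\<^sub>M borel_of ?E"
    unfolding borel_of_def
  proof (rule measurable_measure_of)
    show "{W. openin ?E W} \<subseteq> Pow (topspace ?E)" by (auto dest: openin_subset)
    show "?S \<in> space R \<rightarrow> topspace ?E"
    proof (rule funcsetI)
      fix z assume "z \<in> space R"
      then have "?S z \<in> ?d ` ?X" unfolding space_R by (rule funcset_mem[OF S_in])
      then show "?S z \<in> topspace ?E" using dE by (elim imageE) simp
    qed
    fix W assume "W \<in> {W. openin ?E W}"
    then have "closedin ?E (topspace ?E - W)" by (simp add: closedin_diff)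
    from closedin_continuous_map_preimage[OF dT this]
    have cl: "closedin (top_of_set X) {x \<in> X. ?d (T x) \<in> topspace ?E - W}" by simp
    \<comment> \<open>The points whose successor has its delay vector outside \<open>W\<close>. By
      predictability their delay vectors are exactly the points of \<open>space R\<close> that
      \<open>?S\<close> sends outside \<open>W\<close>.\<close>
    define M where "M n = L n \<inter> {x \<in> X. ?d (T x) \<in> topspace ?E - W}" for n
    have "compact (M n)" for n
      unfolding M_def using L LX cl by (rule compact_Int_closedin)
    moreover have "M n \<subseteq> X" for n using LX by (auto simp: M_def)
    ultimately have "?d ` (\<Union>n. M n) \<in> sets R"
      unfolding sets_R using img[of M] by (auto simp: M_def)
    then have "space R - ?d ` (\<Union>n. M n) \<in> sets R" by (rule sets.compl_sets)
    moreover have "?S -` W \<inter> space R = space R - ?d ` (\<Union>n. M n)"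
    proof (intro set_eqI iffI)
      fix z assume z: "z \<in> ?S -` W \<inter> space R"
      have "?S z \<notin> W" if zM: "z \<in> ?d ` (\<Union>n. M n)"
      proof -
        obtain x n where x: "z = ?d x" "x \<in> M n" using zM by auto
        then have "x \<in> ?X" by (auto simp: M_def)
        then show ?thesis using x predictor_delay_map[OF Xh] by (simp add: M_def)
      qed
      then show "z \<in> space R - ?d ` (\<Union>n. M n)" using z by auto
    next
      fix z assume z: "z \<in> space R - ?d ` (\<Union>n. M n)"
      then obtain x n where x: "z = ?d x" "x \<in> L n" unfolding space_R by auto
      then have "x \<notin> M n" using z by auto
      then have "?d (T x) \<in> W" using x(2) LX[of n] dE by (auto simp: M_def)
      moreover have "?S z = ?d (T x)" unfolding x(1) by (rule predictor_delay_map[OF Xh]) (use x(2) in blast)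
      ultimately show "z \<in> ?S -` W \<inter> space R" using z by simp
    qed
    ultimately show "?S -` W \<inter> space R \<in> sets R" by simp
  qed
  then show ?thesis
    unfolding R_def
    unfolding borel_invariant_prediction_def using inv S_in dX by blast
qed

text \<open>The preimage of a closed set is cut out by the closed image of a compact part of
  \<open>A\<close>. Points of that part need not lie in \<open>Xh\<close>, so \<open>x\<close> in
  \<open>Xh\<close> must be compared with \<open>y\<close> in all of \<open>A\<close>, which is what
  determination relative to \<open>A\<close> provides.\<close>

lemma continuous_prediction_predictor:
  assumes h: "h \<in> lip_loc X" and Xh: "predictability_set \<mu> T k' h Xh"
    and A: "compact A" "A \<subseteq> X" "Xh \<subseteq> A" "determines_orbit T h k Xh A" and k: "k \<le> k'"
  shows "continuous_prediction T k' h Xh (predictor k' h Xh)"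
proof -
  let ?d = "delay_map T h k'" and ?E = "Euclidean_space k'"
  let ?S = "predictor k' h Xh"
  have d: "continuous_map (top_of_set X) ?E ?d"
    by (rule continuous_map_delay_map) (rule continuous_on_observable[OF h])
  have dT: "continuous_map (top_of_set X) ?E (\<lambda>x. ?d (T x))"
  proof -
    have "continuous_map (top_of_set X) (top_of_set X) T"
      using T_in locally_lipschitz_on_imp_continuous_on[OF T_lip] by auto
    from continuous_map_compose[OF this d] show ?thesis by (simp add: o_def)
  qed
  have dE: "?d x \<in> topspace ?E" for x by (simp add: delay_map_def topspace_Euclidean_space)
  show ?thesis
    unfolding continuous_prediction_def continuous_map_closedin
  proof (intro conjI allI impI)
    show "?S \<in> topspace (subtopology ?E (?d ` Xh)) \<rightarrow> topspace ?E"
      using predictor_delay_map[OF Xh] dE by auto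
    fix C assume C: "closedin ?E C"
    let ?B = "A \<inter> {x \<in> X. ?d (T x) \<in> C}"
    have "closedin (top_of_set X) {x \<in> X. ?d (T x) \<in> C}"
      using closedin_continuous_map_preimage[OF dT C] by simp
    with A(1,2) have "compact ?B" by (rule compact_Int_closedin)
    then have B: "closedin ?E (?d ` ?B)" by (intro closedin_delay_map_image[OF d]) auto
    have "{z \<in> topspace (subtopology ?E (?d ` Xh)). ?S z \<in> C} = ?d ` Xh \<inter> ?d ` ?B"
    proof (intro set_eqI iffI)
      fix z assume "z \<in> {z \<in> topspace (subtopology ?E (?d ` Xh)). ?S z \<in> C}"
      then obtain x where x: "x \<in> Xh" "z = ?d x" "?S z \<in> C" by auto
      then have "x \<in> ?B" using A(2,3) predictor_delay_map[OF Xh x(1)] by auto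
      then show "z \<in> ?d ` Xh \<inter> ?d ` ?B" using x by blast
    next
      fix z assume "z \<in> ?d ` Xh \<inter> ?d ` ?B"
      then obtain x y where xy: "x \<in> Xh" "z = ?d x" "y \<in> ?B" "z = ?d y" by auto
      then have "?d (T x) = ?d (T y)"
        using determines_orbit_delay_map[OF A(4) k xy(1), of y] by simp
      then have "?S z \<in> C" using xy predictor_delay_map[OF Xh xy(1)] by simp
      then show "z \<in> {z \<in> topspace (subtopology ?E (?d ` Xh)). ?S z \<in> C}" using xy(1,2) dE by auto
    qed
    then show "closedin (subtopology ?E (?d ` Xh)) {z \<in> topspace (subtopology ?E (?d ` Xh)). ?S z \<in> C}"
      using B by (simp add: closedin_subtopology_Int_closed)
  qed
qed

end

lemma determines_orbit_subset: "determines_orbit T h k G A \<Longrightarrow> G' \<subseteq> G \<Longrightarrow> determines_orbit T h k G' A"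
  unfolding determines_orbit_def by blast

lemma prevalent_superset:
  assumes "borel_prevalent U X S" "\<And>h. h \<in> S \<Longrightarrow> h \<in> lip_loc X \<and> P h"
  shows "prevalent U X {h \<in> lip_loc X. P h}"
  unfolding prevalent_def using assms by blast

section \<open>The support, the choice of the exponent, and the prevalent sets\<close>

context observed_system
begin

lemma closedin_measure_support: "closedin (top_of_set X) (measure_support \<mu>)"
  unfolding measure_support_def space_observed
proof (rule closedin_Inter)
  have "full_measure_set \<mu> X"
    using X_borel space_observed by (auto simp: full_measure_set_def sets_observed_iff)
  then show "{C. closedin (top_of_set X) C \<and> full_measure_set \<mu> C} \<noteq> {}" by auto
qed auto

text \<open>The intersection may run over uncountably many sets; by Lindelof countably many of the
  relatively open null complements already have the same union.\<close>

lemma full_measure_set_measure_support: "full_measure_set \<mu> (measure_support \<mu>)"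
proof -
  let ?F = "{C. closedin (top_of_set X) C \<and> full_measure_set \<mu> C}"
  have op: "openin (top_of_set X) S" if "S \<in> (\<lambda>C. X - C) ` ?F" for S
    using that by (auto intro: openin_diff)
  obtain \<V> where \<V>: "\<V> \<subseteq> (\<lambda>C. X - C) ` ?F" "countable \<V>" "\<Union>\<V> = \<Union>((\<lambda>C. X - C) ` ?F)"
    by (rule Lindelof_openin[of "(\<lambda>C. X - C) ` ?F" X, OF op], assumption, rule that)
  have null: "V \<in> null_sets \<mu>" if "V \<in> \<V>" for V
  proof -
    obtain C where C: "V = X - C" "full_measure_set \<mu> C" using \<V>(1) \<open>V \<in> \<V>\<close> by blast
    then have "V \<in> sets \<mu>"
      using sets.compl_sets[of C \<mu>] by (simp add: full_measure_set_def space_observed)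
    then show ?thesis using C by (intro null_setsI) (simp_all add: full_measure_set_def space_observed)
  qed
  have "\<Union>\<V> \<in> null_sets \<mu>"
    using null_sets_UN'[OF \<V>(2), of "\<lambda>V. V" \<mu>] null by simp
  moreover have "\<Union>\<V> = X - measure_support \<mu>"
    unfolding \<V>(3) measure_support_def space_observed by blast
  moreover have "measure_support \<mu> \<subseteq> X"
    using closedin_subset[OF closedin_measure_support] by simp
  ultimately show ?thesis
    unfolding full_measure_set_def space_observed
    using sets.compl_sets[of "\<Union>\<V>" \<mu>] by (auto simp: space_observed double_diff null_sets_def)
qed

lemma compact_measure_support: "compact X \<Longrightarrow> compact (measure_support \<mu>)"
  using closedin_compact closedin_measure_support by blast

lemma hausdorff_dim_measure_cover:
  "\<exists>k K. 1 \<le> k \<and> k \<le> Suc CARD('n) \<and> (\<forall>k'\<ge>1. hausdorff_dim_measure \<mu> < of_nat k' \<longrightarrow> k \<le> k') \<and>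
    (\<forall>n::nat. compact (K n) \<and> K n \<subseteq> X \<and> null_cover k (K n)) \<and> emeasure ambient (\<Union>n. K n) = 1"
proof -
  \<comment> \<open>Null covers are demanded of bounded subsets only: a full measure set for the
    fallback exponent may be unbounded, while the compact pieces taken later are bounded.\<close>
  define P where "P k \<longleftrightarrow> (\<exists>A. full_measure_set \<mu> A \<and> (\<forall>B. B \<subseteq> A \<longrightarrow> bounded B \<longrightarrow> null_cover k B))" for k
  have "P k" if k: "hausdorff_dim_measure \<mu> < of_nat k" for k
  proof -
    obtain A where "full_measure_set \<mu> A" "hausdorff_dim A < of_nat k"
      using k unfolding hausdorff_dim_measure_def INF_less_iff by blast
    then show ?thesis
      unfolding P_def using null_cover_subset[OF hausdorff_dim_less_imp_null_cover] by blast
  qed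
  moreover have "P (Suc CARD('n))"
    unfolding P_def using full_measure_set_measure_support bounded_null_cover by blast
  ultimately obtain k where k: "1 \<le> k" "k \<le> Suc CARD('n)" "P k"
    "\<forall>k'\<ge>1. hausdorff_dim_measure \<mu> < of_nat k' \<longrightarrow> k \<le> k'"
    using least_admissible_exponent[of "hausdorff_dim_measure \<mu>" P "CARD('n)"] by blast
  then obtain A where A: "full_measure_set \<mu> A" "\<And>B. B \<subseteq> A \<Longrightarrow> bounded B \<Longrightarrow> null_cover k B"
    unfolding P_def by blast
  then have A': "A \<subseteq> X" "A \<in> sets borel" "emeasure ambient A = 1" by (auto simp: full_measure_set_iff)
  from full_measure_sigma_compact[OF prob_space_ambient sets_ambient A'(2,3)]
  obtain K :: "nat \<Rightarrow> (real ^ 'n) set" where K: "\<forall>n. compact (K n) \<and> K n \<subseteq> A" "emeasure ambient (\<Union>n. K n) = 1"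
    by blast
  have "\<forall>n. compact (K n) \<and> K n \<subseteq> X \<and> null_cover k (K n)"
    using K(1) A'(1) A(2) compact_imp_bounded by blast
  then show ?thesis using k K(2) by blast
qed

lemma hausdorff_dim_support_cover:
  assumes "compact X"
  shows "\<exists>k. 1 \<le> k \<and> k \<le> Suc CARD('n) \<and>
    (\<forall>k'\<ge>1. hausdorff_dim (measure_support \<mu>) < of_nat k' \<longrightarrow> k \<le> k') \<and> null_cover k (measure_support \<mu>)"
  using least_admissible_exponent[of "hausdorff_dim (measure_support \<mu>)"
      "\<lambda>k. null_cover k (measure_support \<mu>)" "CARD('n)"]
    hausdorff_dim_less_imp_null_cover bounded_null_cover compact_imp_bounded compact_measure_support[OF assms]
  by blast

lemma prevalent_as_predictable:
  "prevalent U X {h \<in> lip_loc X. \<forall>k\<ge>1. hausdorff_dim_measure \<mu> < of_nat k \<longrightarrow> as_predictable \<mu> T k h}"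
proof -
  obtain k K where k: "1 \<le> k" "k \<le> Suc CARD('n)"
      "\<And>k'. k' \<ge> 1 \<Longrightarrow> hausdorff_dim_measure \<mu> < of_nat k' \<Longrightarrow> k \<le> k'"
    and K: "\<And>n::nat. compact (K n)" "\<And>n. K n \<subseteq> X" "\<And>n. null_cover k (K n)" "emeasure ambient (\<Union>n. K n) = 1"
    using hausdorff_dim_measure_cover by blast
  from prevalent_determines_orbit[OF K k(1,2)] obtain S where S: "borel_prevalent U X S"
    "\<forall>h\<in>S. h \<in> lip_loc X \<and> (\<exists>G. full_measure_set \<mu> G \<and> G \<subseteq> (\<Union>n. K n) \<and> determines_orbit T h k G (\<Union>n. K n))"
    by (elim exE conjE) (rule that)
  show ?thesis
  proof (rule prevalent_superset[OF S(1)])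
    fix h assume "h \<in> S"
    then obtain G where h: "h \<in> lip_loc X" and G: "full_measure_set \<mu> G" "G \<subseteq> (\<Union>n. K n)"
        "determines_orbit T h k G (\<Union>n. K n)"
      using S(2) by blast
    show "h \<in> lip_loc X \<and> (\<forall>k\<ge>1. hausdorff_dim_measure \<mu> < of_nat k \<longrightarrow> as_predictable \<mu> T k h)"
      using h as_predictableI[OF h predictability_setI[OF G k(3)]] by blast
  qed
qed

lemma prevalent_borel_invariant_prediction:
  assumes "invariant_measure \<mu> T"
  shows "prevalent U X {h \<in> lip_loc X. \<forall>k\<ge>1. hausdorff_dim_measure \<mu> < of_nat k \<longrightarrow>
    (\<exists>Xh S. predictability_set \<mu> T k h Xh \<and> prediction_map X T k h Xh S \<and>
      borel_invariant_prediction T k h Xh S)}"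
proof -
  obtain k K where k: "1 \<le> k" "k \<le> Suc CARD('n)"
      "\<And>k'. k' \<ge> 1 \<Longrightarrow> hausdorff_dim_measure \<mu> < of_nat k' \<Longrightarrow> k \<le> k'"
    and K: "\<And>n::nat. compact (K n)" "\<And>n. K n \<subseteq> X" "\<And>n. null_cover k (K n)" "emeasure ambient (\<Union>n. K n) = 1"
    using hausdorff_dim_measure_cover by blast
  from prevalent_determines_orbit[OF K k(1,2)] obtain S where S: "borel_prevalent U X S"
    "\<forall>h\<in>S. h \<in> lip_loc X \<and> (\<exists>G. full_measure_set \<mu> G \<and> G \<subseteq> (\<Union>n. K n) \<and> determines_orbit T h k G (\<Union>n. K n))"
    by (elim exE conjE) (rule that)
  show ?thesis
  proof (rule prevalent_superset[OF S(1)], intro conjI allI impI)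
    fix h assume "h \<in> S"
    then obtain G where h: "h \<in> lip_loc X" and G: "full_measure_set \<mu> G" "G \<subseteq> (\<Union>n. K n)"
        "determines_orbit T h k G (\<Union>n. K n)"
      using S(2) by blast
    show "h \<in> lip_loc X" by (rule h)
    from invariant_sigma_compact_subset[OF assms G(1)]
    obtain L :: "nat \<Rightarrow> (real ^ 'n) set" where L: "\<And>n. compact (L n)" "(\<Union>n. L n) \<subseteq> G"
      "T ` (\<Union>n. L n) \<subseteq> (\<Union>n. L n)" "full_measure_set \<mu> (\<Union>n. L n)"
      by blast
    fix k' :: nat assume "k' \<ge> 1" "hausdorff_dim_measure \<mu> < of_nat k'"
    then have "k \<le> k'" by (rule k(3))
    with L(4) order_trans[OF L(2) G(2)] determines_orbit_subset[OF G(3) L(2)]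
    have p: "predictability_set \<mu> T k' h (\<Union>n. L n)" by (rule predictability_setI)
    show "\<exists>Xh S. predictability_set \<mu> T k' h Xh \<and> prediction_map X T k' h Xh S \<and>
        borel_invariant_prediction T k' h Xh S"
      using p prediction_map_predictor[OF p] borel_invariant_prediction_predictor[OF h p L(1,3)] by blast
  qed
qed

lemma prevalent_determines_orbit_support:
  assumes "compact X"
  shows "\<exists>k S. (\<forall>k'\<ge>1. hausdorff_dim (measure_support \<mu>) < of_nat k' \<longrightarrow> k \<le> k') \<and>
    borel_prevalent U X S \<and> (\<forall>h\<in>S. h \<in> lip_loc X \<and>
      (\<exists>G. full_measure_set \<mu> G \<and> G \<subseteq> measure_support \<mu> \<and> determines_orbit T h k G (measure_support \<mu>)))"
proof -
  let ?A = "measure_support \<mu>"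
  obtain k where k: "1 \<le> k" "k \<le> Suc CARD('n)" "null_cover k ?A"
      "\<And>k'. k' \<ge> 1 \<Longrightarrow> hausdorff_dim ?A < of_nat k' \<Longrightarrow> k \<le> k'"
    using hausdorff_dim_support_cover[OF assms] by blast
  have A: "?A \<subseteq> X" "emeasure ambient ?A = 1"
    using full_measure_set_measure_support by (auto simp: full_measure_set_iff)
  \<comment> \<open>The support is itself compact, so a constant sequence of pieces
    suffices.\<close>
  have "\<exists>S. borel_prevalent U X S \<and> (\<forall>h\<in>S. h \<in> lip_loc X \<and>
      (\<exists>G. full_measure_set \<mu> G \<and> G \<subseteq> ?A \<and> determines_orbit T h k G ?A))"
    using prevalent_determines_orbit[of "\<lambda>_::nat. ?A" k]
    using compact_measure_support[OF assms] A k(1-3) by simp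
  then show ?thesis using k(4) by blast
qed

lemma prevalent_continuous_prediction:
  assumes "compact X"
  shows "prevalent U X {h \<in> lip_loc X. \<forall>k\<ge>1. hausdorff_dim (measure_support \<mu>) < of_nat k \<longrightarrow>
    (\<exists>Xh S. predictability_set \<mu> T k h Xh \<and> prediction_map X T k h Xh S \<and>
      continuous_prediction T k h Xh S)}"
proof -
  let ?A = "measure_support \<mu>"
  from prevalent_determines_orbit_support[OF assms] obtain k S where
    k: "\<forall>k'\<ge>1. hausdorff_dim ?A < of_nat k' \<longrightarrow> k \<le> k'" and S: "borel_prevalent U X S"
      "\<forall>h\<in>S. h \<in> lip_loc X \<and> (\<exists>G. full_measure_set \<mu> G \<and> G \<subseteq> ?A \<and> determines_orbit T h k G ?A)"
    by (elim exE conjE) (rule that)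
  have A: "?A \<subseteq> X" using full_measure_set_measure_support by (simp add: full_measure_set_iff)
  show ?thesis
  proof (rule prevalent_superset[OF S(1)], intro conjI allI impI)
    fix h assume "h \<in> S"
    then obtain G where h: "h \<in> lip_loc X" and G: "full_measure_set \<mu> G" "G \<subseteq> ?A"
        "determines_orbit T h k G ?A"
      using S(2) by blast
    show "h \<in> lip_loc X" by (rule h)
    fix k' :: nat assume "k' \<ge> 1" "hausdorff_dim ?A < of_nat k'"
    then have kk: "k \<le> k'" using k by blast
    have p: "predictability_set \<mu> T k' h G" by (rule predictability_setI[OF G kk])
    show "\<exists>Xh S. predictability_set \<mu> T k' h Xh \<and> prediction_map X T k' h Xh S \<and>
        continuous_prediction T k' h Xh S"
      using p prediction_map_predictor[OF p]
        continuous_prediction_predictor[OF h p compact_measure_support[OF assms] A G(2,3) kk] by blast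
  qed
qed

text \<open>One pair of set and map has to satisfy both regularity claims: the invariant
  sigma-compact set is taken inside \<open>G\<close>, where orbits are still determined relative to
  the compact support, and this gives continuity.\<close>

lemma prevalent_continuous_borel_invariant_prediction:
  assumes "compact X" "invariant_measure \<mu> T"
  shows "prevalent U X {h \<in> lip_loc X. \<forall>k\<ge>1. hausdorff_dim (measure_support \<mu>) < of_nat k \<longrightarrow>
    (\<exists>Xh S. predictability_set \<mu> T k h Xh \<and> prediction_map X T k h Xh S \<and>
      borel_invariant_prediction T k h Xh S \<and> continuous_prediction T k h Xh S)}"
proof -
  let ?A = "measure_support \<mu>"
  from prevalent_determines_orbit_support[OF assms(1)] obtain k S where
    k: "\<forall>k'\<ge>1. hausdorff_dim ?A < of_nat k' \<longrightarrow> k \<le> k'" and S: "borel_prevalent U X S"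
      "\<forall>h\<in>S. h \<in> lip_loc X \<and> (\<exists>G. full_measure_set \<mu> G \<and> G \<subseteq> ?A \<and> determines_orbit T h k G ?A)"
    by (elim exE conjE) (rule that)
  have A: "?A \<subseteq> X" using full_measure_set_measure_support by (simp add: full_measure_set_iff)
  show ?thesis
  proof (rule prevalent_superset[OF S(1)], intro conjI allI impI)
    fix h assume "h \<in> S"
    then obtain G where h: "h \<in> lip_loc X" and G: "full_measure_set \<mu> G" "G \<subseteq> ?A"
        "determines_orbit T h k G ?A"
      using S(2) by blast
    show "h \<in> lip_loc X" by (rule h)
    from invariant_sigma_compact_subset[OF assms(2) G(1)]
    obtain L :: "nat \<Rightarrow> (real ^ 'n) set" where L: "\<And>n. compact (L n)" "(\<Union>n. L n) \<subseteq> G"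
      "T ` (\<Union>n. L n) \<subseteq> (\<Union>n. L n)" "full_measure_set \<mu> (\<Union>n. L n)"
      by blast
    fix k' :: nat assume "k' \<ge> 1" "hausdorff_dim ?A < of_nat k'"
    then have kk: "k \<le> k'" using k by blast
    note LA = order_trans[OF L(2) G(2)] determines_orbit_subset[OF G(3) L(2)]
    have p: "predictability_set \<mu> T k' h (\<Union>n. L n)" by (rule predictability_setI[OF L(4) LA kk])
    show "\<exists>Xh S. predictability_set \<mu> T k' h Xh \<and> prediction_map X T k' h Xh S \<and>
        borel_invariant_prediction T k' h Xh S \<and> continuous_prediction T k' h Xh S"
      using p prediction_map_predictor[OF p] borel_invariant_prediction_predictor[OF h p L(1,3)]
        continuous_prediction_predictor[OF h p compact_measure_support[OF assms(1)] A LA kk] by blast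
  qed
qed

end

theorem theorem1p21:
  fixes X :: "(real ^ 'n) set" and U :: "nat \<Rightarrow> (real ^ 'n) set"
    and \<mu> :: "(real ^ 'n) measure" and T :: "real ^ 'n \<Rightarrow> real ^ 'n"
  assumes "topological_basis (range U)" and "\<And>n. bounded (U n)"
    and "X \<in> sets borel"
    and "prob_space \<mu>" and "sets \<mu> = sets (restrict_space borel X)"
    and "T \<in> X \<rightarrow> X" and "locally_lipschitz_on X T"
  shows
    "prevalent U X {h \<in> lip_loc X. \<forall>k\<ge>1. hausdorff_dim_measure \<mu> < of_nat k \<longrightarrow>
        as_predictable \<mu> T k h} \<and>
     (invariant_measure \<mu> T \<longrightarrow>
        prevalent U X {h \<in> lip_loc X. \<forall>k\<ge>1. hausdorff_dim_measure \<mu> < of_nat k \<longrightarrow>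
          (\<exists>Xh S. predictability_set \<mu> T k h Xh \<and> prediction_map X T k h Xh S \<and>
             borel_invariant_prediction T k h Xh S)}) \<and>
     (compact X \<longrightarrow>
        prevalent U X {h \<in> lip_loc X. \<forall>k\<ge>1. hausdorff_dim (measure_support \<mu>) < of_nat k \<longrightarrow>
          (\<exists>Xh S. predictability_set \<mu> T k h Xh \<and> prediction_map X T k h Xh S \<and>
             continuous_prediction T k h Xh S)}) \<and>
     (compact X \<and> invariant_measure \<mu> T \<longrightarrow>
        prevalent U X {h \<in> lip_loc X. \<forall>k\<ge>1. hausdorff_dim (measure_support \<mu>) < of_nat k \<longrightarrow>
          (\<exists>Xh S. predictability_set \<mu> T k h Xh \<and> prediction_map X T k h Xh S \<and>
             borel_invariant_prediction T k h Xh S \<and> continuous_prediction T k h Xh S)})"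
proof -
  interpret observed_system U X \<mu> T
  proof (intro observed_system.intro lip_space_cart.intro lip_space.intro
      lip_space_cart_axioms.intro observed_system_axioms.intro)
  qed (fact assms)+
  show ?thesis
    using prevalent_as_predictable prevalent_borel_invariant_prediction
      prevalent_continuous_prediction prevalent_continuous_borel_invariant_prediction
    by (intro conjI impI) (elim conjE; assumption | blast)+
qed

end
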